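(* Let $V$ be a finite-dimensional complex representation of a complex reductive group $G$ with $\mathbb{C}(V)^G=\operatorname{Frac}(\mathbb{C}[V]^G)$, and let $K=\overline{\mathbb{C}(V)^G}$. The extension subvariety associated to each closed point of $\mathcal{M}$ is a closed subvariety $Y\subset V$ such that the restriction map $\mathbb{C}[V]^G\to\mathbb{C}[Y]$ is injective and $\mathbb{C}[Y]$ is an algebraic ring extension of $\mathbb{C}[V]^G$. Conversely, every closed subvariety $Y\subset V$ with these two properties is the extension subvariety associated to a (possibly non-unique) closed point of $\mathcal{M}$.
   Context: Subvarieties are irreducible. $K$ is an algebraic closure of $\mathbb{C}(V)^G$. The extension parameter scheme is the $K$-scheme $\mathcal{M}=\operatorname{Spec}(\mathbb{C}[V]\otimes_{\mathbb{C}[V]^G}K)$, viewed as a closed subscheme of $\operatorname{Spec}(\mathbb{C}[V]\otimes_{\mathbb{C}}K)$. For a closed point $p\in\mathcal{M}$ with corresponding maximal ideal $\mathfrak{m}\subset\mathbb{C}[V]\otimes_{\mathbb{C}}K$, the associated extension subvariety $Y_p\subset V$ is the irreducible closed subvariety with coordinate ring $\mathbb{C}[Y_p]=\mathbb{C}[V]/(\mathfrak{m}\cap\mathbb{C}[V])$, where $\mathfrak{m}\cap\mathbb{C}[V]$ is the preimage of $\mathfrak m$ under $f\mapsto f\otimes 1$. *)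

theory Defs
  imports
    "HOL-Analysis.Determinants"
    "HOL-Library.Poly_Mapping"
    "HOL-Algebra.Algebraic_Closure"
begin

section \<open>Affine varieties in a complex vector space\<close>

text \<open>
  A complex vector space is a type together with a scalar multiplication, as in
  \<^theory>\<open>HOL.Vector_Spaces\<close>; dimension zero is allowed. The ring \<open>\<complex>[V]\<close> is realised as
  the ring of polynomial functions, generated by constants and linear functionals.
\<close>

inductive_set polynomial_functions ::
    "(complex \<Rightarrow> 'v::ab_group_add \<Rightarrow> 'v) \<Rightarrow> ('v \<Rightarrow> complex) set"
  for sc :: "complex \<Rightarrow> 'v::ab_group_add \<Rightarrow> 'v" where
  const: "(\<lambda>_. c) \<in> polynomial_functions sc"
| linear: "Vector_Spaces.linear sc (*) l \<Longrightarrow> l \<in> polynomial_functions sc"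
| add: "f \<in> polynomial_functions sc \<Longrightarrow> g \<in> polynomial_functions sc \<Longrightarrow>
    (\<lambda>v. f v + g v) \<in> polynomial_functions sc"
| mult: "f \<in> polynomial_functions sc \<Longrightarrow> g \<in> polynomial_functions sc \<Longrightarrow>
    (\<lambda>v. f v * g v) \<in> polynomial_functions sc"

definition coord_ring :: "(complex \<Rightarrow> 'v::ab_group_add \<Rightarrow> 'v) \<Rightarrow> ('v \<Rightarrow> complex) ring" where
  "coord_ring sc =
    \<lparr>carrier = polynomial_functions sc,
     mult = (\<lambda>f g v. f v * g v), one = (\<lambda>_. 1),
     zero = (\<lambda>_. 0), add = (\<lambda>f g v. f v + g v)\<rparr>"

definition zariski_closed :: "(complex \<Rightarrow> 'v::ab_group_add \<Rightarrow> 'v) \<Rightarrow> 'v set \<Rightarrow> bool" where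
  "zariski_closed sc Y \<longleftrightarrow>
    (\<exists>F \<subseteq> polynomial_functions sc. Y = {v. \<forall>f\<in>F. f v = 0})"

definition closed_subvariety :: "(complex \<Rightarrow> 'v::ab_group_add \<Rightarrow> 'v) \<Rightarrow> 'v set \<Rightarrow> bool" where
  "closed_subvariety sc Y \<longleftrightarrow> zariski_closed sc Y \<and> Y \<noteq> {} \<and>
    (\<forall>A B. zariski_closed sc A \<longrightarrow> zariski_closed sc B \<longrightarrow> Y \<subseteq> A \<union> B \<longrightarrow> Y \<subseteq> A \<or> Y \<subseteq> B)"

definition vanishing_ideal ::
    "(complex \<Rightarrow> 'v::ab_group_add \<Rightarrow> 'v) \<Rightarrow> 'v set \<Rightarrow> ('v \<Rightarrow> complex) set" where
  "vanishing_ideal sc Y = {f \<in> polynomial_functions sc. \<forall>v\<in>Y. f v = 0}"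

definition subvariety_ring ::
    "(complex \<Rightarrow> 'v::ab_group_add \<Rightarrow> 'v) \<Rightarrow> 'v set \<Rightarrow> ('v \<Rightarrow> complex) set ring" where
  "subvariety_ring sc Y = coord_ring sc Quot vanishing_ideal sc Y"

definition restriction ::
    "(complex \<Rightarrow> 'v::ab_group_add \<Rightarrow> 'v) \<Rightarrow> 'v set \<Rightarrow> ('v \<Rightarrow> complex) \<Rightarrow> ('v \<Rightarrow> complex) set" where
  "restriction sc Y f = vanishing_ideal sc Y +>\<^bsub>coord_ring sc\<^esub> f"


section \<open>Reductive groups and their representations\<close>

definition matrix_scale :: "complex \<Rightarrow> complex^'m^'m \<Rightarrow> complex^'m^'m" where
  "matrix_scale c A = (\<chi> i j. c * A $ i $ j)"

text \<open>Zariski closed subgroups of \<open>GL\<^sub>m(\<complex>)\<close>\<close>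

definition linear_algebraic_group :: "(complex^'m^'m) set \<Rightarrow> bool" where
  "linear_algebraic_group G \<longleftrightarrow>
    (\<exists>Z. zariski_closed matrix_scale Z \<and> G = {A \<in> Z. invertible A}) \<and>
    mat 1 \<in> G \<and> (\<forall>g\<in>G. \<forall>h\<in>G. g ** h \<in> G) \<and> (\<forall>g\<in>G. matrix_inv g \<in> G)"

definition zariski_connected :: "(complex^'m^'m) set \<Rightarrow> bool" where
  "zariski_connected H \<longleftrightarrow>
    \<not> (\<exists>A B. zariski_closed matrix_scale A \<and> zariski_closed matrix_scale B \<and>
        H \<subseteq> A \<union> B \<and> H \<inter> A \<inter> B = {} \<and> H \<inter> A \<noteq> {} \<and> H \<inter> B \<noteq> {})"

text \<open>
  The powers of \<open>g - 1\<close> are spelled out with \<open>**\<close>, because \<open>^\<close> is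
  componentwise on this type.
\<close>

definition unipotent :: "complex^'m^'m \<Rightarrow> bool" where
  "unipotent g \<longleftrightarrow> (\<exists>k. (((**) (g - mat 1)) ^^ k) (mat 1) = 0)"

text \<open>
  Reductive means that the unipotent radical, i.e. the largest connected normal unipotent closed
  subgroup, is trivial. The group itself need not be connected.
\<close>

definition reductive_group :: "(complex^'m^'m) set \<Rightarrow> bool" where
  "reductive_group G \<longleftrightarrow> linear_algebraic_group G \<and>
    (\<forall>H \<subseteq> G. linear_algebraic_group H \<and> zariski_connected H \<and>
        (\<forall>g\<in>G. \<forall>h\<in>H. g ** h ** matrix_inv g \<in> H) \<and> (\<forall>h\<in>H. unipotent h)
      \<longrightarrow> H = {mat 1})"

text \<open>
  Algebraic representations: the matrix coefficients are regular functions on \<open>G\<close>, that is,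
  polynomials in the matrix entries divided by powers of the determinant.
\<close>

definition rational_representation ::
    "(complex \<Rightarrow> 'v::ab_group_add \<Rightarrow> 'v) \<Rightarrow> (complex^'m^'m) set \<Rightarrow> (complex^'m^'m \<Rightarrow> 'v \<Rightarrow> 'v) \<Rightarrow> bool"
  where
  "rational_representation sc G \<rho> \<longleftrightarrow>
    (\<forall>g\<in>G. Vector_Spaces.linear sc sc (\<rho> g)) \<and>
    \<rho> (mat 1) = id \<and> (\<forall>g\<in>G. \<forall>h\<in>G. \<rho> (g ** h) = \<rho> g \<circ> \<rho> h) \<and>
    (\<forall>v l. Vector_Spaces.linear sc (*) l \<longrightarrow>
      (\<exists>p \<in> polynomial_functions matrix_scale. \<exists>k::nat. \<forall>g\<in>G. l (\<rho> g v) = p g / det g ^ k))"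

definition act :: "(complex^'m^'m \<Rightarrow> 'v \<Rightarrow> 'v) \<Rightarrow> complex^'m^'m \<Rightarrow> ('v \<Rightarrow> complex) \<Rightarrow> 'v \<Rightarrow> complex"
  where "act \<rho> g f = (\<lambda>v. f (\<rho> (matrix_inv g) v))"

definition invariants ::
    "(complex \<Rightarrow> 'v::ab_group_add \<Rightarrow> 'v) \<Rightarrow> (complex^'m^'m) set \<Rightarrow> (complex^'m^'m \<Rightarrow> 'v \<Rightarrow> 'v)
      \<Rightarrow> ('v \<Rightarrow> complex) set" where
  "invariants sc G \<rho> = {f \<in> polynomial_functions sc. \<forall>g\<in>G. act \<rho> g f = f}"


section \<open>Fraction fields and rational invariants\<close>

text \<open>The fraction \<open>a / b\<close> over a domain, as an equivalence class of pairs\<close>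

definition fraction :: "('a, 'x) ring_scheme \<Rightarrow> 'a \<Rightarrow> 'a \<Rightarrow> ('a \<times> 'a) set" where
  "fraction D a b =
    {(c, d). c \<in> carrier D \<and> d \<in> carrier D - {\<zero>\<^bsub>D\<^esub>} \<and> a \<otimes>\<^bsub>D\<^esub> d = c \<otimes>\<^bsub>D\<^esub> b}"

definition fraction_field :: "('a, 'x) ring_scheme \<Rightarrow> ('a \<times> 'a) set ring" where
  "fraction_field D =
    \<lparr>carrier = {fraction D a b | a b. a \<in> carrier D \<and> b \<in> carrier D - {\<zero>\<^bsub>D\<^esub>}},
     mult = (\<lambda>P Q. \<Union>(a, b)\<in>P. \<Union>(c, d)\<in>Q. fraction D (a \<otimes>\<^bsub>D\<^esub> c) (b \<otimes>\<^bsub>D\<^esub> d)),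
     one = fraction D \<one>\<^bsub>D\<^esub> \<one>\<^bsub>D\<^esub>,
     zero = fraction D \<zero>\<^bsub>D\<^esub> \<one>\<^bsub>D\<^esub>,
     add = (\<lambda>P Q. \<Union>(a, b)\<in>P. \<Union>(c, d)\<in>Q.
       fraction D (a \<otimes>\<^bsub>D\<^esub> d \<oplus>\<^bsub>D\<^esub> c \<otimes>\<^bsub>D\<^esub> b) (b \<otimes>\<^bsub>D\<^esub> d))\<rparr>"

text \<open>
  A group element acts on \<open>\<complex>[V]\<close> by a ring automorphism, so the image of the class \<open>a / b\<close>
  under the action on pairs is exactly the class \<open>g\<cdot>a / g\<cdot>b\<close>.
\<close>

definition rational_invariants ::
    "(complex \<Rightarrow> 'v::ab_group_add \<Rightarrow> 'v) \<Rightarrow> (complex^'m^'m) set \<Rightarrow> (complex^'m^'m \<Rightarrow> 'v \<Rightarrow> 'v)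
      \<Rightarrow> (('v \<Rightarrow> complex) \<times> ('v \<Rightarrow> complex)) set set" where
  "rational_invariants sc G \<rho> =
    {P \<in> carrier (fraction_field (coord_ring sc)).
      \<forall>g\<in>G. map_prod (act \<rho> g) (act \<rho> g) ` P = P}"

definition rational_invariant_field ::
    "(complex \<Rightarrow> 'v::ab_group_add \<Rightarrow> 'v) \<Rightarrow> (complex^'m^'m) set \<Rightarrow> (complex^'m^'m \<Rightarrow> 'v \<Rightarrow> 'v)
      \<Rightarrow> (('v \<Rightarrow> complex) \<times> ('v \<Rightarrow> complex)) set ring" where
  "rational_invariant_field sc G \<rho> =
    (fraction_field (coord_ring sc)) \<lparr>carrier := rational_invariants sc G \<rho>\<rparr>"

text \<open>\<open>Frac(\<complex>[V]\<^sup>G)\<close> as a subset of \<open>\<complex>(V)\<close>\<close>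

definition fractions_of_invariants ::
    "(complex \<Rightarrow> 'v::ab_group_add \<Rightarrow> 'v) \<Rightarrow> (complex^'m^'m) set \<Rightarrow> (complex^'m^'m \<Rightarrow> 'v \<Rightarrow> 'v)
      \<Rightarrow> (('v \<Rightarrow> complex) \<times> ('v \<Rightarrow> complex)) set set" where
  "fractions_of_invariants sc G \<rho> =
    {fraction (coord_ring sc) a b | a b.
      a \<in> invariants sc G \<rho> \<and> b \<in> invariants sc G \<rho> - {\<lambda>_. 0}}"


section \<open>Tensor products of commutative algebras\<close>

text \<open>
  The free abelian group on \<open>A \<times> B\<close>, with multiplication extended bilinearly from
  \<open>(a, b) (a', b') = (a a', b b')\<close>.
\<close>

definition pair_ring :: "('a, 'x) ring_scheme \<Rightarrow> ('b, 'y) ring_scheme \<Rightarrow> ('a \<times> 'b \<Rightarrow>\<^sub>0 int) ring" where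
  "pair_ring A B =
    \<lparr>carrier = {c. Poly_Mapping.keys c \<subseteq> carrier A \<times> carrier B},
     mult = (\<lambda>c d. frag_extend (\<lambda>(a, b). frag_extend (\<lambda>(a', b').
       frag_of (a \<otimes>\<^bsub>A\<^esub> a', b \<otimes>\<^bsub>B\<^esub> b')) d) c),
     one = frag_of (\<one>\<^bsub>A\<^esub>, \<one>\<^bsub>B\<^esub>),
     zero = 0, add = (+)\<rparr>"

text \<open>
  The relations of \<open>A \<otimes>\<^sub>S B\<close>, where the base ring has underlying set \<open>S\<close> and the algebra
  structures are given by ring homomorphisms \<open>\<phi> : S \<rightarrow> A\<close> and \<open>\<psi> : S \<rightarrow> B\<close>.
\<close>

definition tensor_ideal ::
    "'s set \<Rightarrow> ('s \<Rightarrow> 'a) \<Rightarrow> ('s \<Rightarrow> 'b) \<Rightarrow> ('a, 'x) ring_scheme \<Rightarrow> ('b, 'y) ring_scheme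
      \<Rightarrow> ('a \<times> 'b \<Rightarrow>\<^sub>0 int) set" where
  "tensor_ideal S \<phi> \<psi> A B = Idl\<^bsub>pair_ring A B\<^esub>
    ({frag_of (a \<oplus>\<^bsub>A\<^esub> a', b) - frag_of (a, b) - frag_of (a', b) | a a' b.
        a \<in> carrier A \<and> a' \<in> carrier A \<and> b \<in> carrier B} \<union>
     {frag_of (a, b \<oplus>\<^bsub>B\<^esub> b') - frag_of (a, b) - frag_of (a, b') | a b b'.
        a \<in> carrier A \<and> b \<in> carrier B \<and> b' \<in> carrier B} \<union>
     {frag_of (\<phi> s \<otimes>\<^bsub>A\<^esub> a, b) - frag_of (a, \<psi> s \<otimes>\<^bsub>B\<^esub> b) | s a b.
        s \<in> S \<and> a \<in> carrier A \<and> b \<in> carrier B})"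

definition tensor_ring ::
    "'s set \<Rightarrow> ('s \<Rightarrow> 'a) \<Rightarrow> ('s \<Rightarrow> 'b) \<Rightarrow> ('a, 'x) ring_scheme \<Rightarrow> ('b, 'y) ring_scheme
      \<Rightarrow> ('a \<times> 'b \<Rightarrow>\<^sub>0 int) set ring" where
  "tensor_ring S \<phi> \<psi> A B = pair_ring A B Quot tensor_ideal S \<phi> \<psi> A B"

definition pure_tensor ::
    "'s set \<Rightarrow> ('s \<Rightarrow> 'a) \<Rightarrow> ('s \<Rightarrow> 'b) \<Rightarrow> ('a, 'x) ring_scheme \<Rightarrow> ('b, 'y) ring_scheme
      \<Rightarrow> 'a \<Rightarrow> 'b \<Rightarrow> ('a \<times> 'b \<Rightarrow>\<^sub>0 int) set" where
  "pure_tensor S \<phi> \<psi> A B a b = tensor_ideal S \<phi> \<psi> A B +>\<^bsub>pair_ring A B\<^esub> frag_of (a, b)"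


section \<open>The extension parameter scheme and extension subvarieties\<close>

text \<open>
  Throughout, \<open>\<iota>\<close> is the embedding of \<open>\<complex>(V)\<^sup>G\<close> into its algebraic closure \<open>K\<close>. It makes \<open>K\<close>
  an algebra over \<open>\<complex>[V]\<^sup>G\<close>, and over \<open>\<complex>\<close> through the constant functions.
\<close>

definition invariant_to_K ::
    "(complex \<Rightarrow> 'v::ab_group_add \<Rightarrow> 'v) \<Rightarrow> ((('v \<Rightarrow> complex) \<times> ('v \<Rightarrow> complex)) set \<Rightarrow> 'k)
      \<Rightarrow> ('v \<Rightarrow> complex) \<Rightarrow> 'k" where
  "invariant_to_K sc \<iota> f = \<iota> (fraction (coord_ring sc) f (\<lambda>_. 1))"

text \<open>\<open>\<complex>[V] \<otimes>\<^sub>\<complex> K\<close> and \<open>\<complex>[V] \<otimes>\<^sub>R K\<close> with \<open>R = \<complex>[V]\<^sup>G\<close>\<close>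

definition tensor_over_complex ::
    "(complex \<Rightarrow> 'v::ab_group_add \<Rightarrow> 'v) \<Rightarrow> 'k ring
      \<Rightarrow> ((('v \<Rightarrow> complex) \<times> ('v \<Rightarrow> complex)) set \<Rightarrow> 'k)
      \<Rightarrow> (('v \<Rightarrow> complex) \<times> 'k \<Rightarrow>\<^sub>0 int) set ring" where
  "tensor_over_complex sc K \<iota> =
    tensor_ring UNIV (\<lambda>c _. c) (\<lambda>c. invariant_to_K sc \<iota> (\<lambda>_. c)) (coord_ring sc) K"

definition tensor_over_invariants ::
    "(complex \<Rightarrow> 'v::ab_group_add \<Rightarrow> 'v) \<Rightarrow> (complex^'m^'m) set \<Rightarrow> (complex^'m^'m \<Rightarrow> 'v \<Rightarrow> 'v)
      \<Rightarrow> 'k ring \<Rightarrow> ((('v \<Rightarrow> complex) \<times> ('v \<Rightarrow> complex)) set \<Rightarrow> 'k)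
      \<Rightarrow> (('v \<Rightarrow> complex) \<times> 'k \<Rightarrow>\<^sub>0 int) set ring" where
  "tensor_over_invariants sc G \<rho> K \<iota> =
    tensor_ring (invariants sc G \<rho>) id (invariant_to_K sc \<iota>) (coord_ring sc) K"

text \<open>
  The canonical surjection \<open>\<complex>[V] \<otimes>\<^sub>\<complex> K \<rightarrow> \<complex>[V] \<otimes>\<^sub>R K\<close>. Both rings are quotients of the same
  ring, and the second ideal contains the first, so each coset of the first lies in exactly one
  coset of the second.
\<close>

definition change_of_base ::
    "(complex \<Rightarrow> 'v::ab_group_add \<Rightarrow> 'v) \<Rightarrow> (complex^'m^'m) set \<Rightarrow> (complex^'m^'m \<Rightarrow> 'v \<Rightarrow> 'v)
      \<Rightarrow> 'k ring \<Rightarrow> ((('v \<Rightarrow> complex) \<times> ('v \<Rightarrow> complex)) set \<Rightarrow> 'k)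
      \<Rightarrow> (('v \<Rightarrow> complex) \<times> 'k \<Rightarrow>\<^sub>0 int) set \<Rightarrow> (('v \<Rightarrow> complex) \<times> 'k \<Rightarrow>\<^sub>0 int) set" where
  "change_of_base sc G \<rho> K \<iota> P = the_elem
    ((\<lambda>c. tensor_ideal (invariants sc G \<rho>) id (invariant_to_K sc \<iota>) (coord_ring sc) K
        +>\<^bsub>pair_ring (coord_ring sc) K\<^esub> c) ` P)"

text \<open>
  Closed points of an affine scheme are the maximal ideals of its coordinate ring.
\<close>

definition closed_points ::
    "(complex \<Rightarrow> 'v::ab_group_add \<Rightarrow> 'v) \<Rightarrow> (complex^'m^'m) set \<Rightarrow> (complex^'m^'m \<Rightarrow> 'v \<Rightarrow> 'v)
      \<Rightarrow> 'k ring \<Rightarrow> ((('v \<Rightarrow> complex) \<times> ('v \<Rightarrow> complex)) set \<Rightarrow> 'k)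
      \<Rightarrow> (('v \<Rightarrow> complex) \<times> 'k \<Rightarrow>\<^sub>0 int) set set set" where
  "closed_points sc G \<rho> K \<iota> = {p. maximalideal p (tensor_over_invariants sc G \<rho> K \<iota>)}"

text \<open>
  The maximal ideal \<open>\<mm>\<close> of \<open>\<complex>[V] \<otimes>\<^sub>\<complex> K\<close> corresponding to a closed point of the closed
  subscheme \<open>\<M>\<close>, and its preimage \<open>\<mm> \<inter> \<complex>[V]\<close> under \<open>f \<mapsto> f \<otimes> 1\<close>
\<close>

definition point_ideal ::
    "(complex \<Rightarrow> 'v::ab_group_add \<Rightarrow> 'v) \<Rightarrow> (complex^'m^'m) set \<Rightarrow> (complex^'m^'m \<Rightarrow> 'v \<Rightarrow> 'v)
      \<Rightarrow> 'k ring \<Rightarrow> ((('v \<Rightarrow> complex) \<times> ('v \<Rightarrow> complex)) set \<Rightarrow> 'k)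
      \<Rightarrow> (('v \<Rightarrow> complex) \<times> 'k \<Rightarrow>\<^sub>0 int) set set \<Rightarrow> (('v \<Rightarrow> complex) \<times> 'k \<Rightarrow>\<^sub>0 int) set set" where
  "point_ideal sc G \<rho> K \<iota> p =
    {P \<in> carrier (tensor_over_complex sc K \<iota>). change_of_base sc G \<rho> K \<iota> P \<in> p}"

definition contraction ::
    "(complex \<Rightarrow> 'v::ab_group_add \<Rightarrow> 'v) \<Rightarrow> 'k ring
      \<Rightarrow> ((('v \<Rightarrow> complex) \<times> ('v \<Rightarrow> complex)) set \<Rightarrow> 'k)
      \<Rightarrow> (('v \<Rightarrow> complex) \<times> 'k \<Rightarrow>\<^sub>0 int) set set \<Rightarrow> ('v \<Rightarrow> complex) set" where
  "contraction sc K \<iota> m = {f \<in> polynomial_functions sc.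
    pure_tensor UNIV (\<lambda>c _. c) (\<lambda>c. invariant_to_K sc \<iota> (\<lambda>_. c)) (coord_ring sc) K f \<one>\<^bsub>K\<^esub> \<in> m}"

text \<open>
  \<open>\<complex>[Y] = \<complex>[V] / (\<mm> \<inter> \<complex>[V])\<close> as quotients of \<open>\<complex>[V]\<close>, i.e. the vanishing ideal of \<open>Y\<close> is
  \<open>\<mm> \<inter> \<complex>[V]\<close>.
\<close>

definition is_extension_subvariety ::
    "(complex \<Rightarrow> 'v::ab_group_add \<Rightarrow> 'v) \<Rightarrow> (complex^'m^'m) set \<Rightarrow> (complex^'m^'m \<Rightarrow> 'v \<Rightarrow> 'v)
      \<Rightarrow> 'k ring \<Rightarrow> ((('v \<Rightarrow> complex) \<times> ('v \<Rightarrow> complex)) set \<Rightarrow> 'k)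
      \<Rightarrow> (('v \<Rightarrow> complex) \<times> 'k \<Rightarrow>\<^sub>0 int) set set \<Rightarrow> 'v set \<Rightarrow> bool" where
  "is_extension_subvariety sc G \<rho> K \<iota> p Y \<longleftrightarrow> closed_subvariety sc Y \<and>
    vanishing_ideal sc Y = contraction sc K \<iota> (point_ideal sc G \<rho> K \<iota> p)"

definition restriction_injective ::
    "(complex \<Rightarrow> 'v::ab_group_add \<Rightarrow> 'v) \<Rightarrow> (complex^'m^'m) set \<Rightarrow> (complex^'m^'m \<Rightarrow> 'v \<Rightarrow> 'v)
      \<Rightarrow> 'v set \<Rightarrow> bool" where
  "restriction_injective sc G \<rho> Y \<longleftrightarrow> inj_on (restriction sc Y) (invariants sc G \<rho>)"

text \<open>
  \<open>\<complex>[Y]\<close> is algebraic over the image of \<open>\<complex>[V]\<^sup>G\<close>: each element is a root of a nonzero, not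
  necessarily monic, polynomial over that subring.
\<close>

definition algebraic_over_invariants ::
    "(complex \<Rightarrow> 'v::ab_group_add \<Rightarrow> 'v) \<Rightarrow> (complex^'m^'m) set \<Rightarrow> (complex^'m^'m \<Rightarrow> 'v \<Rightarrow> 'v)
      \<Rightarrow> 'v set \<Rightarrow> bool" where
  "algebraic_over_invariants sc G \<rho> Y \<longleftrightarrow>
    (\<forall>x \<in> carrier (subvariety_ring sc Y).
      ring.algebraic (subvariety_ring sc Y) (restriction sc Y ` invariants sc G \<rho>) x)"

end

theory Submission
  imports "HOL-Algebra.Algebraic_Closure_Type" Defs
begin

text \<open>
  Write \<open>A = \<complex>[V]\<close> and \<open>R = \<complex>[V]\<^sup>G\<close>. A maximal ideal of \<open>A \<otimes>\<^sub>R K\<close> has residue field \<open>K\<close>, because \<open>K\<close> is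
  algebraically closed and \<open>A\<close> is finitely generated; so closed points correspond to homomorphisms
  \<open>\<eta> : A \<rightarrow> K\<close> extending \<open>R \<rightarrow> K\<close>, and the contraction of a point is \<open>ker \<eta>\<close>. The ring \<open>A / ker \<eta>\<close> lies in
  \<open>K\<close>, which is algebraic over the fractions of \<open>R\<close>. Conversely, if \<open>\<complex>[Y]\<close> is algebraic over \<open>R\<close>, then
  \<open>R \<rightarrow> K\<close> extends to \<open>\<complex>[Y] \<rightarrow> K\<close>, and algebraicity makes the extension injective.

  The residue field statement, the Nullstellensatz for \<open>ker \<eta>\<close> and the extension to \<open>\<complex>[Y]\<close> are instances
  of one fact: if a domain \<open>E\<close> is finitely generated over \<open>D\<close>, then for every nonzero \<open>b \<in> E\<close> there is a
  nonzero \<open>a \<in> D\<close> such that every homomorphism from \<open>D\<close> to an algebraically closed field which does not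
  kill \<open>a\<close> extends to \<open>E\<close> without killing \<open>b\<close>.
\<close>

section \<open>Extending homomorphisms to algebraically closed fields\<close>

text \<open>The clause about \<open>b\<close> in the extension statement is what makes induction on
  the generators possible: the nonzero element found for the last generator serves as
  \<open>b\<close> for the ring generated by the preceding ones. The three instances differ in their
  data. For the Nullstellensatz the base is the field of complex numbers, the map to extend is the
  identity, and \<open>b\<close> is the value that has to survive at the sought point. For the
  residue field the base is \<open>K\<close>, again with the identity; the result is a retraction
  onto \<open>K\<close>, injective because its source is a field. For C[Y] the base is the ring of
  invariants and the map is R -> K, whose injectivity keeps it from killing \<open>a\<close>. The
  hypothesis on C(V)^G turns elements of the field over which \<open>K\<close> is algebraic into
  quotients of invariants, so that denominators can be cleared in an algebraic relation. Algebraic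
  closedness is encoded by finite sums because it is applied both to the complex numbers, a field
  given by a type, and to \<open>K\<close>, whose polynomials are coefficient lists, while the
  extension step evaluates polynomials of \<open>UP\<close>.\<close>

definition has_roots :: "('a, 'm) ring_scheme \<Rightarrow> bool" where
  "has_roots \<Omega> \<longleftrightarrow> (\<forall>n c. n > 0 \<longrightarrow> c \<in> {..n} \<rightarrow> carrier \<Omega> \<longrightarrow> c n \<noteq> \<zero>\<^bsub>\<Omega>\<^esub> \<longrightarrow>
     (\<exists>z\<in>carrier \<Omega>. (\<Oplus>\<^bsub>\<Omega>\<^esub>i\<in>{..n::nat}. c i \<otimes>\<^bsub>\<Omega>\<^esub> z [^]\<^bsub>\<Omega>\<^esub> i) = \<zero>\<^bsub>\<Omega>\<^esub>))"

lemma has_rootsD: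
  assumes "has_roots \<Omega>" "n > 0" "c \<in> {..n} \<rightarrow> carrier \<Omega>" "c n \<noteq> \<zero>\<^bsub>\<Omega>\<^esub>"
  obtains z where "z \<in> carrier \<Omega>" "(\<Oplus>\<^bsub>\<Omega>\<^esub>i\<in>{..n::nat}. c i \<otimes>\<^bsub>\<Omega>\<^esub> z [^]\<^bsub>\<Omega>\<^esub> i) = \<zero>\<^bsub>\<Omega>\<^esub>"
  using assms unfolding has_roots_def by blast

text \<open>A root \<open>z\<close> of \<open>1 + X f\<close> satisfies \<open>f z \<noteq> 0\<close>.\<close>

lemma (in field) has_roots_imp_nonroot:
  assumes roots: "has_roots R" and c: "c \<in> {..n} \<rightarrow> carrier R" and cn: "c n \<noteq> \<zero>"
  obtains z where "z \<in> carrier R" "(\<Oplus>i\<in>{..n::nat}. c i \<otimes> z [^] i) \<noteq> \<zero>"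
proof -
  \<comment> \<open>The shift raises the degree by one, so \<open>has_roots\<close> also applies
    when f is constant and \<open>n = 0\<close>.\<close>
  define d where "d = (\<lambda>i. if i = 0 then \<one> else c (i - 1))"
  have d: "d \<in> {..Suc n} \<rightarrow> carrier R"
    using c by (auto simp: d_def Pi_iff)
  obtain z where z: "z \<in> carrier R" "(\<Oplus>i\<in>{..Suc n}. d i \<otimes> z [^] i) = \<zero>"
    using has_rootsD[OF roots _ d] cn by (auto simp: d_def)
  have "(\<Oplus>i\<in>{..Suc n}. d i \<otimes> z [^] i) = (\<Oplus>i\<in>{..n}. d (Suc i) \<otimes> z [^] Suc i) \<oplus> d 0 \<otimes> z [^] (0::nat)"
    using d z by (intro finsum_Suc2) auto
  also have "(\<Oplus>i\<in>{..n}. d (Suc i) \<otimes> z [^] Suc i) = (\<Oplus>i\<in>{..n}. (c i \<otimes> z [^] i) \<otimes> z)"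
    using c z by (intro finsum_cong') (auto simp: d_def Pi_iff m_assoc)
  also have "\<dots> = (\<Oplus>i\<in>{..n}. c i \<otimes> z [^] i) \<otimes> z"
    using c z by (intro finsum_ldistr[symmetric]) (auto simp: Pi_iff)
  finally have "(\<Oplus>i\<in>{..n}. c i \<otimes> z [^] i) \<otimes> z \<oplus> \<one> = \<zero>"
    using z by (simp add: d_def)
  then have "(\<Oplus>i\<in>{..n}. c i \<otimes> z [^] i) \<noteq> \<zero>"
    using z one_not_zero by auto
  with z that show thesis by blast
qed

text \<open>Two preimages of the same element differ by an element of the kernel of
  \<open>f\<close>, which \<open>g\<close> kills, so an arbitrary choice of preimage is harmless.
  The image of \<open>f\<close> takes the place of the quotient by its kernel because the extensions
  are defined on subrings of a fixed ring.\<close>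

lemma ring_hom_factor:
  assumes "ring P" "ring E" "ring S"
    and f: "f \<in> ring_hom P E" and g: "g \<in> ring_hom P S"
    and ker: "\<And>p. p \<in> carrier P \<Longrightarrow> f p = \<zero>\<^bsub>E\<^esub> \<Longrightarrow> g p = \<zero>\<^bsub>S\<^esub>"
  obtains \<psi> where "\<psi> \<in> ring_hom (E\<lparr>carrier := f ` carrier P\<rparr>) S"
    "\<And>p. p \<in> carrier P \<Longrightarrow> \<psi> (f p) = g p"
proof -
  interpret F: ring_hom_ring P E f by (rule ring_hom_ringI2) fact+
  interpret G: ring_hom_ring P S g by (rule ring_hom_ringI2) fact+
  define \<psi> where "\<psi> = (\<lambda>y. g (inv_into (carrier P) f y))"
  have eq: "\<psi> (f p) = g p" if p: "p \<in> carrier P" for p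
  proof -
    define q where "q = inv_into (carrier P) f (f p)"
    have q: "q \<in> carrier P" "f q = f p"
      using p by (auto simp: q_def inv_into_into f_inv_into_f)
    have "f (q \<ominus>\<^bsub>P\<^esub> p) = \<zero>\<^bsub>E\<^esub>"
      using p q by (simp add: a_minus_def F.S.r_neg)
    then have "g (q \<ominus>\<^bsub>P\<^esub> p) = \<zero>\<^bsub>S\<^esub>"
      using p q by (intro ker) auto
    then have "g q = g p"
      using p q by (simp add: a_minus_def) (metis F.R.add.inv_closed G.S.minus_equality G.S.minus_minus G.hom_a_inv G.hom_closed)
    then show ?thesis by (simp add: \<psi>_def q_def)
  qed
  have "\<psi> \<in> ring_hom (E\<lparr>carrier := f ` carrier P\<rparr>) S"
  proof (rule ring_hom_memI; clarsimp)
    fix p assume "p \<in> carrier P"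
    then show "\<psi> (f p) \<in> carrier S" by (simp add: eq)
  next
    fix p q assume "p \<in> carrier P" "q \<in> carrier P"
    then show "\<psi> (f p \<otimes>\<^bsub>E\<^esub> f q) = \<psi> (f p) \<otimes>\<^bsub>S\<^esub> \<psi> (f q)"
      "\<psi> (f p \<oplus>\<^bsub>E\<^esub> f q) = \<psi> (f p) \<oplus>\<^bsub>S\<^esub> \<psi> (f q)"
      using eq[of "p \<otimes>\<^bsub>P\<^esub> q"] eq[of "p \<oplus>\<^bsub>P\<^esub> q"] by (auto simp: eq)
  next
    show "\<psi> \<one>\<^bsub>E\<^esub> = \<one>\<^bsub>S\<^esub>" using eq[of "\<one>\<^bsub>P\<^esub>"] by simp
  qed
  with eq that show thesis by blast
qed

lemma UP_const_of_deg_zero: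
  fixes D (structure)
  assumes "cring D" "p \<in> carrier (UP D)" "deg D p = 0"
  obtains c where "c \<in> carrier D" "p = up_ring.monom (UP D) c 0"
proof -
  interpret UP_cring D "UP D" by (simp add: UP_cring_def assms)
  from deg_zero_impl_monom[OF assms(2,3)] coeff_closed[OF assms(2)] that show thesis by blast
qed

text \<open>
  If \<open>x\<close> is transcendental over \<open>D\<close>, take for \<open>a\<close> the leading coefficient of a polynomial \<open>\<beta>\<close> with
  \<open>b = \<beta>(x)\<close>. Otherwise let \<open>q\<close> be a relation of minimal degree for \<open>x\<close>. Pseudo-division shows that a
  non-vanishing multiple of \<open>b\<close> of minimal degree in \<open>x\<close> is a constant \<open>c \<in> D\<close>, and \<open>a\<close> is the product
  of \<open>c\<close> with the leading coefficient of \<open>q\<close>: a root of the image of \<open>q\<close> is then a valid value for \<open>x\<close>.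
\<close>

lemma simple_hom_extension:
  assumes D: "domain D" and E: "domain E" and i: "i \<in> ring_hom D E" "inj_on i (carrier D)"
    and x: "x \<in> carrier E" and \<Omega>: "field \<Omega>" "has_roots \<Omega>"
    and T: "T = UnivPoly.eval D E i x ` carrier (UP D)"
    and b: "b \<in> T" "b \<noteq> \<zero>\<^bsub>E\<^esub>"
  shows "\<exists>a\<in>carrier D. a \<noteq> \<zero>\<^bsub>D\<^esub> \<and> (\<forall>\<phi>\<in>ring_hom D \<Omega>. \<phi> a \<noteq> \<zero>\<^bsub>\<Omega>\<^esub> \<longrightarrow>
    (\<exists>\<psi>\<in>ring_hom (E\<lparr>carrier := T\<rparr>) \<Omega>. (\<forall>d\<in>carrier D. \<psi> (i d) = \<phi> d) \<and> \<psi> b \<noteq> \<zero>\<^bsub>\<Omega>\<^esub>))"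
proof -
  let ?P = "UP D"
  interpret D: domain D by fact
  interpret E: domain E by fact
  interpret \<Omega>: field \<Omega> by fact
  interpret U: UP_pre_univ_prop D E i ?P
    using UP_pre_univ_propI[OF D.is_cring E.is_cring i(1)] .
  interpret UD: UP_domain D ?P by (simp add: UP_domain_def D)
  define ev where "ev = UnivPoly.eval D E i x"
  have ev: "ev \<in> ring_hom ?P E"
    using U.eval_ring_hom[OF x] by (simp add: ev_def)
  interpret ev: ring_hom_ring ?P E ev
    by (rule ring_hom_ringI2[OF U.P.ring_axioms E.ring_axioms ev])
  have ev_const: "ev (up_ring.monom ?P d 0) = i d" if "d \<in> carrier D" for d
    using U.eval_const[OF x that] by (simp add: ev_def)
  have ev_smult: "ev (d \<odot>\<^bsub>?P\<^esub> p) = i d \<otimes>\<^bsub>E\<^esub> ev p" if "d \<in> carrier D" "p \<in> carrier ?P" for d p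
    using that by (simp add: U.monom_mult_is_smult[symmetric] ev_const)
  have i0: "i d = \<zero>\<^bsub>E\<^esub> \<longleftrightarrow> d = \<zero>\<^bsub>D\<^esub>" if "d \<in> carrier D" for d
    using i(2) that by (metis D.zero_closed U.hom_zero inj_onD)
  have lc: "up_ring.coeff ?P p (deg D p) \<in> carrier D" if "p \<in> carrier ?P" for p
    using that by simp
  have lc0: "up_ring.coeff ?P p (deg D p) \<noteq> \<zero>\<^bsub>D\<^esub>" if "p \<in> carrier ?P" "p \<noteq> \<zero>\<^bsub>?P\<^esub>" for p
    using that U.lcoeff_nonzero by blast
  obtain \<beta> where \<beta>: "\<beta> \<in> carrier ?P" "b = ev \<beta>"
    using b T by (auto simp: ev_def)
  have \<beta>0: "\<beta> \<noteq> \<zero>\<^bsub>?P\<^esub>" using \<beta> b by auto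
  have T': "T = ev ` carrier ?P" using T by (simp add: ev_def)
  \<comment> \<open>A value \<open>z\<close> for \<open>x\<close> defines an extension to D[x] as
    soon as every relation satisfied by \<open>x\<close> over \<open>D\<close> becomes one satisfied
    by \<open>z\<close>. Both cases below therefore only look for \<open>z\<close>.\<close>
  have ext: "\<exists>\<psi>\<in>ring_hom (E\<lparr>carrier := T\<rparr>) \<Omega>. (\<forall>d\<in>carrier D. \<psi> (i d) = \<phi> d) \<and>
      (\<forall>p\<in>carrier ?P. \<psi> (ev p) = UnivPoly.eval D \<Omega> \<phi> z p)"
    if \<phi>: "\<phi> \<in> ring_hom D \<Omega>" and z: "z \<in> carrier \<Omega>"
      and ker: "\<And>p. p \<in> carrier ?P \<Longrightarrow> ev p = \<zero>\<^bsub>E\<^esub> \<Longrightarrow> UnivPoly.eval D \<Omega> \<phi> z p = \<zero>\<^bsub>\<Omega>\<^esub>" for \<phi> z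
  proof -
    interpret V: UP_pre_univ_prop D \<Omega> \<phi> ?P
      using UP_pre_univ_propI[OF D.is_cring \<Omega>.is_cring \<phi>] .
    obtain \<psi> where \<psi>: "\<psi> \<in> ring_hom (E\<lparr>carrier := ev ` carrier ?P\<rparr>) \<Omega>"
      "\<And>p. p \<in> carrier ?P \<Longrightarrow> \<psi> (ev p) = UnivPoly.eval D \<Omega> \<phi> z p"
      using ring_hom_factor[OF U.P.ring_axioms E.ring_axioms \<Omega>.ring_axioms ev V.eval_ring_hom[OF z] ker]
      by blast
    have "\<psi> (i d) = \<phi> d" if "d \<in> carrier D" for d
      using \<psi>(2)[of "up_ring.monom ?P d 0"] V.eval_const[OF z that] ev_const[OF that] that by simp
    with \<psi> show ?thesis unfolding T' by blast
  qed
  have eval_eq: "UnivPoly.eval D \<Omega> \<phi> z p = (\<Oplus>\<^bsub>\<Omega>\<^esub>j\<in>{..deg D p}. \<phi> (up_ring.coeff ?P p j) \<otimes>\<^bsub>\<Omega>\<^esub> z [^]\<^bsub>\<Omega>\<^esub> j)"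
    if "p \<in> carrier ?P" for \<phi> z p
    using that by (simp add: UnivPoly.eval_def)
  have coeffs: "(\<lambda>j. \<phi> (up_ring.coeff ?P p j)) \<in> {..n} \<rightarrow> carrier \<Omega>"
    if "\<phi> \<in> ring_hom D \<Omega>" "p \<in> carrier ?P" for \<phi> p n
    using that by (auto simp: ring_hom_def)
  show ?thesis
  proof (cases "\<exists>q\<in>carrier ?P. q \<noteq> \<zero>\<^bsub>?P\<^esub> \<and> ev q = \<zero>\<^bsub>E\<^esub>")
    case False
    show ?thesis
    proof (intro bexI[of _ "up_ring.coeff ?P \<beta> (deg D \<beta>)"] conjI ballI impI)
      fix \<phi> assume \<phi>: "\<phi> \<in> ring_hom D \<Omega>" "\<phi> (up_ring.coeff ?P \<beta> (deg D \<beta>)) \<noteq> \<zero>\<^bsub>\<Omega>\<^esub>"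
      interpret V: UP_pre_univ_prop D \<Omega> \<phi> ?P
        using UP_pre_univ_propI[OF D.is_cring \<Omega>.is_cring \<phi>(1)] .
      obtain z where z: "z \<in> carrier \<Omega>" "UnivPoly.eval D \<Omega> \<phi> z \<beta> \<noteq> \<zero>\<^bsub>\<Omega>\<^esub>"
        using \<Omega>.has_roots_imp_nonroot[OF \<Omega>(2) coeffs[OF \<phi>(1) \<beta>(1)] \<phi>(2)] eval_eq[OF \<beta>(1)] by metis
      have "UnivPoly.eval D \<Omega> \<phi> z p = \<zero>\<^bsub>\<Omega>\<^esub>" if "p \<in> carrier ?P" "ev p = \<zero>\<^bsub>E\<^esub>" for p
      proof -
        have "p = \<zero>\<^bsub>?P\<^esub>" using False that by blast
        then show ?thesis
          using V.eval_const[OF z(1) D.zero_closed] by simp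
      qed
      from ext[OF \<phi>(1) z(1) this] z(2) \<beta>
      show "\<exists>\<psi>\<in>ring_hom (E\<lparr>carrier := T\<rparr>) \<Omega>. (\<forall>d\<in>carrier D. \<psi> (i d) = \<phi> d) \<and> \<psi> b \<noteq> \<zero>\<^bsub>\<Omega>\<^esub>"
        by auto
    qed (use \<beta> \<beta>0 lc lc0 in auto)
  next
    case True
    define N where "N = {q \<in> carrier ?P. q \<noteq> \<zero>\<^bsub>?P\<^esub> \<and> ev q = \<zero>\<^bsub>E\<^esub>}"
    define q where "q = arg_min (deg D) (\<lambda>q. q \<in> N)"
    have "q \<in> N" and q_min: "\<And>p. p \<in> N \<Longrightarrow> deg D q \<le> deg D p"
      using arg_min_nat_lemma[of "\<lambda>q. q \<in> N" _ "deg D"] True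
      by (auto simp: q_def N_def)
    then have q: "q \<in> carrier ?P" "q \<noteq> \<zero>\<^bsub>?P\<^esub>" "ev q = \<zero>\<^bsub>E\<^esub>"
      by (auto simp: N_def)
    define lq where "lq = up_ring.coeff ?P q (deg D q)"
    have lq: "lq \<in> carrier D" "lq \<noteq> \<zero>\<^bsub>D\<^esub>" using q lc lc0 by (auto simp: lq_def)
    have low: "p = \<zero>\<^bsub>?P\<^esub>" if "p \<in> carrier ?P" "ev p = \<zero>\<^bsub>E\<^esub>" "deg D p < deg D q" for p
      using q_min[of p] that by (auto simp: N_def)
    \<comment> \<open>\<open>J\<close> consists of polynomials whose value at \<open>x\<close> is a
      nonzero multiple of \<open>b\<close> within D[x]. The remainder of \<beta> modulo
      \<open>q\<close> lies in it, since its value is \<open>b\<close> times the image of a power of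
      \<open>lq\<close>; hence \<open>J\<close> has a member of degree below that of
      \<open>q\<close>.\<close>
    define J where "J = {h \<in> carrier ?P. ev h \<noteq> \<zero>\<^bsub>E\<^esub> \<and> (\<exists>s\<in>carrier ?P. ev h = b \<otimes>\<^bsub>E\<^esub> ev s)}"
    obtain s r k where r: "s \<in> carrier ?P" "r \<in> carrier ?P"
      "lq [^]\<^bsub>D\<^esub> (k::nat) \<odot>\<^bsub>?P\<^esub> \<beta> = q \<otimes>\<^bsub>?P\<^esub> s \<oplus>\<^bsub>?P\<^esub> r" "r = \<zero>\<^bsub>?P\<^esub> \<or> deg D r < deg D q"
      using U.long_div_theorem[OF q(1) \<beta>(1) q(2)] by (auto simp: lq_def)
    have ev_r: "ev r = i (lq [^]\<^bsub>D\<^esub> k) \<otimes>\<^bsub>E\<^esub> b"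
      using arg_cong[OF r(3), of ev] r(1,2) q lq \<beta> by (simp add: ev_smult)
    have "lq [^]\<^bsub>D\<^esub> k \<noteq> \<zero>\<^bsub>D\<^esub>" for k :: nat
      using lq by (induction k) (auto simp: D.integral_iff)
    then have lqk: "i (lq [^]\<^bsub>D\<^esub> k) \<noteq> \<zero>\<^bsub>E\<^esub>" for k :: nat
      using lq(1) by (subst i0) auto
    have bE: "b \<in> carrier E" using \<beta> by auto
    have "r \<in> J"
      unfolding J_def
    proof (intro CollectI conjI bexI)
      show "ev r = b \<otimes>\<^bsub>E\<^esub> ev (up_ring.monom ?P (lq [^]\<^bsub>D\<^esub> k) 0)"
        using lq bE by (simp add: ev_r ev_const E.m_comm)
      show "ev r \<noteq> \<zero>\<^bsub>E\<^esub>"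
        unfolding ev_r using lqk b(2) bE lq by (simp add: E.integral_iff)
    qed (use r lq in auto)
    define h where "h = arg_min (deg D) (\<lambda>h. h \<in> J)"
    have hJ: "h \<in> J" and h_min: "\<And>p. p \<in> J \<Longrightarrow> deg D h \<le> deg D p"
      using arg_min_nat_lemma[of "\<lambda>h. h \<in> J" r "deg D"] \<open>r \<in> J\<close>
      by (auto simp: h_def)
    then obtain s' where h: "h \<in> carrier ?P" "ev h \<noteq> \<zero>\<^bsub>E\<^esub>" "s' \<in> carrier ?P" "ev h = b \<otimes>\<^bsub>E\<^esub> ev s'"
      by (auto simp: J_def)
    have h0: "h \<noteq> \<zero>\<^bsub>?P\<^esub>" using h by auto
    have "r \<noteq> \<zero>\<^bsub>?P\<^esub>" using \<open>r \<in> J\<close> by (auto simp: J_def)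
    then have hq: "deg D h < deg D q"
      using r(4) h_min[OF \<open>r \<in> J\<close>] by linarith
    define lh where "lh = up_ring.coeff ?P h (deg D h)"
    have lh: "lh \<in> carrier D" "lh \<noteq> \<zero>\<^bsub>D\<^esub>" using h h0 lc lc0 by (auto simp: lh_def)
    \<comment> \<open>The remainder \<open>t\<close> of \<open>q\<close> modulo \<open>h\<close>
      again takes a multiple of \<open>b\<close> as its value at \<open>x\<close>. Minimality of
      \<open>h\<close> makes this value zero, and then minimality of \<open>q\<close> makes
      \<open>t\<close> itself zero.\<close>
    obtain u t m where t: "u \<in> carrier ?P" "t \<in> carrier ?P"
      "lh [^]\<^bsub>D\<^esub> (m::nat) \<odot>\<^bsub>?P\<^esub> q = h \<otimes>\<^bsub>?P\<^esub> u \<oplus>\<^bsub>?P\<^esub> t" "t = \<zero>\<^bsub>?P\<^esub> \<or> deg D t < deg D h"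
      using U.long_div_theorem[OF h(1) q(1) h0] by (auto simp: lh_def)
    have "ev h \<otimes>\<^bsub>E\<^esub> ev u \<oplus>\<^bsub>E\<^esub> ev t = \<zero>\<^bsub>E\<^esub>"
      using arg_cong[OF t(3), of ev] t(1,2) q h(1) lh by (simp add: ev_smult)
    then have ev_t: "ev t = b \<otimes>\<^bsub>E\<^esub> ev (\<ominus>\<^bsub>?P\<^esub> (s' \<otimes>\<^bsub>?P\<^esub> u))"
      using t h bE E.sum_zero_eq_neg[of "ev t" "ev h \<otimes>\<^bsub>E\<^esub> ev u"]
      by (simp add: E.r_minus E.m_assoc E.a_comm)
    have "ev t = \<zero>\<^bsub>E\<^esub>"
    proof (rule ccontr)
      assume nz: "ev t \<noteq> \<zero>\<^bsub>E\<^esub>"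
      then have "t \<in> J" using ev_t t h unfolding J_def by blast
      moreover have "t \<noteq> \<zero>\<^bsub>?P\<^esub>" using nz by auto
      ultimately show False using h_min[of t] t(4) by auto
    qed
    then have t0: "t = \<zero>\<^bsub>?P\<^esub>"
      using low[of t] t hq by auto
    have lhm: "lh [^]\<^bsub>D\<^esub> m \<in> carrier D" "lh [^]\<^bsub>D\<^esub> m \<noteq> \<zero>\<^bsub>D\<^esub>"
      using lh by (simp, induction m) (auto simp: D.integral_iff)
    have hu: "lh [^]\<^bsub>D\<^esub> m \<odot>\<^bsub>?P\<^esub> q = h \<otimes>\<^bsub>?P\<^esub> u"
      using t t0 h by simp
    have degs: "deg D (lh [^]\<^bsub>D\<^esub> m \<odot>\<^bsub>?P\<^esub> q) = deg D q"
      using lhm q by (simp add: UD.deg_smult)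
    have u0: "u \<noteq> \<zero>\<^bsub>?P\<^esub>"
    proof
      assume "u = \<zero>\<^bsub>?P\<^esub>"
      then have "deg D q = 0" using hu degs h by simp
      then show False using hq by simp
    qed
    \<comment> \<open>So \<open>h\<close> divides a constant multiple of \<open>q\<close>, and as
      \<open>h\<close> does not vanish at \<open>x\<close>, the cofactor \<open>u\<close> does. A
      nonzero relation has degree at least that of \<open>q\<close>, which leaves degree zero for
      \<open>h\<close>.\<close>
    have "ev h \<otimes>\<^bsub>E\<^esub> ev u = \<zero>\<^bsub>E\<^esub>"
      using arg_cong[OF hu, of ev] t(1,2) q h(1) lh by (simp add: ev_smult)
    then have "ev u = \<zero>\<^bsub>E\<^esub>"
      using h(1,2) t(1) E.integral[of "ev h" "ev u"] by auto
    then have "deg D q \<le> deg D u"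
      using u0 t q_min by (auto simp: N_def)
    moreover have "deg D q = deg D h + deg D u"
      using hu degs UD.deg_mult[OF h0 u0 h(1) t(1)] by simp
    ultimately have "deg D h = 0" by simp
    then obtain c where c: "c \<in> carrier D" "h = up_ring.monom ?P c 0"
      using UP_const_of_deg_zero[OF D.is_cring h(1)] by blast
    have ic: "i c = b \<otimes>\<^bsub>E\<^esub> ev s'" using h c ev_const by simp
    have c0: "c \<noteq> \<zero>\<^bsub>D\<^esub>" using h0 c by auto
    show ?thesis
    proof (intro bexI[of _ "lq \<otimes>\<^bsub>D\<^esub> c"] conjI ballI impI)
      fix \<phi> assume \<phi>: "\<phi> \<in> ring_hom D \<Omega>" "\<phi> (lq \<otimes>\<^bsub>D\<^esub> c) \<noteq> \<zero>\<^bsub>\<Omega>\<^esub>"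
      interpret V: UP_pre_univ_prop D \<Omega> \<phi> ?P
        using UP_pre_univ_propI[OF D.is_cring \<Omega>.is_cring \<phi>(1)] .
      have \<phi>lq: "\<phi> lq \<noteq> \<zero>\<^bsub>\<Omega>\<^esub>" and \<phi>c: "\<phi> c \<noteq> \<zero>\<^bsub>\<Omega>\<^esub>"
        using \<phi> lq c by auto
      \<comment> \<open>The image of \<open>q\<close> keeps its degree, which is positive because
        \<open>h\<close> has a smaller one.\<close>
      obtain z where z: "z \<in> carrier \<Omega>" "UnivPoly.eval D \<Omega> \<phi> z q = \<zero>\<^bsub>\<Omega>\<^esub>"
        using has_rootsD[OF \<Omega>(2) _ coeffs[OF \<phi>(1) q(1)], of "deg D q"] \<phi>lq hq eval_eq[OF q(1)]
        unfolding lq_def by (metis gr_zeroI less_zeroE)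
      have ev2: "UnivPoly.eval D \<Omega> \<phi> z \<in> ring_hom ?P \<Omega>" by (rule V.eval_ring_hom[OF z(1)])
      interpret ev2: ring_hom_ring ?P \<Omega> "UnivPoly.eval D \<Omega> \<phi> z"
        by (rule ring_hom_ringI2[OF U.P.ring_axioms \<Omega>.ring_axioms ev2])
      \<comment> \<open>Pseudo-division of \<open>p\<close> by \<open>q\<close> leaves a remainder
        of smaller degree vanishing at \<open>x\<close>, hence zero. So a power of \<open>lq\<close>
        times \<open>p\<close> is a multiple of \<open>q\<close>, and the image of that power in
        \<Omega> is nonzero.\<close>
      have "UnivPoly.eval D \<Omega> \<phi> z p = \<zero>\<^bsub>\<Omega>\<^esub>" if p: "p \<in> carrier ?P" "ev p = \<zero>\<^bsub>E\<^esub>" for p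
      proof -
        obtain s r k where r: "s \<in> carrier ?P" "r \<in> carrier ?P"
          "lq [^]\<^bsub>D\<^esub> (k::nat) \<odot>\<^bsub>?P\<^esub> p = q \<otimes>\<^bsub>?P\<^esub> s \<oplus>\<^bsub>?P\<^esub> r" "r = \<zero>\<^bsub>?P\<^esub> \<or> deg D r < deg D q"
          using U.long_div_theorem[OF q(1) p(1) q(2)] by (auto simp: lq_def)
        have "ev r = \<zero>\<^bsub>E\<^esub>"
          using arg_cong[OF r(3), of ev] r(1,2) q lq p by (simp add: ev_smult)
        then have "r = \<zero>\<^bsub>?P\<^esub>" using low r by blast
        then have "up_ring.monom ?P (lq [^]\<^bsub>D\<^esub> k) 0 \<otimes>\<^bsub>?P\<^esub> p = q \<otimes>\<^bsub>?P\<^esub> s"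
          using r q lq p by (simp add: U.monom_mult_is_smult)
        from arg_cong[OF this, of "UnivPoly.eval D \<Omega> \<phi> z"]
        have "\<phi> lq [^]\<^bsub>\<Omega>\<^esub> k \<otimes>\<^bsub>\<Omega>\<^esub> UnivPoly.eval D \<Omega> \<phi> z p = \<zero>\<^bsub>\<Omega>\<^esub>"
          using r q lq p z V.eval_const[OF z(1)] by simp
        moreover have "\<phi> lq [^]\<^bsub>\<Omega>\<^esub> k \<noteq> \<zero>\<^bsub>\<Omega>\<^esub>"
          using \<phi>lq lq by (induction k) (auto simp: \<Omega>.integral_iff)
        ultimately show ?thesis
          using lq p \<Omega>.integral by (metis V.hom_closed \<Omega>.nat_pow_closed ev2.hom_closed)
      qed
      from ext[OF \<phi>(1) z(1) this] obtain \<psi> where \<psi>: "\<psi> \<in> ring_hom (E\<lparr>carrier := T\<rparr>) \<Omega>"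
        "\<forall>d\<in>carrier D. \<psi> (i d) = \<phi> d" by blast
      \<comment> \<open>The cofactor that turns \<open>b\<close> into the image of \<open>c\<close>
        lies in \<open>T\<close>, so \<psi> b is a factor of the nonzero element \<phi> c.\<close>
      have "ev s' \<in> T" using h T' by auto
      then have "\<phi> c = \<psi> b \<otimes>\<^bsub>\<Omega>\<^esub> \<psi> (ev s')"
        using \<psi> c b ic ring_hom_mult[OF \<psi>(1), of b "ev s'"] by auto
      moreover have "\<psi> (ev s') \<in> carrier \<Omega>"
        using ring_hom_closed[OF \<psi>(1)] \<open>ev s' \<in> T\<close> by simp
      ultimately have "\<psi> b \<noteq> \<zero>\<^bsub>\<Omega>\<^esub>" using \<phi>c by auto
      with \<psi> show "\<exists>\<psi>\<in>ring_hom (E\<lparr>carrier := T\<rparr>) \<Omega>. (\<forall>d\<in>carrier D. \<psi> (i d) = \<phi> d) \<and> \<psi> b \<noteq> \<zero>\<^bsub>\<Omega>\<^esub>"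
        by blast
    qed (use lq c c0 D.integral in auto)
  qed
qed

text \<open>Generators are adjoined one at a time. \<open>T\<close> stays abstract: it is enough
  that it is a subring containing the listed elements, and each application compares it with the
  image in question.\<close>

lemma finite_hom_extension:
  assumes D: "domain D" and E: "domain E" and i: "i \<in> ring_hom D E" "inj_on i (carrier D)"
    and Y: "finite Y" "Y \<subseteq> carrier E" and \<Omega>: "field \<Omega>" "has_roots \<Omega>"
  obtains T where "subring T E" "i ` carrier D \<subseteq> T" "Y \<subseteq> T"
    "\<And>b. b \<in> T \<Longrightarrow> b \<noteq> \<zero>\<^bsub>E\<^esub> \<Longrightarrow> \<exists>a\<in>carrier D. a \<noteq> \<zero>\<^bsub>D\<^esub> \<and> (\<forall>\<phi>\<in>ring_hom D \<Omega>. \<phi> a \<noteq> \<zero>\<^bsub>\<Omega>\<^esub> \<longrightarrow>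
       (\<exists>\<psi>\<in>ring_hom (E\<lparr>carrier := T\<rparr>) \<Omega>. (\<forall>d\<in>carrier D. \<psi> (i d) = \<phi> d) \<and> \<psi> b \<noteq> \<zero>\<^bsub>\<Omega>\<^esub>))"
proof -
  interpret D: domain D by fact
  interpret E: domain E by fact
  interpret \<Omega>: field \<Omega> by fact
  interpret i: ring_hom_ring D E i by (rule ring_hom_ringI2[OF D.ring_axioms E.ring_axioms i(1)])
  let ?ext = "\<lambda>T b. \<exists>a\<in>carrier D. a \<noteq> \<zero>\<^bsub>D\<^esub> \<and> (\<forall>\<phi>\<in>ring_hom D \<Omega>. \<phi> a \<noteq> \<zero>\<^bsub>\<Omega>\<^esub> \<longrightarrow>
       (\<exists>\<psi>\<in>ring_hom (E\<lparr>carrier := T\<rparr>) \<Omega>. (\<forall>d\<in>carrier D. \<psi> (i d) = \<phi> d) \<and> \<psi> b \<noteq> \<zero>\<^bsub>\<Omega>\<^esub>))"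
  have "\<exists>T. subring T E \<and> i ` carrier D \<subseteq> T \<and> Y \<subseteq> T \<and> (\<forall>b\<in>T. b \<noteq> \<zero>\<^bsub>E\<^esub> \<longrightarrow> ?ext T b)"
    using Y
  proof (induction Y rule: finite_induct)
    case empty
    \<comment> \<open>Nothing is adjoined: \<open>T\<close> is the copy of \<open>D\<close> in
      \<open>E\<close>, and for \<open>b = i a\<close> the element \<open>a\<close> itself
      serves.\<close>
    have "?ext (i ` carrier D) (i a)" if a: "a \<in> carrier D" "i a \<noteq> \<zero>\<^bsub>E\<^esub>" for a
    proof (intro bexI[of _ a] conjI ballI impI)
      fix \<phi> assume \<phi>: "\<phi> \<in> ring_hom D \<Omega>" "\<phi> a \<noteq> \<zero>\<^bsub>\<Omega>\<^esub>"
      have "\<phi> p = \<zero>\<^bsub>\<Omega>\<^esub>" if "p \<in> carrier D" "i p = \<zero>\<^bsub>E\<^esub>" for p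
      proof -
        have "p = \<zero>\<^bsub>D\<^esub>" using that i(2) by (metis D.zero_closed i.hom_zero inj_onD)
        then show ?thesis
          using ring_hom_zero[OF \<phi>(1) D.ring_axioms \<Omega>.ring_axioms] by simp
      qed
      from ring_hom_factor[OF D.ring_axioms E.ring_axioms \<Omega>.ring_axioms i(1) \<phi>(1) this]
      obtain \<psi> where "\<psi> \<in> ring_hom (E\<lparr>carrier := i ` carrier D\<rparr>) \<Omega>"
        "\<And>p. p \<in> carrier D \<Longrightarrow> \<psi> (i p) = \<phi> p" by blast
      with \<phi> a show "\<exists>\<psi>\<in>ring_hom (E\<lparr>carrier := i ` carrier D\<rparr>) \<Omega>. (\<forall>d\<in>carrier D. \<psi> (i d) = \<phi> d) \<and> \<psi> (i a) \<noteq> \<zero>\<^bsub>\<Omega>\<^esub>"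
        by (intro bexI[of _ \<psi>]) auto
    qed (use a in auto)
    moreover have "subring (i ` carrier D) E"
      by (rule i.img_is_subring[OF D.carrier_is_subring])
    ultimately show ?case by (intro exI[of _ "i ` carrier D"]) auto
  next
    case (insert x Y)
    then obtain T where T: "subring T E" "i ` carrier D \<subseteq> T" "Y \<subseteq> T"
      "\<And>b. b \<in> T \<Longrightarrow> b \<noteq> \<zero>\<^bsub>E\<^esub> \<Longrightarrow> ?ext T b" by auto
    \<comment> \<open>The ring generated so far becomes the new base, included in \<open>E\<close>
      by the identity, and \<open>T'\<close> is the result of adjoining \<open>x\<close> to
      it.\<close>
    let ?D' = "E\<lparr>carrier := T\<rparr>"
    have D': "domain ?D'" by (rule E.subring_is_domain[OF T(1)])
    interpret D': domain ?D' by (rule D')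
    have TE: "T \<subseteq> carrier E" by (rule subringE(1)[OF T(1)])
    then have incl: "id \<in> ring_hom ?D' E" by (auto simp: ring_hom_def)
    have x: "x \<in> carrier E" using insert by auto
    interpret U: UP_pre_univ_prop ?D' E id "UP ?D'"
      using UP_pre_univ_propI[OF D'.is_cring E.is_cring incl] .
    let ?ev = "UnivPoly.eval ?D' E id x"
    define T' where "T' = ?ev ` carrier (UP ?D')"
    interpret ev: ring_hom_ring "UP ?D'" E ?ev
      by (rule ring_hom_ringI2[OF U.P.ring_axioms E.ring_axioms U.eval_ring_hom[OF x]])
    have sub: "subring T' E"
      unfolding T'_def by (rule ev.img_is_subring[OF U.P.carrier_is_subring])
    have "d \<in> T'" if "d \<in> T" for d
      using U.eval_const[OF x, of d] that unfolding T'_def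
      by (intro image_eqI[of _ _ "up_ring.monom (UP ?D') d 0"]) auto
    then have TT': "T \<subseteq> T'" by blast
    have "x \<in> T'"
      using U.eval_monom1[OF x] unfolding T'_def
      by (intro image_eqI[of _ _ "up_ring.monom (UP ?D') \<one>\<^bsub>?D'\<^esub> 1"]) (use subringE(3)[OF T(1)] in auto)
    moreover have "?ext T' b" if b: "b \<in> T'" "b \<noteq> \<zero>\<^bsub>E\<^esub>" for b
    proof -
      \<comment> \<open>Extending from \<open>T\<close> to \<open>T'\<close> requires that
        \<open>a'\<close> is not killed. This \<open>a'\<close> is handed to the induction
        hypothesis as the element to preserve, which returns a condition on
        \<open>D\<close>.\<close>
      obtain a' where a': "a' \<in> T" "a' \<noteq> \<zero>\<^bsub>E\<^esub>"
        "\<And>\<phi>. \<phi> \<in> ring_hom ?D' \<Omega> \<Longrightarrow> \<phi> a' \<noteq> \<zero>\<^bsub>\<Omega>\<^esub> \<Longrightarrow>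
          \<exists>\<psi>\<in>ring_hom (E\<lparr>carrier := T'\<rparr>) \<Omega>. (\<forall>d\<in>T. \<psi> d = \<phi> d) \<and> \<psi> b \<noteq> \<zero>\<^bsub>\<Omega>\<^esub>"
        using simple_hom_extension[OF D' E incl _ x \<Omega> T'_def b] by auto
      from T(4)[OF a'(1,2)] obtain a where a: "a \<in> carrier D" "a \<noteq> \<zero>\<^bsub>D\<^esub>"
        "\<And>\<phi>. \<phi> \<in> ring_hom D \<Omega> \<Longrightarrow> \<phi> a \<noteq> \<zero>\<^bsub>\<Omega>\<^esub> \<Longrightarrow>
          \<exists>\<psi>\<in>ring_hom ?D' \<Omega>. (\<forall>d\<in>carrier D. \<psi> (i d) = \<phi> d) \<and> \<psi> a' \<noteq> \<zero>\<^bsub>\<Omega>\<^esub>" by blast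
      show ?thesis
      proof (intro bexI[of _ a] conjI ballI impI)
        fix \<phi> assume "\<phi> \<in> ring_hom D \<Omega>" "\<phi> a \<noteq> \<zero>\<^bsub>\<Omega>\<^esub>"
        from a(3)[OF this] obtain \<psi> where \<psi>: "\<psi> \<in> ring_hom ?D' \<Omega>"
          "\<forall>d\<in>carrier D. \<psi> (i d) = \<phi> d" "\<psi> a' \<noteq> \<zero>\<^bsub>\<Omega>\<^esub>" by blast
        from a'(3)[OF \<psi>(1,3)] obtain \<psi>' where "\<psi>' \<in> ring_hom (E\<lparr>carrier := T'\<rparr>) \<Omega>"
          "\<forall>d\<in>T. \<psi>' d = \<psi> d" "\<psi>' b \<noteq> \<zero>\<^bsub>\<Omega>\<^esub>" by blast
        with \<psi> T(2) show "\<exists>\<psi>\<in>ring_hom (E\<lparr>carrier := T'\<rparr>) \<Omega>. (\<forall>d\<in>carrier D. \<psi> (i d) = \<phi> d) \<and> \<psi> b \<noteq> \<zero>\<^bsub>\<Omega>\<^esub>"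
          by (intro bexI[of _ \<psi>']) (auto simp: image_subset_iff)
      qed (use a in auto)
    qed
    ultimately show ?case
      using sub TT' T by (intro exI[of _ T']) auto
  qed
  with that show thesis by blast
qed

section \<open>Polynomial functions and the Nullstellensatz\<close>

lemma finsum_ring_of_type:
  "finite A \<Longrightarrow> finsum (ring_of_type_algebra :: 'a::comm_ring_1 ring) f A = (\<Sum>i\<in>A. f i)"
proof (induction A rule: finite_induct)
  interpret R: cring "ring_of_type_algebra :: 'a ring" ..
  {
    case empty
    show ?case by (simp, simp add: ring_of_type_algebra_def)
  next
    case (insert x F)
    then show ?case
      by (subst R.finsum_insert) (auto simp: ring_of_type_algebra_def)
  }
qed

lemma pow_ring_of_type:
  "x [^]\<^bsub>(ring_of_type_algebra :: 'a::comm_ring_1 ring)\<^esub> (n::nat) = x ^ n"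
proof (induction n)
  interpret R: cring "ring_of_type_algebra :: 'a ring" ..
  {
    case 0
    show ?case by (simp, simp add: ring_of_type_algebra_def)
  next
    case (Suc n)
    then show ?case by (simp, simp add: ring_of_type_algebra_def)
  }
qed

lemma has_roots_ring_of_type: "has_roots (ring_of_type_algebra :: 'a::alg_closed_field ring)"
  unfolding has_roots_def
proof (intro allI impI)
  let ?R = "ring_of_type_algebra :: 'a ring"
  fix n :: nat and c :: "nat \<Rightarrow> 'a"
  assume "n > 0" "c n \<noteq> \<zero>\<^bsub>?R\<^esub>"
  then obtain z where "(\<Sum>k\<le>n. c k * z ^ k) = 0"
    using alg_closed[of n c] by (auto simp: ring_of_type_algebra_def)
  then have "(\<Oplus>\<^bsub>?R\<^esub>i\<in>{..n}. c i \<otimes>\<^bsub>?R\<^esub> z [^]\<^bsub>?R\<^esub> i) = \<zero>\<^bsub>?R\<^esub>"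
    by (simp add: finsum_ring_of_type pow_ring_of_type) (simp add: ring_of_type_algebra_def)
  then show "\<exists>z\<in>carrier ?R. (\<Oplus>\<^bsub>?R\<^esub>i\<in>{..n}. c i \<otimes>\<^bsub>?R\<^esub> z [^]\<^bsub>?R\<^esub> i) = \<zero>\<^bsub>?R\<^esub>"
    by (intro bexI[of _ z]) (auto simp: ring_of_type_algebra_def)
qed

text \<open>Coefficient lists start with the leading coefficient, which accounts for
  \<open>rev\<close>.\<close>

lemma (in ring) eval_eq_finsum:
  assumes "c \<in> {..<n} \<rightarrow> carrier R" "x \<in> carrier R"
  shows "eval (map c (rev [0..<n])) x = (\<Oplus>i\<in>{..<n}. c i \<otimes> x [^] i)"
  using assms(1)
proof (induction n)
  case (Suc n)
  then have "eval (map c (rev [0..<n])) x = (\<Oplus>i\<in>{..<n}. c i \<otimes> x [^] i)"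
    by (auto simp: Pi_iff)
  moreover have "(\<Oplus>i\<in>{..<Suc n}. c i \<otimes> x [^] i) = c n \<otimes> x [^] n \<oplus> (\<Oplus>i\<in>{..<n}. c i \<otimes> x [^] i)"
    unfolding lessThan_Suc using Suc.prems assms(2)
    by (subst finsum_insert) (auto simp: Pi_iff)
  ultimately show ?case by simp
qed simp

lemma (in algebraically_closed) has_roots: "has_roots L"
  unfolding has_roots_def
proof (intro allI impI)
  fix n :: nat and c assume n: "n > 0" and c: "c \<in> {..n} \<rightarrow> carrier L" "c n \<noteq> \<zero>"
  define p where "p = map c (rev [0..<Suc n])"
  have p: "p \<in> carrier (poly_ring L)"
    using c unfolding univ_poly_carrier[symmetric] polynomial_def p_def by (auto simp: Pi_iff)
  \<comment> \<open>Over an algebraically closed field \<open>p\<close> splits, so it has as many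
    roots, counted with multiplicity, as its degree \<open>n\<close>.\<close>
  have "size (roots p) \<noteq> 0"
    using roots_over_carrier[OF p] n by (simp add: splitted_def p_def)
  then obtain z where "z \<in># roots p"
    by auto
  then have z: "z \<in> carrier L" "eval p z = \<zero>"
    using roots_mem_iff_is_root[OF p] by (auto simp: is_root_def)
  have "(\<Oplus>i\<in>{..<Suc n}. c i \<otimes> z [^] i) = \<zero>"
    using c z by (subst eval_eq_finsum[symmetric]) (auto simp: p_def)
  with z show "\<exists>z\<in>carrier L. (\<Oplus>i\<in>{..n}. c i \<otimes> z [^] i) = \<zero>"
    by (auto simp: lessThan_Suc_atMost)
qed

section \<open>The ring of polynomial functions and its generators\<close>

lemma coord_ring_simps [simp]:
  "carrier (coord_ring sc) = polynomial_functions sc"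
  "f \<otimes>\<^bsub>coord_ring sc\<^esub> g = (\<lambda>v. f v * g v)" "f \<oplus>\<^bsub>coord_ring sc\<^esub> g = (\<lambda>v. f v + g v)"
  "\<one>\<^bsub>coord_ring sc\<^esub> = (\<lambda>_. 1)" "\<zero>\<^bsub>coord_ring sc\<^esub> = (\<lambda>_. 0)"
  by (simp_all add: coord_ring_def)

lemma polynomial_functions_uminus:
  "f \<in> polynomial_functions sc \<Longrightarrow> (\<lambda>v. - f v) \<in> polynomial_functions sc"
  using polynomial_functions.mult[OF polynomial_functions.const[of "-1"], of f] by simp

lemma cring_coord_ring: "cring (coord_ring sc)"
proof (intro cringI abelian_groupI comm_monoidI)
  show "\<exists>g\<in>carrier (coord_ring sc). g \<oplus>\<^bsub>coord_ring sc\<^esub> f = \<zero>\<^bsub>coord_ring sc\<^esub>"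
    if "f \<in> carrier (coord_ring sc)" for f
    using that polynomial_functions_uminus[of f] by (intro bexI[of _ "\<lambda>v. - f v"]) auto
qed (auto simp: algebra_simps intro: polynomial_functions.intros)

lemma coord_ring_uminus [simp]:
  assumes "f \<in> polynomial_functions sc"
  shows "\<ominus>\<^bsub>coord_ring sc\<^esub> f = (\<lambda>v. - f v)"
proof -
  interpret cring "coord_ring sc" by (rule cring_coord_ring)
  show ?thesis
    using assms polynomial_functions_uminus[of f] by (intro minus_equality) auto
qed

lemma coord_ring_minus [simp]:
  assumes "f \<in> polynomial_functions sc" "g \<in> polynomial_functions sc"
  shows "f \<ominus>\<^bsub>coord_ring sc\<^esub> g = (\<lambda>v. f v - g v)"
  using assms by (simp add: a_minus_def)

lemma polynomial_function_on_line:
  assumes "f \<in> polynomial_functions sc"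
  obtains p :: "complex poly" where "\<And>t. f (u + sc t w) = poly p t"
  using assms
proof (induction arbitrary: thesis)
  case (const c)
  show ?case by (rule const[of "[:c:]"]) simp
next
  case (linear l)
  show ?case
    by (rule linear(2)[of "[:l u, l w:]"]) (use linear(1) in \<open>simp add: Vector_Spaces.linear_iff\<close>)
next
  case (add f g)
  obtain p q where "\<And>t. f (u + sc t w) = poly p t" "\<And>t. g (u + sc t w) = poly q t"
    using add.IH by metis
  then show ?case by (intro add.prems[of "p + q"]) simp
next
  case (mult f g)
  obtain p q where "\<And>t. f (u + sc t w) = poly p t" "\<And>t. g (u + sc t w) = poly q t"
    using mult.IH by metis
  then show ?case by (intro mult.prems[of "p * q"]) simp
qed

text \<open>
  Restricting to the line through a point where \<open>f \<noteq> 0\<close> and a point where \<open>g \<noteq> 0\<close> reduces the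
  absence of zero divisors to polynomials in one variable.
\<close>

lemma domain_coord_ring:
  assumes "vector_space sc"
  shows "domain (coord_ring sc)"
proof -
  interpret V: vector_space sc by fact
  interpret cring "coord_ring sc" by (rule cring_coord_ring)
  show ?thesis
  proof
    show "\<one>\<^bsub>coord_ring sc\<^esub> \<noteq> \<zero>\<^bsub>coord_ring sc\<^esub>" by (simp add: fun_eq_iff)
  next
    fix f g assume fg: "f \<otimes>\<^bsub>coord_ring sc\<^esub> g = \<zero>\<^bsub>coord_ring sc\<^esub>"
      "f \<in> carrier (coord_ring sc)" "g \<in> carrier (coord_ring sc)"
    show "f = \<zero>\<^bsub>coord_ring sc\<^esub> \<or> g = \<zero>\<^bsub>coord_ring sc\<^esub>"
    proof (rule ccontr)
      assume "\<not> ?thesis"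
      then obtain u w where uw: "f u \<noteq> 0" "g w \<noteq> 0" by (auto simp: fun_eq_iff)
      obtain p where p: "\<And>t. f (u + sc t (w - u)) = poly p t"
        using polynomial_function_on_line[of f sc u "w - u"] fg by auto
      obtain q where q: "\<And>t. g (u + sc t (w - u)) = poly q t"
        using polynomial_function_on_line[of g sc u "w - u"] fg by auto
      have "poly (p * q) t = 0" for t
        using fun_cong[OF fg(1), of "u + sc t (w - u)"] by (simp add: p q)
      then have "p * q = 0" using poly_all_0_iff_0 by blast
      moreover have "poly p 0 \<noteq> 0" using uw p[of 0] by simp
      moreover have "poly q 1 \<noteq> 0" using uw q[of 1] by simp
      ultimately show False by auto
    qed
  qed
qed

text \<open>The dual basis of \<open>B\<close>. Together with the constants it generates C[V], which
  is the finiteness that \<open>finite_hom_extension\<close> asks for.\<close>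

definition coordinates :: "(complex \<Rightarrow> 'v::ab_group_add \<Rightarrow> 'v) \<Rightarrow> 'v set \<Rightarrow> ('v \<Rightarrow> complex) set" where
  "coordinates sc B = (\<lambda>b v. module.representation sc B v b) ` B"

context
  fixes sc :: "complex \<Rightarrow> 'v::ab_group_add \<Rightarrow> 'v" and B
  assumes V: "finite_dimensional_vector_space sc B"
begin

interpretation V: finite_dimensional_vector_space sc B by (rule V)

lemma linear_coordinate: "Vector_Spaces.linear sc (*) (\<lambda>v. V.representation B v b)"
proof -
  have "vector_space ((*) :: complex \<Rightarrow> complex \<Rightarrow> complex)"
    by unfold_locales (auto simp: algebra_simps)
  then show ?thesis
    by (simp add: Vector_Spaces.linear_iff V.vector_space_axioms V.representation_add V.representation_scale
        V.independent_Basis V.span_Basis)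
qed

lemma finite_coordinates: "finite (coordinates sc B)"
  by (simp add: coordinates_def V.finite_Basis)

lemma coordinates_subset: "coordinates sc B \<subseteq> polynomial_functions sc"
  by (auto simp: coordinates_def intro: polynomial_functions.linear linear_coordinate)

lemma sum_coordinates: "(\<Sum>b\<in>B. sc (V.representation B v b) b) = v"
  by (rule V.sum_representation_eq)
    (auto simp: V.independent_Basis V.span_Basis V.finite_Basis)

lemma linear_eq_sum_coordinates:
  assumes "Vector_Spaces.linear sc (*) l"
  shows "l v = (\<Sum>b\<in>B. V.representation B v b * l b)"
proof -
  interpret l: Vector_Spaces.linear sc "(*)" l by fact
  have "l v = l (\<Sum>b\<in>B. sc (V.representation B v b) b)"
    by (simp add: sum_coordinates)
  then show ?thesis by (simp add: l.sum l.scale)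
qed

text \<open>Every linear functional is a sum of constant multiples of coordinates, so arbitrary
  functionals can be traded for finitely many generators.\<close>

lemma polynomial_functions_induct_coordinates [consumes 1, case_names const coord add mult]:
  assumes "f \<in> polynomial_functions sc"
    and const: "\<And>c. P (\<lambda>_. c)" and coord: "\<And>f. f \<in> coordinates sc B \<Longrightarrow> P f"
    and add: "\<And>f g. f \<in> polynomial_functions sc \<Longrightarrow> g \<in> polynomial_functions sc \<Longrightarrow>
       P f \<Longrightarrow> P g \<Longrightarrow> P (\<lambda>v. f v + g v)"
    and mult: "\<And>f g. f \<in> polynomial_functions sc \<Longrightarrow> g \<in> polynomial_functions sc \<Longrightarrow>
       P f \<Longrightarrow> P g \<Longrightarrow> P (\<lambda>v. f v * g v)"
  shows "P f"
  using assms(1)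
proof induction
  case (linear l)
  \<comment> \<open>Membership in the ring is proved alongside \<open>P\<close> because the rules
    \<open>add\<close> and \<open>mult\<close> demand it of their arguments.\<close>
  have "P (\<lambda>v. \<Sum>b\<in>C. V.representation B v b * l b) \<and>
      (\<lambda>v. \<Sum>b\<in>C. V.representation B v b * l b) \<in> polynomial_functions sc" if "C \<subseteq> B" for C
    using finite_subset[OF that V.finite_Basis] that
  proof (induction C rule: finite_induct)
    case empty
    then show ?case using const[of 0] polynomial_functions.const[of 0] by simp
  next
    case (insert b C)
    have b: "(\<lambda>v. V.representation B v b) \<in> coordinates sc B"
      using insert by (auto simp: coordinates_def)
    then have b': "(\<lambda>v. V.representation B v b) \<in> polynomial_functions sc"
      using coordinates_subset by blast
    note pc = polynomial_functions.const[of "l b" sc]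
    have "P (\<lambda>v. V.representation B v b * l b)"
      using mult[OF b' pc coord[OF b] const] .
    moreover have "(\<lambda>v. V.representation B v b * l b) \<in> polynomial_functions sc"
      using polynomial_functions.mult[OF b' pc] .
    ultimately show ?case
      using insert add[of "\<lambda>v. V.representation B v b * l b" "\<lambda>v. \<Sum>b\<in>C. V.representation B v b * l b"]
        polynomial_functions.add[of "\<lambda>v. V.representation B v b * l b" sc "\<lambda>v. \<Sum>b\<in>C. V.representation B v b * l b"]
      by simp
  qed
  from this[of B] show ?case
    by (simp add: linear_eq_sum_coordinates[OF linear, symmetric])
qed (fact const, (rule add; assumption), (rule mult; assumption))

text \<open>The link between C[V] and the ring \<open>T\<close> of
  \<open>finite_hom_extension\<close>: containment has to be known for the generators only.\<close>

lemma image_polynomial_functions_subset: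
  assumes "h \<in> ring_hom (coord_ring sc) E" "subring T E"
    and "\<And>c. h (\<lambda>_. c) \<in> T" "h ` coordinates sc B \<subseteq> T"
  shows "h ` polynomial_functions sc \<subseteq> T"
proof clarify
  fix f assume "f \<in> polynomial_functions sc"
  then show "h f \<in> T"
  proof (induction rule: polynomial_functions_induct_coordinates)
    case (add f g)
    then show ?case
      using ring_hom_add[OF assms(1), of f g] subringE(7)[OF assms(2), of "h f" "h g"] by simp
  next
    case (mult f g)
    then show ?case
      using ring_hom_mult[OF assms(1), of f g] subringE(6)[OF assms(2), of "h f" "h g"] by simp
  qed (use assms in auto)
qed

lemma complex_point_of_hom:
  assumes \<theta>: "\<theta> \<in> ring_hom (coord_ring sc) (ring_of_type_algebra :: complex ring)"
    and const: "\<And>c. \<theta> (\<lambda>_. c) = c"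
  obtains v where "\<And>f. f \<in> polynomial_functions sc \<Longrightarrow> \<theta> f = f v"
proof
  \<comment> \<open>The point whose coordinates are the values of \<theta> on the coordinate
    functions.\<close>
  define v where "v = (\<Sum>b\<in>B. sc (\<theta> (\<lambda>v. V.representation B v b)) b)"
  fix f assume "f \<in> polynomial_functions sc"
  then show "\<theta> f = f v"
  proof (induction rule: polynomial_functions_induct_coordinates)
    case (coord f)
    then obtain b where b: "b \<in> B" "f = (\<lambda>v. V.representation B v b)"
      by (auto simp: coordinates_def)
    have "V.representation B v b = (\<Sum>b'\<in>B. \<theta> (\<lambda>v. V.representation B v b') * V.representation B b' b)"
      unfolding v_def
      by (simp add: V.representation_sum V.representation_scale V.independent_Basis V.span_Basis)
    also have "\<dots> = (\<Sum>b'\<in>B. if b = b' then \<theta> (\<lambda>v. V.representation B v b') else 0)"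
      by (intro sum.cong) (auto simp: V.representation_basis V.independent_Basis)
    also have "\<dots> = \<theta> f"
      using b V.finite_Basis by simp
    finally show ?case using b by simp
  next
    case (add f g)
    then show ?case
      using ring_hom_add[OF \<theta>, of f g] by (simp, simp add: ring_of_type_algebra_def)
  next
    case (mult f g)
    then show ?case
      using ring_hom_mult[OF \<theta>, of f g] by (simp, simp add: ring_of_type_algebra_def)
  qed (simp add: const)
qed

text \<open>With the complex numbers as base inside \<open>K\<close> and
  \<open>b = \<eta> f\<close>, \<open>finite_hom_extension\<close> sends a subring containing the
  image of \<eta> to the complex numbers without killing \<eta> f. The composite with \<eta> is
  evaluation at a point, the required \<open>v\<close>.\<close>

lemma nullstellensatz_kernel:
  assumes K: "field K" and \<eta>: "\<eta> \<in> ring_hom (coord_ring sc) K"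
    and f: "f \<in> polynomial_functions sc" "\<eta> f \<noteq> \<zero>\<^bsub>K\<^esub>"
  obtains v where "f v \<noteq> 0"
    "\<And>g. g \<in> polynomial_functions sc \<Longrightarrow> \<eta> g = \<zero>\<^bsub>K\<^esub> \<Longrightarrow> g v = 0"
proof -
  let ?C = "ring_of_type_algebra :: complex ring"
  interpret K: field K by fact
  interpret A: cring "coord_ring sc" by (rule cring_coord_ring)
  interpret \<eta>: ring_hom_ring "coord_ring sc" K \<eta>
    by (rule ring_hom_ringI2[OF A.ring_axioms K.ring_axioms \<eta>])
  have C: "field ?C" ..
  interpret C: field ?C by (rule C)
  define i where "i = (\<lambda>c. \<eta> (\<lambda>_. c))"
  have i: "i \<in> ring_hom ?C K"
  proof (rule ring_hom_memI)
    fix a b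
    show "i (a \<otimes>\<^bsub>?C\<^esub> b) = i a \<otimes>\<^bsub>K\<^esub> i b"
      using ring_hom_mult[OF \<eta>, of "\<lambda>_. a" "\<lambda>_. b"]
      by (simp add: i_def ring_of_type_algebra_def polynomial_functions.const)
    show "i (a \<oplus>\<^bsub>?C\<^esub> b) = i a \<oplus>\<^bsub>K\<^esub> i b"
      using ring_hom_add[OF \<eta>, of "\<lambda>_. a" "\<lambda>_. b"]
      by (simp add: i_def ring_of_type_algebra_def polynomial_functions.const)
    show "i a \<in> carrier K"
      using ring_hom_closed[OF \<eta>, of "\<lambda>_. a"] by (simp add: i_def polynomial_functions.const)
    show "i \<one>\<^bsub>?C\<^esub> = \<one>\<^bsub>K\<^esub>"
      using ring_hom_one[OF \<eta>] by (simp add: i_def ring_of_type_algebra_def)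
  qed
  have inj: "inj_on i (carrier ?C)"
    using non_trivial_field_hom_is_inj[OF i C K] by blast
  have X: "\<eta> ` coordinates sc B \<subseteq> carrier K"
    using coordinates_subset ring_hom_closed[OF \<eta>] by auto
  obtain T where T: "subring T K" "i ` carrier ?C \<subseteq> T" "\<eta> ` coordinates sc B \<subseteq> T"
    and T_ext: "\<And>b. b \<in> T \<Longrightarrow> b \<noteq> \<zero>\<^bsub>K\<^esub> \<Longrightarrow>
      \<exists>a\<in>carrier ?C. a \<noteq> \<zero>\<^bsub>?C\<^esub> \<and> (\<forall>\<phi>\<in>ring_hom ?C ?C. \<phi> a \<noteq> \<zero>\<^bsub>?C\<^esub> \<longrightarrow>
        (\<exists>\<psi>\<in>ring_hom (K\<lparr>carrier := T\<rparr>) ?C. (\<forall>d\<in>carrier ?C. \<psi> (i d) = \<phi> d) \<and> \<psi> b \<noteq> \<zero>\<^bsub>?C\<^esub>))"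
    using finite_hom_extension[OF C.domain_axioms K.domain_axioms i inj
        finite_imageI[OF finite_coordinates] X C has_roots_ring_of_type] by blast
  have \<eta>T: "\<eta> ` polynomial_functions sc \<subseteq> T"
    by (rule image_polynomial_functions_subset[OF \<eta> T(1) _ T(3)])
      (use T(2) in \<open>auto simp: i_def ring_of_type_algebra_def\<close>)
  then obtain a where "a \<noteq> \<zero>\<^bsub>?C\<^esub>" and a: "\<And>\<phi>. \<phi>\<in>ring_hom ?C ?C \<Longrightarrow> \<phi> a \<noteq> \<zero>\<^bsub>?C\<^esub> \<Longrightarrow>
        \<exists>\<psi>\<in>ring_hom (K\<lparr>carrier := T\<rparr>) ?C. (\<forall>d\<in>carrier ?C. \<psi> (i d) = \<phi> d) \<and> \<psi> (\<eta> f) \<noteq> \<zero>\<^bsub>?C\<^esub>"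
    using T_ext[of "\<eta> f"] f by blast
  \<comment> \<open>For the identity the condition on \<open>a\<close> says that \<open>a\<close> is
    nonzero. The resulting map fixes the constants, as \<open>complex_point_of_hom\<close>
    requires.\<close>
  have "id \<in> ring_hom ?C ?C" by (auto simp: ring_hom_def)
  from a[OF this] \<open>a \<noteq> \<zero>\<^bsub>?C\<^esub>\<close> obtain \<psi> where \<psi>: "\<psi> \<in> ring_hom (K\<lparr>carrier := T\<rparr>) ?C"
    "\<forall>d\<in>carrier ?C. \<psi> (i d) = d" "\<psi> (\<eta> f) \<noteq> \<zero>\<^bsub>?C\<^esub>" by auto
  have "\<eta> \<in> ring_hom (coord_ring sc) (K\<lparr>carrier := T\<rparr>)"
    using \<eta> \<eta>T unfolding ring_hom_def by auto
  from ring_hom_trans[OF this \<psi>(1)] have "\<psi> \<circ> \<eta> \<in> ring_hom (coord_ring sc) ?C" .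
  then obtain v where v: "\<And>g. g \<in> polynomial_functions sc \<Longrightarrow> (\<psi> \<circ> \<eta>) g = g v"
    using complex_point_of_hom[of "\<psi> \<circ> \<eta>"] \<psi>(2) by (auto simp: i_def ring_of_type_algebra_def)
  have \<psi>0: "\<psi> \<zero>\<^bsub>K\<^esub> = 0"
    using ring_hom_zero[OF \<psi>(1) K.subring_is_ring[OF T(1)] C.ring_axioms]
    by (simp add: ring_of_type_algebra_def)
  show thesis
  proof
    show "f v \<noteq> 0" using v[OF f(1)] \<psi>(3) by (simp add: ring_of_type_algebra_def)
    show "g v = 0" if "g \<in> polynomial_functions sc" "\<eta> g = \<zero>\<^bsub>K\<^esub>" for g
      using v[OF that(1)] that(2) \<psi>0 by simp
  qed
qed

end

section \<open>Fractions and invariants\<close>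

text \<open>Sums and products in \<open>fraction_field\<close> are unions over all pairs of
  representatives. Once the class obtained does not depend on the representatives, the union
  collapses to it.\<close>

lemma UN_pairs_const:
  assumes "p \<in> P" "q \<in> Q" "\<And>a b c d. (a, b) \<in> P \<Longrightarrow> (c, d) \<in> Q \<Longrightarrow> f a b c d = Z"
  shows "(\<Union>(a, b)\<in>P. \<Union>(c, d)\<in>Q. f a b c d) = Z"
proof -
  have "(\<Union>x\<in>P. \<Union>y\<in>Q. f (fst x) (snd x) (fst y) (snd y)) = (\<Union>x\<in>P. \<Union>y\<in>Q. Z)"
    by (intro SUP_cong refl assms(3)) auto
  also have "\<dots> = Z" using assms(1,2) by auto
  finally show ?thesis by (simp add: case_prod_beta)
qed

text \<open>Transitivity of cross-multiplication: the nonzero denominator \<open>b\<close> is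
  cancelled.\<close>

lemma (in domain) fraction_subset:
  assumes "a \<in> carrier R" "b \<in> carrier R - {\<zero>}" "c \<in> carrier R" "d \<in> carrier R - {\<zero>}"
    and eq: "a \<otimes> d = c \<otimes> b"
  shows "fraction R a b \<subseteq> fraction R c d"
proof clarify
  fix x y assume "(x, y) \<in> fraction R a b"
  then have xy: "x \<in> carrier R" "y \<in> carrier R - {\<zero>}" "a \<otimes> y = x \<otimes> b"
    by (simp_all add: fraction_def)
  note car = assms(1,3) xy(1) DiffD1[OF assms(2)] DiffD1[OF assms(4)] DiffD1[OF xy(2)]
  have "b \<otimes> (c \<otimes> y) = (c \<otimes> b) \<otimes> y" using car by (simp add: m_ac)
  also have "\<dots> = (a \<otimes> d) \<otimes> y" by (simp only: eq)
  also have "\<dots> = (a \<otimes> y) \<otimes> d" using car by (simp add: m_ac)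
  also have "\<dots> = (x \<otimes> b) \<otimes> d" by (simp only: xy(3))
  also have "\<dots> = b \<otimes> (x \<otimes> d)" using car by (simp add: m_ac)
  finally have "c \<otimes> y = x \<otimes> d"
    using assms(2) car m_lcancel[of b "c \<otimes> y" "x \<otimes> d"] by simp
  with xy show "(x, y) \<in> fraction R c d" by (simp add: fraction_def)
qed

lemma (in domain) fraction_cong:
  assumes "a \<in> carrier R" "b \<in> carrier R - {\<zero>}" "c \<in> carrier R" "d \<in> carrier R - {\<zero>}"
    and "a \<otimes> d = c \<otimes> b"
  shows "fraction R a b = fraction R c d"
  using fraction_subset[OF assms] fraction_subset[OF assms(3,4,1,2) assms(5)[symmetric]] by blast

lemma (in domain) fraction_eq_of_mem:
  assumes "a \<in> carrier R" "b \<in> carrier R - {\<zero>}" "(c, d) \<in> fraction R a b"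
  shows "c \<in> carrier R" "d \<in> carrier R - {\<zero>}" "fraction R c d = fraction R a b"
    "a \<otimes> d = c \<otimes> b"
  using assms fraction_cong[of a b c d] by (auto simp: fraction_def)

lemma (in domain) mem_fraction_self:
  "a \<in> carrier R \<Longrightarrow> b \<in> carrier R - {\<zero>} \<Longrightarrow> (a, b) \<in> fraction R a b"
  by (auto simp: fraction_def)

lemma (in domain) fraction_mult:
  assumes "a \<in> carrier R" "b \<in> carrier R - {\<zero>}" "c \<in> carrier R" "d \<in> carrier R - {\<zero>}"
  shows "fraction R a b \<otimes>\<^bsub>fraction_field R\<^esub> fraction R c d = fraction R (a \<otimes> c) (b \<otimes> d)"
proof -
  have "fraction R (x \<otimes> x') (y \<otimes> y') = fraction R (a \<otimes> c) (b \<otimes> d)"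
    if "(x, y) \<in> fraction R a b" "(x', y') \<in> fraction R c d" for x y x' y'
  proof -
    note 1 = fraction_eq_of_mem[OF assms(1,2) that(1)] and 2 = fraction_eq_of_mem[OF assms(3,4) that(2)]
    have "(a \<otimes> c) \<otimes> (y \<otimes> y') = (a \<otimes> y) \<otimes> (c \<otimes> y')"
      using 1(1,2) 2(1,2) assms by (simp add: m_ac)
    also have "\<dots> = (x \<otimes> b) \<otimes> (x' \<otimes> d)" by (simp only: 1(4) 2(4))
    also have "\<dots> = (x \<otimes> x') \<otimes> (b \<otimes> d)" using 1(1,2) 2(1,2) assms by (simp add: m_ac)
    finally show ?thesis
      using 1(1,2) 2(1,2) assms by (intro fraction_cong[symmetric]) (auto simp: integral_iff)
  qed
  then show ?thesis
    unfolding fraction_field_def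
    by (simp, intro UN_pairs_const[OF mem_fraction_self[OF assms(1,2)] mem_fraction_self[OF assms(3,4)]])
qed

lemma (in domain) fraction_add:
  assumes "a \<in> carrier R" "b \<in> carrier R - {\<zero>}" "c \<in> carrier R" "d \<in> carrier R - {\<zero>}"
  shows "fraction R a b \<oplus>\<^bsub>fraction_field R\<^esub> fraction R c d = fraction R (a \<otimes> d \<oplus> c \<otimes> b) (b \<otimes> d)"
proof -
  have "fraction R (x \<otimes> y' \<oplus> x' \<otimes> y) (y \<otimes> y') = fraction R (a \<otimes> d \<oplus> c \<otimes> b) (b \<otimes> d)"
    if "(x, y) \<in> fraction R a b" "(x', y') \<in> fraction R c d" for x y x' y'
  proof -
    note 1 = fraction_eq_of_mem[OF assms(1,2) that(1)] and 2 = fraction_eq_of_mem[OF assms(3,4) that(2)]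
    have "(a \<otimes> d \<oplus> c \<otimes> b) \<otimes> (y \<otimes> y') = (a \<otimes> y) \<otimes> (d \<otimes> y') \<oplus> (c \<otimes> y') \<otimes> (b \<otimes> y)"
      using 1(1,2) 2(1,2) assms by (simp add: m_ac l_distr r_distr)
    also have "\<dots> = (x \<otimes> b) \<otimes> (d \<otimes> y') \<oplus> (x' \<otimes> d) \<otimes> (b \<otimes> y)" by (simp only: 1(4) 2(4))
    also have "\<dots> = (x \<otimes> y' \<oplus> x' \<otimes> y) \<otimes> (b \<otimes> d)" using 1(1,2) 2(1,2) assms by (simp add: m_ac l_distr r_distr)
    finally show ?thesis
      using 1(1,2) 2(1,2) assms by (intro fraction_cong[symmetric]) (auto simp: integral_iff)
  qed
  then show ?thesis
    unfolding fraction_field_def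
    by (simp, intro UN_pairs_const[OF mem_fraction_self[OF assms(1,2)] mem_fraction_self[OF assms(3,4)]])
qed

lemma const_in_invariants: "(\<lambda>_. c) \<in> invariants sc G \<rho>"
  by (simp add: invariants_def act_def polynomial_functions.const)

lemma subring_invariants: "subring (invariants sc G \<rho>) (coord_ring sc)"
proof -
  interpret A: cring "coord_ring sc" by (rule cring_coord_ring)
  show ?thesis
    by (rule A.subringI)
      (auto simp: invariants_def act_def fun_eq_iff polynomial_functions_uminus
        intro: polynomial_functions.intros)
qed

text \<open>The identity (a/b)(b/1) = a/1 is carried to \<open>K\<close> by \<iota>: for general
  \<open>a\<close> it presents \<iota>(a/b) as a quotient of images of invariants, and for
  \<open>a = 1\<close> it shows that no nonzero invariant is sent to zero.\<close>

lemma
  assumes "vector_space sc" and K: "field K"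
    and frac: "rational_invariants sc G \<rho> = fractions_of_invariants sc G \<rho>"
    and \<iota>: "\<iota> \<in> ring_hom (rational_invariant_field sc G \<rho>) K"
  shows invariant_to_K_hom:
      "invariant_to_K sc \<iota> \<in> ring_hom (coord_ring sc\<lparr>carrier := invariants sc G \<rho>\<rparr>) K"
    and invariant_to_K_inj: "inj_on (invariant_to_K sc \<iota>) (invariants sc G \<rho>)"
    and rational_invariants_fractions: "\<And>y. y \<in> \<iota> ` rational_invariants sc G \<rho> \<Longrightarrow>
      \<exists>a\<in>invariants sc G \<rho>. \<exists>b\<in>invariants sc G \<rho>. b \<noteq> (\<lambda>_. 0) \<and>
        y \<otimes>\<^bsub>K\<^esub> invariant_to_K sc \<iota> b = invariant_to_K sc \<iota> a"
proof -
  let ?A = "coord_ring sc" and ?R = "invariants sc G \<rho>" and ?\<kappa> = "invariant_to_K sc \<iota>"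
  interpret A: domain ?A by (rule domain_coord_ring) fact
  interpret K: field K by fact
  have RA: "?R \<subseteq> carrier ?A" by (auto simp: invariants_def)
  have one: "(\<lambda>_. 1) \<in> ?R" by (rule const_in_invariants)
  have R_mult: "(\<lambda>v. a v * b v) \<in> ?R" and R_add: "(\<lambda>v. a v + b v) \<in> ?R"
    if "a \<in> ?R" "b \<in> ?R" for a b
    using subringE(6,7)[OF subring_invariants that] by simp_all
  have nz: "(\<lambda>_. 1) \<noteq> (\<lambda>_. 0 :: complex)" by (simp add: fun_eq_iff)
  \<comment> \<open>The hypothesis \<open>frac\<close> places quotients of invariants, and with them
    the fractions f/1, in the domain of \<iota>.\<close>
  have fr: "fraction ?A a b \<in> rational_invariants sc G \<rho>" if "a \<in> ?R" "b \<in> ?R" "b \<noteq> (\<lambda>_. 0)" for a b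
    using that unfolding frac fractions_of_invariants_def by blast
  have fr1: "fraction ?A a (\<lambda>_. 1) \<in> rational_invariants sc G \<rho>" if "a \<in> ?R" for a
    using fr[OF that one nz] .
  have \<iota>_mult: "\<iota> (x \<otimes>\<^bsub>fraction_field ?A\<^esub> y) = \<iota> x \<otimes>\<^bsub>K\<^esub> \<iota> y"
    and \<iota>_add: "\<iota> (x \<oplus>\<^bsub>fraction_field ?A\<^esub> y) = \<iota> x \<oplus>\<^bsub>K\<^esub> \<iota> y"
    if "x \<in> rational_invariants sc G \<rho>" "y \<in> rational_invariants sc G \<rho>" for x y
    using ring_hom_mult[OF \<iota>, of x y] ring_hom_add[OF \<iota>, of x y] that
    by (auto simp: rational_invariant_field_def)
  have \<iota>_closed: "\<iota> x \<in> carrier K" if "x \<in> rational_invariants sc G \<rho>" for x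
    using ring_hom_closed[OF \<iota>, of x] that by (simp add: rational_invariant_field_def)
  have \<iota>_one: "?\<kappa> (\<lambda>_. 1) = \<one>\<^bsub>K\<^esub>"
    using ring_hom_one[OF \<iota>] by (simp add: rational_invariant_field_def invariant_to_K_def fraction_field_def)
  have A1: "(\<lambda>_. 1) \<in> carrier ?A - {\<zero>\<^bsub>?A\<^esub>}" using one RA nz by auto
  show hom: "?\<kappa> \<in> ring_hom (?A\<lparr>carrier := ?R\<rparr>) K"
  proof (rule ring_hom_memI; simp)
    fix f assume f: "f \<in> ?R"
    then show "?\<kappa> f \<in> carrier K" by (simp add: invariant_to_K_def \<iota>_closed fr1)
    fix g assume g: "g \<in> ?R"
    have fgA: "f \<in> polynomial_functions sc" "g \<in> polynomial_functions sc" using f g RA by auto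
    show "?\<kappa> (\<lambda>v. f v * g v) = ?\<kappa> f \<otimes>\<^bsub>K\<^esub> ?\<kappa> g"
      using A.fraction_mult[of f "\<lambda>_. 1" g "\<lambda>_. 1"] \<iota>_mult[OF fr1[OF f] fr1[OF g]] fgA A1
      by (auto simp: invariant_to_K_def)
    show "?\<kappa> (\<lambda>v. f v + g v) = ?\<kappa> f \<oplus>\<^bsub>K\<^esub> ?\<kappa> g"
      using A.fraction_add[of f "\<lambda>_. 1" g "\<lambda>_. 1"] \<iota>_add[OF fr1[OF f] fr1[OF g]] fgA A1
      by (auto simp: invariant_to_K_def)
  next
    show "?\<kappa> (\<lambda>_. 1) = \<one>\<^bsub>K\<^esub>" by (rule \<iota>_one)
  qed
  have clear: "\<iota> (fraction ?A a b) \<otimes>\<^bsub>K\<^esub> ?\<kappa> b = ?\<kappa> a"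
    if ab: "a \<in> ?R" "b \<in> ?R" "b \<noteq> (\<lambda>_. 0)" for a b
  proof -
    have A: "a \<in> carrier ?A" "b \<in> carrier ?A - {\<zero>\<^bsub>?A\<^esub>}" using ab RA by auto
    have "fraction ?A a b \<otimes>\<^bsub>fraction_field ?A\<^esub> fraction ?A b (\<lambda>_. 1) = fraction ?A (a \<otimes>\<^bsub>?A\<^esub> b) (b \<otimes>\<^bsub>?A\<^esub> (\<lambda>_. 1))"
      using A A1 by (intro A.fraction_mult) auto
    also have "\<dots> = fraction ?A a (\<lambda>_. 1)"
      using A A1 R_mult[OF ab(1,2)] RA by (intro A.fraction_cong) auto
    finally show ?thesis
      using \<iota>_mult[OF fr[OF ab] fr1[OF ab(2)]] by (simp add: invariant_to_K_def)
  qed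
  have nonzero: "?\<kappa> b \<noteq> \<zero>\<^bsub>K\<^esub>" if "b \<in> ?R" "b \<noteq> (\<lambda>_. 0)" for b
    using clear[OF one that] \<iota>_one \<iota>_closed[OF fr[OF one that]] by auto
  interpret \<kappa>: ring_hom_ring "?A\<lparr>carrier := ?R\<rparr>" K ?\<kappa>
    by (rule ring_hom_ringI2[OF A.subring_is_ring[OF subring_invariants] K.ring_axioms hom])
  have "a_kernel (?A\<lparr>carrier := ?R\<rparr>) K ?\<kappa> = {\<zero>\<^bsub>?A\<^esub>}"
    using nonzero \<kappa>.hom_zero const_in_invariants[of 0] unfolding a_kernel_def' by auto
  then show "inj_on ?\<kappa> ?R"
    using \<kappa>.trivial_ker_imp_inj by simp
  show "\<exists>a\<in>?R. \<exists>b\<in>?R. b \<noteq> (\<lambda>_. 0) \<and> y \<otimes>\<^bsub>K\<^esub> ?\<kappa> b = ?\<kappa> a"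
    if "y \<in> \<iota> ` rational_invariants sc G \<rho>" for y
  proof -
    obtain a b where "a \<in> ?R" "b \<in> ?R" "b \<noteq> (\<lambda>_. 0)" "y = \<iota> (fraction ?A a b)"
      using \<open>y \<in> _\<close> by (auto simp: frac fractions_of_invariants_def)
    then show ?thesis using clear[of a b] by (intro bexI[of _ a] bexI[of _ b]) auto
  qed
qed

section \<open>Subvarieties as kernels of homomorphisms to \<open>K\<close>\<close>

lemma ideal_vanishing_ideal: "ideal (vanishing_ideal sc Y) (coord_ring sc)"
proof -
  interpret A: cring "coord_ring sc" by (rule cring_coord_ring)
  have zero: "(\<lambda>_. 0) \<in> vanishing_ideal sc Y"
    by (simp add: vanishing_ideal_def polynomial_functions.const)
  have "subgroup (vanishing_ideal sc Y) (add_monoid (coord_ring sc))"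
    by (rule A.add.subgroupI)
      (use zero in \<open>auto simp: vanishing_ideal_def polynomial_functions_uminus a_inv_def[symmetric]
        intro: polynomial_functions.intros\<close>)
  then show ?thesis
    by (rule idealI[OF A.ring_axioms])
      (auto simp: vanishing_ideal_def intro: polynomial_functions.intros)
qed

lemma zariski_closed_eq_zeros:
  assumes "zariski_closed sc Y"
  shows "Y = {v. \<forall>f\<in>vanishing_ideal sc Y. f v = 0}"
  using assms by (fastforce simp: zariski_closed_def vanishing_ideal_def)

text \<open>If Y lies in A \<union> B but in neither, there are f vanishing on A and g vanishing on
  B, each nonzero somewhere on Y, while f g vanishes on Y. The condition on the constant 1
  guarantees that Y is nonempty.\<close>

lemma closed_subvarietyI_prime:
  assumes "zariski_closed sc Y" "(\<lambda>_. 1) \<notin> vanishing_ideal sc Y"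
    and prime: "\<And>f g. f \<in> polynomial_functions sc \<Longrightarrow> g \<in> polynomial_functions sc \<Longrightarrow>
      (\<lambda>v. f v * g v) \<in> vanishing_ideal sc Y \<Longrightarrow> f \<in> vanishing_ideal sc Y \<or> g \<in> vanishing_ideal sc Y"
  shows "closed_subvariety sc Y"
  unfolding closed_subvariety_def
proof (intro conjI allI impI)
  show "Y \<noteq> {}" using assms(2) by (auto simp: vanishing_ideal_def polynomial_functions.const)
  fix A B assume AB: "zariski_closed sc A" "zariski_closed sc B" "Y \<subseteq> A \<union> B"
  show "Y \<subseteq> A \<or> Y \<subseteq> B"
  proof (rule ccontr)
    assume "\<not> ?thesis"
    then obtain a b where "a \<in> Y" "a \<notin> A" "b \<in> Y" "b \<notin> B" by blast
    then obtain f g where "f \<in> vanishing_ideal sc A" "f a \<noteq> 0" "g \<in> vanishing_ideal sc B" "g b \<noteq> 0"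
      using zariski_closed_eq_zeros[OF AB(1)] zariski_closed_eq_zeros[OF AB(2)] by blast
    moreover from this have "(\<lambda>v. f v * g v) \<in> vanishing_ideal sc Y"
      using AB(3) by (auto simp: vanishing_ideal_def intro: polynomial_functions.mult)
    ultimately show False
      using prime[of f g] \<open>a \<in> Y\<close> \<open>b \<in> Y\<close> by (auto simp: vanishing_ideal_def)
  qed
qed fact

lemma closed_subvariety_prime:
  assumes "closed_subvariety sc Y"
  shows "primeideal (vanishing_ideal sc Y) (coord_ring sc)"
proof (rule primeidealI[OF ideal_vanishing_ideal cring_coord_ring])
  have "(\<lambda>_. 1) \<notin> vanishing_ideal sc Y"
    using assms by (auto simp: vanishing_ideal_def closed_subvariety_def)
  then show "carrier (coord_ring sc) \<noteq> vanishing_ideal sc Y"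
    using polynomial_functions.const[of 1] by auto
next
  fix f g assume fg: "f \<in> carrier (coord_ring sc)" "g \<in> carrier (coord_ring sc)"
    "f \<otimes>\<^bsub>coord_ring sc\<^esub> g \<in> vanishing_ideal sc Y"
  have "zariski_closed sc {v. h v = 0}" if "h \<in> polynomial_functions sc" for h
    unfolding zariski_closed_def using that by (intro exI[of _ "{h}"]) auto
  moreover have "Y \<subseteq> {v. f v = 0} \<union> {v. g v = 0}"
    using fg by (auto simp: vanishing_ideal_def)
  ultimately have "Y \<subseteq> {v. f v = 0} \<or> Y \<subseteq> {v. g v = 0}"
    using assms fg unfolding closed_subvariety_def by auto
  then show "f \<in> vanishing_ideal sc Y \<or> g \<in> vanishing_ideal sc Y"
    using fg by (auto simp: vanishing_ideal_def)
qed

text \<open>The kernel of \<eta> is prime because \<open>K\<close> has no zero divisors, and by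
  \<open>nullstellensatz_kernel\<close> no function outside the kernel vanishes on its zero set.
  Uniqueness holds since a closed set is recovered from its vanishing ideal.\<close>

lemma ex1_subvariety_of_hom:
  assumes V: "finite_dimensional_vector_space sc B" and K: "field K"
    and \<eta>: "\<eta> \<in> ring_hom (coord_ring sc) K"
  shows "\<exists>!Y. closed_subvariety sc Y \<and>
    vanishing_ideal sc Y = {f \<in> polynomial_functions sc. \<eta> f = \<zero>\<^bsub>K\<^esub>}"
proof (rule ex_ex1I)
  interpret K: field K by fact
  define P where "P = {f \<in> polynomial_functions sc. \<eta> f = \<zero>\<^bsub>K\<^esub>}"
  define Y where "Y = {v. \<forall>f\<in>P. f v = 0}"
  have closed: "zariski_closed sc Y"
    unfolding zariski_closed_def Y_def P_def by blast
  have Y: "vanishing_ideal sc Y = P"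
  proof
    show "vanishing_ideal sc Y \<subseteq> P"
    proof (rule subsetI, rule ccontr)
      fix f assume f: "f \<in> vanishing_ideal sc Y" "f \<notin> P"
      then have f': "f \<in> polynomial_functions sc" "\<eta> f \<noteq> \<zero>\<^bsub>K\<^esub>"
        by (auto simp: vanishing_ideal_def P_def)
      obtain v where v: "f v \<noteq> 0"
        "\<And>g. g \<in> polynomial_functions sc \<Longrightarrow> \<eta> g = \<zero>\<^bsub>K\<^esub> \<Longrightarrow> g v = 0"
        using nullstellensatz_kernel[OF V K \<eta> f'] by metis
      then have "v \<in> Y" by (simp add: Y_def P_def)
      then show False using f(1) v(1) by (simp add: vanishing_ideal_def)
    qed
    show "P \<subseteq> vanishing_ideal sc Y"
      unfolding vanishing_ideal_def Y_def by (auto simp: P_def)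
  qed
  have "closed_subvariety sc Y"
  proof (rule closed_subvarietyI_prime[OF closed]; unfold Y)
    show "(\<lambda>_. 1) \<notin> P" using ring_hom_one[OF \<eta>] by (simp add: P_def)
    fix f g assume fg: "f \<in> polynomial_functions sc" "g \<in> polynomial_functions sc" "(\<lambda>v. f v * g v) \<in> P"
    then have "\<eta> f \<otimes>\<^bsub>K\<^esub> \<eta> g = \<zero>\<^bsub>K\<^esub>"
      using ring_hom_mult[OF \<eta>, of f g] by (simp add: P_def)
    then show "f \<in> P \<or> g \<in> P"
      using fg K.integral ring_hom_closed[OF \<eta>] by (auto simp: P_def)
  qed
  with Y show "\<exists>Y. closed_subvariety sc Y \<and>
    vanishing_ideal sc Y = {f \<in> polynomial_functions sc. \<eta> f = \<zero>\<^bsub>K\<^esub>}" unfolding P_def by blast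
next
  fix Y Y' assume "closed_subvariety sc Y \<and>
      vanishing_ideal sc Y = {f \<in> polynomial_functions sc. \<eta> f = \<zero>\<^bsub>K\<^esub>}"
    "closed_subvariety sc Y' \<and>
      vanishing_ideal sc Y' = {f \<in> polynomial_functions sc. \<eta> f = \<zero>\<^bsub>K\<^esub>}"
  then show "Y = Y'"
    using zariski_closed_eq_zeros[of sc Y] zariski_closed_eq_zeros[of sc Y']
    by (simp add: closed_subvariety_def)
qed

section \<open>The coordinate ring of a subvariety as a quotient\<close>

lemma restriction_hom: "restriction sc Y \<in> ring_hom (coord_ring sc) (subvariety_ring sc Y)"
  using ideal.rcos_ring_hom[OF ideal_vanishing_ideal]
  unfolding restriction_def[abs_def] subvariety_ring_def .

lemma restriction_eq_iff:
  assumes "f \<in> polynomial_functions sc" "g \<in> polynomial_functions sc"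
  shows "restriction sc Y f = restriction sc Y g \<longleftrightarrow> (\<lambda>v. f v - g v) \<in> vanishing_ideal sc Y"
proof -
  interpret A: cring "coord_ring sc" by (rule cring_coord_ring)
  show ?thesis
    using A.quotient_eq_iff_same_a_r_cos[OF ideal_vanishing_ideal, of f g] assms
    by (simp add: restriction_def)
qed

lemma cring_subvariety_ring: "cring (subvariety_ring sc Y)"
  unfolding subvariety_ring_def
  by (rule ideal.quotient_is_cring[OF ideal_vanishing_ideal cring_coord_ring])

lemma carrier_subvariety_ring:
  "carrier (subvariety_ring sc Y) = restriction sc Y ` polynomial_functions sc"
  by (auto simp: subvariety_ring_def FactRing_def A_RCOSETS_def' restriction_def)

lemma restriction_eq_zero_iff:
  assumes "f \<in> polynomial_functions sc"
  shows "restriction sc Y f = \<zero>\<^bsub>subvariety_ring sc Y\<^esub> \<longleftrightarrow> f \<in> vanishing_ideal sc Y"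
proof -
  interpret A: cring "coord_ring sc" by (rule cring_coord_ring)
  interpret S: cring "subvariety_ring sc Y" by (rule cring_subvariety_ring)
  have "restriction sc Y (\<lambda>_. 0) = \<zero>\<^bsub>subvariety_ring sc Y\<^esub>"
    using ring_hom_zero[OF restriction_hom A.ring_axioms S.ring_axioms] by simp
  then show ?thesis
    using restriction_eq_iff[OF assms polynomial_functions.const[of 0], where Y = Y] by simp
qed

lemma (in ring) eval_map_scale:
  assumes "set p \<subseteq> carrier R" "x \<in> carrier R" "t \<in> carrier R"
  shows "eval (map (\<lambda>y. t \<otimes> y) p) x = t \<otimes> eval p x"
  using assms(1)
proof (induction p)
  case (Cons y p)
  then show ?case
    using assms(2,3) eval_in_carrier[of p x] by (simp add: m_assoc r_distr)
qed (use assms in simp)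

text \<open>Denominators come from a multiplicatively closed set \<open>D\<close>, later the nonzero
  invariants. The list is scaled as a whole so that, by \<open>eval_map_scale\<close>, a root of
  \<open>p\<close> stays a root.\<close>

lemma (in cring) common_denominator:
  assumes R: "cring S" and \<kappa>: "\<kappa> \<in> ring_hom S R"
    and S0: "\<And>a b. a \<in> D \<Longrightarrow> b \<in> D \<Longrightarrow> a \<otimes>\<^bsub>S\<^esub> b \<in> D" "\<one>\<^bsub>S\<^esub> \<in> D" "D \<subseteq> carrier S"
    and p: "set p \<subseteq> carrier R"
    and frac: "\<And>y. y \<in> set p \<Longrightarrow> \<exists>a\<in>carrier S. \<exists>b\<in>D. y \<otimes> \<kappa> b = \<kappa> a"
  obtains b as where "b \<in> D" "set as \<subseteq> carrier S" "map \<kappa> as = map (\<lambda>y. \<kappa> b \<otimes> y) p"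
  using p frac
proof (induction p arbitrary: thesis)
  case Nil
  show ?case by (rule Nil(1)[OF S0(2), of "[]"]) auto
next
  case (Cons y p)
  interpret S: cring S by fact
  interpret \<kappa>: ring_hom_cring S R \<kappa>
    by (rule ring_hom_cringI[OF R is_cring \<kappa>])
  obtain b as where b: "b \<in> D" "set as \<subseteq> carrier S" "map \<kappa> as = map (\<lambda>y. \<kappa> b \<otimes> y) p"
    using Cons.IH Cons.prems by auto
  obtain a0 b0 where a0: "a0 \<in> carrier S" "b0 \<in> D" "y \<otimes> \<kappa> b0 = \<kappa> a0"
    using Cons.prems(3)[of y] by auto
  have car: "b \<in> carrier S" "b0 \<in> carrier S" "y \<in> carrier R" using b a0 S0 Cons.prems by auto
  show ?case
  proof (rule Cons.prems(1))
    \<comment> \<open>Over the new denominator the head acquires the factor \<open>b\<close> and the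
      old entries acquire the factor \<open>b0\<close>.\<close>
    show "b0 \<otimes>\<^bsub>S\<^esub> b \<in> D" using S0 b a0 by blast
    show "set (b \<otimes>\<^bsub>S\<^esub> a0 # map (\<lambda>a. b0 \<otimes>\<^bsub>S\<^esub> a) as) \<subseteq> carrier S"
      using b a0 car by auto
    have "map \<kappa> (map (\<lambda>a. b0 \<otimes>\<^bsub>S\<^esub> a) as) = map (\<lambda>y. \<kappa> b0 \<otimes> y) (map \<kappa> as)"
      using b(2) car by (auto simp: subset_iff)
    also have "\<dots> = map (\<lambda>y. \<kappa> b0 \<otimes> y) (map (\<lambda>y. \<kappa> b \<otimes> y) p)"
      by (simp only: b(3))
    also have "\<dots> = map (\<lambda>y. \<kappa> (b0 \<otimes>\<^bsub>S\<^esub> b) \<otimes> y) p"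
      using car Cons.prems(2) by (auto simp: m_assoc)
    finally show "map \<kappa> (b \<otimes>\<^bsub>S\<^esub> a0 # map (\<lambda>a. b0 \<otimes>\<^bsub>S\<^esub> a) as) = map (\<lambda>y. \<kappa> (b0 \<otimes>\<^bsub>S\<^esub> b) \<otimes> y) (y # p)"
      using a0 car by (simp add: a0(3)[symmetric] m_ac)
  qed
qed

text \<open>
  Reading the coefficient lists from the constant term, whose image vanishes with \<open>\<psi> x\<close>, one can
  divide a relation for \<open>x\<close> by \<open>x\<close> until \<open>x = 0\<close> is forced.
\<close>

lemma algebraic_in_kernel_eq_zero:
  assumes "domain E" "ring S" and \<psi>: "\<psi> \<in> ring_hom E S"
    and inj: "\<And>d. d \<in> D \<Longrightarrow> \<psi> d = \<zero>\<^bsub>S\<^esub> \<Longrightarrow> d = \<zero>\<^bsub>E\<^esub>" and D: "D \<subseteq> carrier E"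
    and x: "x \<in> carrier E" "\<psi> x = \<zero>\<^bsub>S\<^esub>"
    and p: "set p \<subseteq> D" "\<exists>d\<in>set p. d \<noteq> \<zero>\<^bsub>E\<^esub>" "ring.eval E p x = \<zero>\<^bsub>E\<^esub>"
  shows "x = \<zero>\<^bsub>E\<^esub>"
  using p
proof (induction p rule: rev_induct)
  case (snoc a p)
  interpret E: domain E by fact
  interpret S: ring S by fact
  interpret \<psi>: ring_hom_ring E S \<psi> by (rule ring_hom_ringI2[OF E.ring_axioms S.ring_axioms \<psi>])
  have car: "a \<in> carrier E" "set p \<subseteq> carrier E" "E.eval p x \<in> carrier E"
    using snoc.prems D x E.eval_in_carrier[of p x] by auto
  have eq: "E.eval p x \<otimes>\<^bsub>E\<^esub> x \<oplus>\<^bsub>E\<^esub> a = \<zero>\<^bsub>E\<^esub>"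
    using snoc.prems(3) E.eval_append_aux[OF car(2,1) x(1)] by simp
  from arg_cong[OF this, of \<psi>] have "\<psi> a = \<zero>\<^bsub>S\<^esub>"
    using car x by simp
  then have a: "a = \<zero>\<^bsub>E\<^esub>" using inj snoc.prems by auto
  \<comment> \<open>Since \<open>a\<close> is zero, a nonzero coefficient remains in the shorter
    list, so the induction hypothesis settles the first alternative.\<close>
  then have "E.eval p x = \<zero>\<^bsub>E\<^esub> \<or> x = \<zero>\<^bsub>E\<^esub>"
    using eq car x E.integral by simp
  then show ?case using snoc a by auto
qed simp

section \<open>Injectivity and algebraicity over the invariants, seen through maps to
  \<open>K\<close>\<close>

context
  fixes sc :: "complex \<Rightarrow> 'v::ab_group_add \<Rightarrow> 'v" and B :: "'v set"
    and G :: "(complex^'m^'m) set" and \<rho> :: "complex^'m^'m \<Rightarrow> 'v \<Rightarrow> 'v"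
    and K :: "'k ring" and F :: "'k set" and \<kappa> :: "('v \<Rightarrow> complex) \<Rightarrow> 'k"
  assumes V: "finite_dimensional_vector_space sc B"
    and K: "algebraic_closure K F"
    and \<kappa>_hom: "\<kappa> \<in> ring_hom (coord_ring sc\<lparr>carrier := invariants sc G \<rho>\<rparr>) K"
    and \<kappa>_inj: "inj_on \<kappa> (invariants sc G \<rho>)"
    and frac: "\<And>y. y \<in> F \<Longrightarrow> \<exists>a\<in>invariants sc G \<rho>. \<exists>b\<in>invariants sc G \<rho>. b \<noteq> (\<lambda>_. 0) \<and>
        y \<otimes>\<^bsub>K\<^esub> \<kappa> b = \<kappa> a"
begin

interpretation A: domain "coord_ring sc"
  by (rule domain_coord_ring[OF finite_dimensional_vector_space.axioms(1)[OF V]])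

interpretation K: algebraic_closure K F by (rule K)

interpretation R: domain "coord_ring sc\<lparr>carrier := invariants sc G \<rho>\<rparr>"
  by (rule A.subring_is_domain[OF subring_invariants])

lemma invariants_polynomial: "invariants sc G \<rho> \<subseteq> polynomial_functions sc"
  by (auto simp: invariants_def)

lemma kappa_zero_iff: "f \<in> invariants sc G \<rho> \<Longrightarrow> \<kappa> f = \<zero>\<^bsub>K\<^esub> \<longleftrightarrow> f = (\<lambda>_. 0)"
  using ring_hom_zero[OF \<kappa>_hom R.ring_axioms K.ring_axioms] inj_on_eq_iff[OF \<kappa>_inj, of f "\<lambda>_. 0"]
    const_in_invariants[of 0 sc G \<rho>] by simp

text \<open>An invariant vanishing on Y is killed by \<eta>, hence by \<kappa>, and \<kappa> is
  injective.\<close>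

lemma restriction_injective_of_hom:
  assumes \<eta>: "\<eta> \<in> ring_hom (coord_ring sc) K" "\<And>s. s \<in> invariants sc G \<rho> \<Longrightarrow> \<eta> s = \<kappa> s"
    and Y: "vanishing_ideal sc Y = {f \<in> polynomial_functions sc. \<eta> f = \<zero>\<^bsub>K\<^esub>}"
  shows "restriction_injective sc G \<rho> Y"
  unfolding restriction_injective_def
proof (rule inj_onI)
  fix f g assume fg: "f \<in> invariants sc G \<rho>" "g \<in> invariants sc G \<rho>" "restriction sc Y f = restriction sc Y g"
  then have "(\<lambda>v. f v - g v) \<in> vanishing_ideal sc Y"
    using invariants_polynomial restriction_eq_iff by blast
  moreover have "(\<lambda>v. f v - g v) \<in> invariants sc G \<rho>"
    using fg subringE(5)[OF subring_invariants, of g sc G \<rho>] invariants_polynomial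
      subringE(7)[OF subring_invariants, of f sc G \<rho> "\<lambda>v. - g v"] by (auto simp: subset_iff)
  ultimately have "(\<lambda>v. f v - g v) = (\<lambda>_. 0)"
    using \<eta>(2) kappa_zero_iff unfolding Y by auto
  then show "f = g" by (auto simp: fun_eq_iff)
qed

text \<open>A relation for \<eta> f over \<open>F\<close> becomes one over the invariants after
  clearing denominators. Its value at \<open>f\<close>, computed in C[V], is killed by \<eta> and so
  vanishes on Y.\<close>

lemma algebraic_over_invariants_of_hom:
  assumes \<eta>: "\<eta> \<in> ring_hom (coord_ring sc) K" "\<And>s. s \<in> invariants sc G \<rho> \<Longrightarrow> \<eta> s = \<kappa> s"
    and Y: "vanishing_ideal sc Y = {f \<in> polynomial_functions sc. \<eta> f = \<zero>\<^bsub>K\<^esub>}"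
  shows "algebraic_over_invariants sc G \<rho> Y"
  unfolding algebraic_over_invariants_def
proof
  let ?S = "subvariety_ring sc Y"
  interpret S: cring ?S by (rule cring_subvariety_ring)
  interpret \<eta>: ring_hom_ring "coord_ring sc" K \<eta>
    by (rule ring_hom_ringI2[OF A.ring_axioms K.ring_axioms \<eta>(1)])
  interpret r: ring_hom_ring "coord_ring sc" ?S "restriction sc Y"
    by (rule ring_hom_ringI2[OF A.ring_axioms S.ring_axioms restriction_hom])
  fix x assume "x \<in> carrier ?S"
  then obtain f where f: "f \<in> polynomial_functions sc" "x = restriction sc Y f"
    by (auto simp: carrier_subvariety_ring)
  have F: "subring F K" by (rule subfieldE(1)[OF K.subfield_axioms])
  have \<eta>f: "\<eta> f \<in> carrier K" using f by simp
  obtain p where p: "p \<in> carrier (F[X]\<^bsub>K\<^esub>)" "p \<noteq> []" "K.eval p (\<eta> f) = \<zero>\<^bsub>K\<^esub>"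
    using K.algebraicE[OF F \<eta>f K.algebraic_extension[OF \<eta>f]] by blast
  have pF: "set p \<subseteq> F" "hd p \<noteq> \<zero>\<^bsub>K\<^esub>"
    using p unfolding univ_poly_carrier[symmetric] polynomial_def by auto
  have pK: "set p \<subseteq> carrier K" using pF subringE(1)[OF F] by blast
  \<comment> \<open>The common denominator is a nonzero invariant, so \<kappa> b is nonzero and
    scaling by it preserves the leading coefficient.\<close>
  obtain b as where b: "b \<in> invariants sc G \<rho> - {\<lambda>_. 0}" "set as \<subseteq> invariants sc G \<rho>" "map \<kappa> as = map (\<lambda>y. \<kappa> b \<otimes>\<^bsub>K\<^esub> y) p"
  proof (rule K.common_denominator[OF R.is_cring \<kappa>_hom _ _ _ pK, of "invariants sc G \<rho> - {\<lambda>_. 0}"])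
    show "f \<otimes>\<^bsub>coord_ring sc\<lparr>carrier := invariants sc G \<rho>\<rparr>\<^esub> g \<in> invariants sc G \<rho> - {\<lambda>_. 0}"
      if "f \<in> invariants sc G \<rho> - {\<lambda>_. 0}" "g \<in> invariants sc G \<rho> - {\<lambda>_. 0}" for f g
      using that R.m_closed[of f g] R.integral_iff[of f g] by auto
    show "\<exists>a\<in>carrier (coord_ring sc\<lparr>carrier := invariants sc G \<rho>\<rparr>). \<exists>b\<in>invariants sc G \<rho> - {\<lambda>_. 0}. y \<otimes>\<^bsub>K\<^esub> \<kappa> b = \<kappa> a"
      if "y \<in> set p" for y
      using frac[of y] that pF by fastforce
  qed (use R.one_closed R.one_not_zero in auto)
  have \<kappa>b: "\<kappa> b \<in> carrier K" "\<kappa> b \<noteq> \<zero>\<^bsub>K\<^esub>"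
    using b ring_hom_closed[OF \<kappa>_hom, of b] kappa_zero_iff[of b] by auto
  have asA: "set as \<subseteq> carrier (coord_ring sc)" using b invariants_polynomial by auto
  have "map \<eta> as = map \<kappa> as" using \<eta>(2) b(2) by auto
  then have "\<eta> (A.eval as f) = K.eval (map (\<lambda>y. \<kappa> b \<otimes>\<^bsub>K\<^esub> y) p) (\<eta> f)"
    using \<eta>.eval_hom'[of f as] f asA b by simp
  also have "\<dots> = \<zero>\<^bsub>K\<^esub>"
    using K.eval_map_scale[OF pK \<eta>f \<kappa>b(1)] p \<kappa>b by simp
  finally have "A.eval as f \<in> vanishing_ideal sc Y"
    using A.eval_in_carrier[OF asA, of f] f unfolding Y by simp
  then have "restriction sc Y (A.eval as f) = \<zero>\<^bsub>?S\<^esub>"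
    using restriction_eq_zero_iff[of "A.eval as f" sc Y] by (auto simp: vanishing_ideal_def)
  then have ev: "S.eval (map (restriction sc Y) as) x = \<zero>\<^bsub>?S\<^esub>"
    using r.eval_hom'[of f as] f asA by simp
  have as0: "as \<noteq> []" using b(3) p(2) by auto
  then have hd_as: "hd as \<in> invariants sc G \<rho>" using b(2) by (auto simp: subset_iff)
  \<comment> \<open>The restricted list is a polynomial only if its head is nonzero in C[Y]. This
    holds because \<eta> maps the head of \<open>as\<close> to a product of two nonzero
    elements.\<close>
  have "\<kappa> (hd as) = \<kappa> b \<otimes>\<^bsub>K\<^esub> hd p"
    using b(3) as0 p(2) by (metis hd_map)
  then have "\<kappa> (hd as) \<noteq> \<zero>\<^bsub>K\<^esub>"
    using \<kappa>b pF pK p(2) K.integral[of "\<kappa> b" "hd p"] by (auto simp: subset_iff)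
  then have "restriction sc Y (hd as) \<noteq> \<zero>\<^bsub>?S\<^esub>"
    using restriction_eq_zero_iff[of "hd as" sc Y] hd_as invariants_polynomial \<eta>(2) unfolding Y by auto
  then have "map (restriction sc Y) as \<in> carrier ((restriction sc Y ` invariants sc G \<rho>)[X]\<^bsub>?S\<^esub>)"
    using as0 b(2) unfolding univ_poly_carrier[symmetric] polynomial_def by (auto simp: hd_map)
  from S.algebraicI[OF this _ ev] as0
  show "S.algebraic (restriction sc Y ` invariants sc G \<rho>) x" by (simp add: over_def)
qed

text \<open>With \<open>b = 1\<close>, \<open>finite_hom_extension\<close> extends \<kappa> from the
  invariants to C[Y]; injectivity of \<kappa> meets the condition on \<open>a\<close>. The extension
  is injective as well: an element of its kernel is algebraic over the image of the invariants, on
  which the extension has trivial kernel, so \<open>algebraic_in_kernel_eq_zero\<close>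
  applies.\<close>

lemma hom_of_subvariety:
  assumes Y: "closed_subvariety sc Y" "restriction_injective sc G \<rho> Y"
    "algebraic_over_invariants sc G \<rho> Y"
  obtains \<eta> where "\<eta> \<in> ring_hom (coord_ring sc) K" "\<forall>s\<in>invariants sc G \<rho>. \<eta> s = \<kappa> s"
    "vanishing_ideal sc Y = {f \<in> polynomial_functions sc. \<eta> f = \<zero>\<^bsub>K\<^esub>}"
proof -
  let ?S = "subvariety_ring sc Y" and ?D = "coord_ring sc\<lparr>carrier := invariants sc G \<rho>\<rparr>"
  interpret S: domain ?S
    unfolding subvariety_ring_def by (rule primeideal.quotient_is_domain[OF closed_subvariety_prime[OF Y(1)]])
  let ?r = "restriction sc Y"
  have r: "?r \<in> ring_hom ?D ?S"
    using restriction_hom[of sc Y] invariants_polynomial unfolding ring_hom_def by (auto simp: subset_iff Pi_iff)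
  have inj: "inj_on ?r (carrier ?D)" using Y(2) by (simp add: restriction_injective_def)
  have X: "?r ` coordinates sc B \<subseteq> carrier ?S"
    using coordinates_subset[OF V] by (auto simp: carrier_subvariety_ring)
  obtain T where T: "subring T ?S" "?r ` carrier ?D \<subseteq> T" "?r ` coordinates sc B \<subseteq> T"
    and T_ext: "\<And>b. b \<in> T \<Longrightarrow> b \<noteq> \<zero>\<^bsub>?S\<^esub> \<Longrightarrow>
      \<exists>a\<in>carrier ?D. a \<noteq> \<zero>\<^bsub>?D\<^esub> \<and> (\<forall>\<phi>\<in>ring_hom ?D K. \<phi> a \<noteq> \<zero>\<^bsub>K\<^esub> \<longrightarrow>
        (\<exists>\<psi>\<in>ring_hom (?S\<lparr>carrier := T\<rparr>) K. (\<forall>d\<in>carrier ?D. \<psi> (?r d) = \<phi> d) \<and> \<psi> b \<noteq> \<zero>\<^bsub>K\<^esub>))"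
    using finite_hom_extension[OF R.domain_axioms S.domain_axioms r inj
        finite_imageI[OF finite_coordinates[OF V]] X K.field_axioms K.has_roots] by blast
  \<comment> \<open>The images of the coordinates and of the constants, which are invariant,
    generate C[Y], so \<open>T\<close> is everything.\<close>
  have "carrier ?S \<subseteq> T"
    unfolding carrier_subvariety_ring
  proof (rule image_polynomial_functions_subset[OF V restriction_hom T(1) _ T(3)])
    show "?r (\<lambda>_. c) \<in> T" for c
      using T(2) const_in_invariants[of c sc G \<rho>] by auto
  qed
  then have "T = carrier ?S" using subringE(1)[OF T(1)] by blast
  with T_ext[of "\<one>\<^bsub>?S\<^esub>"] obtain a where a: "a \<in> invariants sc G \<rho>" "a \<noteq> (\<lambda>_. 0)"
    "\<forall>\<phi>\<in>ring_hom ?D K. \<phi> a \<noteq> \<zero>\<^bsub>K\<^esub> \<longrightarrow>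
      (\<exists>\<psi>\<in>ring_hom ?S K. (\<forall>d\<in>invariants sc G \<rho>. \<psi> (?r d) = \<phi> d) \<and> \<psi> \<one>\<^bsub>?S\<^esub> \<noteq> \<zero>\<^bsub>K\<^esub>)"
    by auto
  obtain \<psi> where \<psi>: "\<psi> \<in> ring_hom ?S K" "\<And>d. d \<in> invariants sc G \<rho> \<Longrightarrow> \<psi> (?r d) = \<kappa> d"
    using a \<kappa>_hom kappa_zero_iff[of a] by blast
  have "\<psi> \<circ> ?r \<in> ring_hom (coord_ring sc) K"
    using ring_hom_trans[OF restriction_hom \<psi>(1)] .
  moreover have "\<forall>s\<in>invariants sc G \<rho>. (\<psi> \<circ> ?r) s = \<kappa> s" using \<psi>(2) by simp
  moreover have "vanishing_ideal sc Y = {f \<in> polynomial_functions sc. (\<psi> \<circ> ?r) f = \<zero>\<^bsub>K\<^esub>}"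
  proof (intro equalityI subsetI)
    fix f assume "f \<in> vanishing_ideal sc Y"
    moreover from this have f: "f \<in> polynomial_functions sc" by (simp add: vanishing_ideal_def)
    ultimately show "f \<in> {f \<in> polynomial_functions sc. (\<psi> \<circ> ?r) f = \<zero>\<^bsub>K\<^esub>}"
      using restriction_eq_zero_iff[OF f, of Y] ring_hom_zero[OF \<psi>(1) S.ring_axioms K.ring_axioms] by simp
  next
    fix f assume "f \<in> {f \<in> polynomial_functions sc. (\<psi> \<circ> ?r) f = \<zero>\<^bsub>K\<^esub>}"
    then have f: "f \<in> polynomial_functions sc" "\<psi> (?r f) = \<zero>\<^bsub>K\<^esub>" by auto
    have rf: "?r f \<in> carrier ?S" using f by (simp add: carrier_subvariety_ring)
    have sub: "subring (?r ` invariants sc G \<rho>) ?S"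
      using ring_hom_ring.img_is_subring[OF ring_hom_ringI2[OF A.ring_axioms S.ring_axioms restriction_hom] subring_invariants] .
    obtain p where p: "p \<in> carrier ((?r ` invariants sc G \<rho>)[X]\<^bsub>?S\<^esub>)" "p \<noteq> []" "S.eval p (?r f) = \<zero>\<^bsub>?S\<^esub>"
      using S.algebraicE[OF sub rf] Y(3) rf unfolding algebraic_over_invariants_def over_def by blast
    then have p': "set p \<subseteq> ?r ` invariants sc G \<rho>" "\<exists>d\<in>set p. d \<noteq> \<zero>\<^bsub>?S\<^esub>"
      unfolding univ_poly_carrier[symmetric] polynomial_def by (auto intro!: bexI[of _ "hd p"])
    have "d = \<zero>\<^bsub>?S\<^esub>" if "d \<in> ?r ` invariants sc G \<rho>" "\<psi> d = \<zero>\<^bsub>K\<^esub>" for d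
    proof -
      from \<open>d \<in> ?r ` invariants sc G \<rho>\<close> obtain s where s: "d = ?r s" "s \<in> invariants sc G \<rho>" by (rule imageE)
      then have "s = (\<lambda>_. 0)" using that \<psi>(2) kappa_zero_iff by auto
      then show ?thesis
        using s restriction_eq_zero_iff[of s sc Y] by (auto simp: vanishing_ideal_def polynomial_functions.const)
    qed
    then have "?r f = \<zero>\<^bsub>?S\<^esub>"
      using algebraic_in_kernel_eq_zero[OF S.domain_axioms K.ring_axioms \<psi>(1) _ subringE(1)[OF sub] rf f(2) p' p(3)]
      by blast
    then show "f \<in> vanishing_ideal sc Y" using restriction_eq_zero_iff[OF f(1)] by simp
  qed
  ultimately show thesis using that by blast
qed

end

section \<open>Tensor products\<close>

lemma pair_ring_simps [simp]:
  "carrier (pair_ring A B) = {c. Poly_Mapping.keys c \<subseteq> carrier A \<times> carrier B}"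
  "\<one>\<^bsub>pair_ring A B\<^esub> = frag_of (\<one>\<^bsub>A\<^esub>, \<one>\<^bsub>B\<^esub>)"
  "\<zero>\<^bsub>pair_ring A B\<^esub> = 0" "c \<oplus>\<^bsub>pair_ring A B\<^esub> d = c + d"
  by (simp_all add: pair_ring_def)

lemma frag_extend_diff_fun: "frag_extend (\<lambda>x. f x - g x) c = frag_extend f c - frag_extend g c"
  using subset_UNIV
  by (induction c rule: frag_induction) (auto simp: frag_extend_diff)

lemma frag_extend_zero_fun [simp]: "frag_extend (\<lambda>x. 0) c = 0"
  by (simp add: frag_extend_def)

lemma pair_mult_diff:
  "(c - d) \<otimes>\<^bsub>pair_ring A B\<^esub> e = c \<otimes>\<^bsub>pair_ring A B\<^esub> e - d \<otimes>\<^bsub>pair_ring A B\<^esub> e"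
  "e \<otimes>\<^bsub>pair_ring A B\<^esub> (c - d) = e \<otimes>\<^bsub>pair_ring A B\<^esub> c - e \<otimes>\<^bsub>pair_ring A B\<^esub> d"
  by (simp_all add: pair_ring_def frag_extend_diff frag_extend_diff_fun case_prod_unfold)

lemma pair_mult_zero [simp]:
  "0 \<otimes>\<^bsub>pair_ring A B\<^esub> e = 0" "e \<otimes>\<^bsub>pair_ring A B\<^esub> 0 = 0"
  by (simp_all add: pair_ring_def case_prod_unfold)

lemma pair_mult_frag_of [simp]:
  "frag_of (a, b) \<otimes>\<^bsub>pair_ring A B\<^esub> frag_of (a', b') = frag_of (a \<otimes>\<^bsub>A\<^esub> a', b \<otimes>\<^bsub>B\<^esub> b')"
  by (simp add: pair_ring_def)

text \<open>Differences cover sums and negatives at once. Membership of both parts in the carrier is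
  supplied because the laws to be proved are available only there.\<close>

lemma pair_ring_induct [consumes 1, case_names zero frag_of diff]:
  assumes "c \<in> carrier (pair_ring A B)" "P 0"
    and "\<And>a b. a \<in> carrier A \<Longrightarrow> b \<in> carrier B \<Longrightarrow> P (frag_of (a, b))"
    and "\<And>c d. c \<in> carrier (pair_ring A B) \<Longrightarrow> d \<in> carrier (pair_ring A B) \<Longrightarrow> P c \<Longrightarrow> P d \<Longrightarrow> P (c - d)"
  shows "P c"
proof -
  have "P c \<and> c \<in> carrier (pair_ring A B)"
  proof (rule frag_induction[where S = "carrier A \<times> carrier B"])
    fix c d assume "P c \<and> c \<in> carrier (pair_ring A B)" "P d \<and> d \<in> carrier (pair_ring A B)"
    then show "P (c - d) \<and> c - d \<in> carrier (pair_ring A B)"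
      using assms(4) keys_diff[of c d] by auto
  qed (use assms in auto)
  then show ?thesis ..
qed

text \<open>The product is additive in each argument, so the laws of multiplication reduce by
  induction to pairs, where they are those of \<open>A\<close> and \<open>B\<close>.\<close>

lemma cring_pair_ring:
  assumes "cring A" "cring B"
  shows "cring (pair_ring A B)"
proof -
  interpret A: cring A by fact
  interpret B: cring B by fact
  let ?P = "pair_ring A B"
  have sub_closed: "c - d \<in> carrier ?P" if "c \<in> carrier ?P" "d \<in> carrier ?P" for c d
    using that keys_diff[of c d] by auto
  have closed: "c \<otimes>\<^bsub>?P\<^esub> d \<in> carrier ?P" if "c \<in> carrier ?P" "d \<in> carrier ?P" for c d
    using that(1)
  proof (induction c rule: pair_ring_induct)
    case zero
    show ?case by simp
  next
    case (frag_of a b)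
    from that(2) show ?case
    proof (induction d rule: pair_ring_induct)
      case (frag_of a' b')
      then show ?case using \<open>a \<in> carrier A\<close> \<open>b \<in> carrier B\<close> by simp
    next
      case (diff d d')
      show ?case unfolding pair_mult_diff by (rule sub_closed[OF diff.IH])
    qed simp
  next
    case (diff c c')
    show ?case unfolding pair_mult_diff by (rule sub_closed[OF diff.IH])
  qed
  have comm: "c \<otimes>\<^bsub>?P\<^esub> d = d \<otimes>\<^bsub>?P\<^esub> c" if "c \<in> carrier ?P" "d \<in> carrier ?P" for c d
    using that(1)
  proof (induction c rule: pair_ring_induct)
    case (frag_of a b)
    from that(2) show ?case
      by (induction d rule: pair_ring_induct)
        (use frag_of in \<open>auto simp: pair_mult_diff A.m_comm B.m_comm\<close>)
  qed (auto simp: pair_mult_diff)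
  have assoc: "(c \<otimes>\<^bsub>?P\<^esub> d) \<otimes>\<^bsub>?P\<^esub> e = c \<otimes>\<^bsub>?P\<^esub> (d \<otimes>\<^bsub>?P\<^esub> e)"
    if "c \<in> carrier ?P" "d \<in> carrier ?P" "e \<in> carrier ?P" for c d e
    using that(1)
  proof (induction c rule: pair_ring_induct)
    case (frag_of a b)
    from that(2) show ?case
    proof (induction d rule: pair_ring_induct)
      case (frag_of a' b')
      from that(3) show ?case
        by (induction e rule: pair_ring_induct)
          (use \<open>a \<in> carrier A\<close> \<open>b \<in> carrier B\<close> frag_of in \<open>auto simp: pair_mult_diff A.m_assoc B.m_assoc\<close>)
    qed (auto simp: pair_mult_diff)
  qed (auto simp: pair_mult_diff)
  \<comment> \<open>A sum is treated as c - (0 - d), since additivity is available in the form of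
    differences.\<close>
  have distr: "(c + d) \<otimes>\<^bsub>?P\<^esub> e = c \<otimes>\<^bsub>?P\<^esub> e + d \<otimes>\<^bsub>?P\<^esub> e" for c d e
    using pair_mult_diff(1)[of A B c "0 - d" e] pair_mult_diff(1)[of A B 0 d e] by simp
  have one: "\<one>\<^bsub>?P\<^esub> \<otimes>\<^bsub>?P\<^esub> c = c" if "c \<in> carrier ?P" for c
    using that by (induction c rule: pair_ring_induct) (auto simp: pair_mult_diff)
  show ?thesis
  proof (intro cringI abelian_groupI comm_monoidI)
    fix c d assume "c \<in> carrier ?P" "d \<in> carrier ?P"
    then show "c \<oplus>\<^bsub>?P\<^esub> d \<in> carrier ?P"
      using keys_add[of c d] by auto
  next
    fix c assume c: "c \<in> carrier ?P"
    show "\<exists>d\<in>carrier ?P. d \<oplus>\<^bsub>?P\<^esub> c = \<zero>\<^bsub>?P\<^esub>"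
      using c by (intro bexI[of _ "- c"]) auto
  next
    show "\<one>\<^bsub>?P\<^esub> \<in> carrier ?P" by simp
  qed ((rule closed comm assoc; assumption) |
      (simp add: one distr add_ac del: pair_ring_simps(1,2); fail) | simp)+
qed

lemma pair_ring_minus:
  assumes "cring A" "cring B" "c \<in> carrier (pair_ring A B)" "d \<in> carrier (pair_ring A B)"
  shows "c \<ominus>\<^bsub>pair_ring A B\<^esub> d = c - d"
proof -
  interpret P: cring "pair_ring A B" by (rule cring_pair_ring) fact+
  have "\<ominus>\<^bsub>pair_ring A B\<^esub> d = - d"
    using assms(4) by (intro P.minus_equality) auto
  then show ?thesis by (simp add: a_minus_def)
qed

text \<open>The additive map on the free abelian group of pairs that takes (a, b) to f(a) b. On the
  tensor product it induces the map given by \<open>f\<close> and the identity of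
  \<open>S\<close>.\<close>

definition pair_eval :: "('b, 'y) ring_scheme \<Rightarrow> ('a \<Rightarrow> 'b) \<Rightarrow> ('a \<times> 'b \<Rightarrow>\<^sub>0 int) \<Rightarrow> 'b" where
  "pair_eval S f c = (\<Oplus>\<^bsub>S\<^esub>x\<in>Poly_Mapping.keys c. [Poly_Mapping.lookup c x] \<cdot>\<^bsub>S\<^esub> (f (fst x) \<otimes>\<^bsub>S\<^esub> snd x))"

lemma
  assumes "cring A" "cring S" and f: "f \<in> ring_hom A S"
  shows pair_eval_hom: "pair_eval S f \<in> ring_hom (pair_ring A S) S"
    and pair_eval_frag_of: "\<And>a b. a \<in> carrier A \<Longrightarrow> b \<in> carrier S \<Longrightarrow> pair_eval S f (frag_of (a, b)) = f a \<otimes>\<^bsub>S\<^esub> b"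
    and pair_eval_diff: "\<And>c d. c \<in> carrier (pair_ring A S) \<Longrightarrow> d \<in> carrier (pair_ring A S) \<Longrightarrow>
      pair_eval S f (c - d) = pair_eval S f c \<ominus>\<^bsub>S\<^esub> pair_eval S f d"
proof -
  interpret A: cring A by fact
  interpret S: cring S by fact
  interpret f: ring_hom_ring A S f by (rule ring_hom_ringI2[OF A.ring_axioms S.ring_axioms f])
  let ?P = "pair_ring A S" and ?h = "pair_eval S f"
  interpret P: cring ?P by (rule cring_pair_ring) fact+
  let ?m = "\<lambda>x. f (fst x) \<otimes>\<^bsub>S\<^esub> snd x"
  have m: "?m x \<in> carrier S" if "x \<in> carrier A \<times> carrier S" for x
    using that by auto
  \<comment> \<open>Any finite index set containing the support gives the same sum, which brings
    \<open>c\<close>, \<open>d\<close> and \<open>c + d\<close> over one index set.\<close>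
  have on: "?h c = (\<Oplus>\<^bsub>S\<^esub>x\<in>F. [Poly_Mapping.lookup c x] \<cdot>\<^bsub>S\<^esub> ?m x)"
    if "finite F" "Poly_Mapping.keys c \<subseteq> F" "F \<subseteq> carrier A \<times> carrier S" for c F
    unfolding pair_eval_def
  proof (rule S.add.finprod_mono_neutral_cong_left[OF that(1,2)])
    show "[Poly_Mapping.lookup c i] \<cdot>\<^bsub>S\<^esub> ?m i = \<zero>\<^bsub>S\<^esub>" if "i \<in> F - Poly_Mapping.keys c" for i
      using that by (simp add: in_keys_iff add_pow_def)
    show "(\<lambda>x. [Poly_Mapping.lookup c x] \<cdot>\<^bsub>S\<^esub> ?m x) \<in> F \<rightarrow> carrier S"
      using that(3) m by (intro Pi_I S.add.int_pow_closed) auto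
  qed simp
  have h_closed: "?h c \<in> carrier S" if "c \<in> carrier ?P" for c
    unfolding pair_eval_def using that m by (intro S.finsum_closed Pi_I S.add.int_pow_closed) auto
  have h_add: "?h (c + d) = ?h c \<oplus>\<^bsub>S\<^esub> ?h d" if "c \<in> carrier ?P" "d \<in> carrier ?P" for c d
  proof -
    let ?F = "Poly_Mapping.keys c \<union> Poly_Mapping.keys d"
    have F: "finite ?F" "?F \<subseteq> carrier A \<times> carrier S" using that by auto
    have "?h (c + d) = (\<Oplus>\<^bsub>S\<^esub>x\<in>?F. [Poly_Mapping.lookup c x] \<cdot>\<^bsub>S\<^esub> ?m x \<oplus>\<^bsub>S\<^esub> [Poly_Mapping.lookup d x] \<cdot>\<^bsub>S\<^esub> ?m x)"
      using on[OF F(1) keys_add F(2)] F m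
      by (auto simp: lookup_add S.add.int_pow_mult intro!: S.finsum_cong')
    also have "\<dots> = ?h c \<oplus>\<^bsub>S\<^esub> ?h d"
      using F m by (subst S.finsum_addf) (auto simp: on[OF F(1) _ F(2)] intro!: S.add.int_pow_closed)
    finally show ?thesis .
  qed
  show h_frag: "?h (frag_of (a, b)) = f a \<otimes>\<^bsub>S\<^esub> b" if "a \<in> carrier A" "b \<in> carrier S" for a b
    using that by (simp add: pair_eval_def)
  have h_zero: "?h 0 = \<zero>\<^bsub>S\<^esub>" by (simp add: pair_eval_def)
  show h_diff: "?h (c - d) = ?h c \<ominus>\<^bsub>S\<^esub> ?h d" if "c \<in> carrier ?P" "d \<in> carrier ?P" for c d
  proof -
    have cd: "c - d \<in> carrier ?P" using that keys_diff[of c d] by auto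
    have "?h c = ?h (c - d) \<oplus>\<^bsub>S\<^esub> ?h d"
      using h_add[OF cd that(2)] by simp
    then show ?thesis
      using h_closed[OF cd] h_closed[OF that(2)]
      by (simp add: a_minus_def S.a_assoc S.r_neg)
  qed
  have h_mult: "?h (c \<otimes>\<^bsub>?P\<^esub> d) = ?h c \<otimes>\<^bsub>S\<^esub> ?h d" if "c \<in> carrier ?P" "d \<in> carrier ?P" for c d
    using that(1)
  proof (induction c rule: pair_ring_induct)
    case zero
    show ?case using h_closed[OF that(2)] by (simp add: h_zero)
  next
    case (frag_of a b)
    from that(2) show ?case
    proof (induction d rule: pair_ring_induct)
      case zero
      show ?case using frag_of by (simp add: h_frag h_zero)
    next
      case (frag_of a' b')
      then show ?case
        using \<open>a \<in> carrier A\<close> \<open>b \<in> carrier S\<close> by (simp add: h_frag S.m_ac)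
    next
      case (diff d d')
      have ab: "frag_of (a, b) \<in> carrier ?P" using frag_of by simp
      show ?case
        unfolding pair_mult_diff h_diff[OF P.m_closed[OF ab diff(1)] P.m_closed[OF ab diff(2)]]
          h_diff[OF diff(1,2)] diff.IH
        using h_closed[OF ab] h_closed[OF diff(1)] h_closed[OF diff(2)]
        by (simp add: a_minus_def S.r_distr S.r_minus)
    qed
  next
    case (diff c c')
    show ?case
      unfolding pair_mult_diff h_diff[OF P.m_closed[OF diff(1) that(2)] P.m_closed[OF diff(2) that(2)]]
        h_diff[OF diff(1,2)] diff.IH
      using h_closed[OF that(2)] h_closed[OF diff(1)] h_closed[OF diff(2)]
      by (simp add: a_minus_def S.l_distr S.l_minus)
  qed
  show "?h \<in> ring_hom ?P S"
  proof (rule ring_hom_memI)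
    show "?h \<one>\<^bsub>?P\<^esub> = \<one>\<^bsub>S\<^esub>" by (simp add: h_frag)
  qed (use h_closed h_add h_mult in simp_all)
qed

section \<open>Tensor products as quotients of the ring of pairs\<close>

definition tensor_relations ::
    "'s set \<Rightarrow> ('s \<Rightarrow> 'a) \<Rightarrow> ('s \<Rightarrow> 'b) \<Rightarrow> ('a, 'x) ring_scheme \<Rightarrow> ('b, 'y) ring_scheme
      \<Rightarrow> ('a \<times> 'b \<Rightarrow>\<^sub>0 int) set" where
  "tensor_relations S \<phi> \<psi> A B =
    {frag_of (a \<oplus>\<^bsub>A\<^esub> a', b) - frag_of (a, b) - frag_of (a', b) | a a' b.
        a \<in> carrier A \<and> a' \<in> carrier A \<and> b \<in> carrier B} \<union>
     {frag_of (a, b \<oplus>\<^bsub>B\<^esub> b') - frag_of (a, b) - frag_of (a, b') | a b b'.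
        a \<in> carrier A \<and> b \<in> carrier B \<and> b' \<in> carrier B} \<union>
     {frag_of (\<phi> s \<otimes>\<^bsub>A\<^esub> a, b) - frag_of (a, \<psi> s \<otimes>\<^bsub>B\<^esub> b) | s a b.
        s \<in> S \<and> a \<in> carrier A \<and> b \<in> carrier B}"

lemma tensor_ideal_eq: "tensor_ideal S \<phi> \<psi> A B = Idl\<^bsub>pair_ring A B\<^esub> (tensor_relations S \<phi> \<psi> A B)"
  unfolding tensor_ideal_def tensor_relations_def ..

text \<open>The structure maps are assumed to land in the carriers, which is what makes the
  relations elements of the ring of pairs.\<close>

locale tensor_product =
  fixes S :: "'s set" and \<phi> :: "'s \<Rightarrow> 'a" and \<psi> :: "'s \<Rightarrow> 'b"
    and A :: "('a, 'x) ring_scheme" and B :: "('b, 'y) ring_scheme"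
  assumes A: "cring A" and B: "cring B"
    and \<phi>: "\<And>s. s \<in> S \<Longrightarrow> \<phi> s \<in> carrier A" and \<psi>: "\<And>s. s \<in> S \<Longrightarrow> \<psi> s \<in> carrier B"
begin

sublocale A: cring A by (rule A)
sublocale B: cring B by (rule B)
sublocale P: cring "pair_ring A B" by (rule cring_pair_ring[OF A B])

abbreviation (input) "PR \<equiv> pair_ring A B"
abbreviation (input) "TI \<equiv> tensor_ideal S \<phi> \<psi> A B"
abbreviation (input) "TR \<equiv> tensor_ring S \<phi> \<psi> A B"

lemma diff_in_pair_ring: "c \<in> carrier PR \<Longrightarrow> d \<in> carrier PR \<Longrightarrow> c - d \<in> carrier PR"
  using pair_ring_minus[OF A B, of c d] P.minus_closed[of c d] by simp

lemma tensor_relations_subset: "tensor_relations S \<phi> \<psi> A B \<subseteq> carrier PR"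
  unfolding tensor_relations_def
  by (auto simp del: pair_ring_simps(1) intro!: diff_in_pair_ring) (auto simp: \<phi> \<psi>)

lemma tensor_ideal_ideal: "ideal TI PR"
  unfolding tensor_ideal_eq by (rule P.genideal_ideal[OF tensor_relations_subset])

lemma tensor_relations_in_ideal: "tensor_relations S \<phi> \<psi> A B \<subseteq> TI"
  unfolding tensor_ideal_eq by (rule P.genideal_self[OF tensor_relations_subset])

lemma tensor_ideal_minimal:
  "ideal J PR \<Longrightarrow> tensor_relations S \<phi> \<psi> A B \<subseteq> J \<Longrightarrow> TI \<subseteq> J"
  unfolding tensor_ideal_eq by (rule P.genideal_minimal)

lemma cring_tensor_ring: "cring TR"
  unfolding tensor_ring_def
  by (rule ideal.quotient_is_cring[OF tensor_ideal_ideal P.is_cring])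

lemma tensor_coset_hom: "(\<lambda>c. TI +>\<^bsub>PR\<^esub> c) \<in> ring_hom PR TR"
  unfolding tensor_ring_def by (rule ideal.rcos_ring_hom[OF tensor_ideal_ideal])

lemma carrier_tensor_ring: "carrier TR = (\<lambda>c. TI +>\<^bsub>PR\<^esub> c) ` carrier PR"
  by (auto simp: tensor_ring_def FactRing_def A_RCOSETS_def' simp del: pair_ring_simps)

lemma tensor_coset_eq_iff:
  "c \<in> carrier PR \<Longrightarrow> d \<in> carrier PR \<Longrightarrow> TI +>\<^bsub>PR\<^esub> c = TI +>\<^bsub>PR\<^esub> d \<longleftrightarrow> c - d \<in> TI"
  using P.quotient_eq_iff_same_a_r_cos[OF tensor_ideal_ideal, of c d] pair_ring_minus[OF A B, of c d]
  by simp

lemma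
  shows tensor_add_left: "a \<in> carrier A \<Longrightarrow> a' \<in> carrier A \<Longrightarrow> b \<in> carrier B \<Longrightarrow>
      TI +>\<^bsub>PR\<^esub> frag_of (a \<oplus>\<^bsub>A\<^esub> a', b) = TI +>\<^bsub>PR\<^esub> (frag_of (a, b) + frag_of (a', b))"
    and tensor_add_right: "a \<in> carrier A \<Longrightarrow> b \<in> carrier B \<Longrightarrow> b' \<in> carrier B \<Longrightarrow>
      TI +>\<^bsub>PR\<^esub> frag_of (a, b \<oplus>\<^bsub>B\<^esub> b') = TI +>\<^bsub>PR\<^esub> (frag_of (a, b) + frag_of (a, b'))"
    and tensor_balanced: "s \<in> S \<Longrightarrow> a \<in> carrier A \<Longrightarrow> b \<in> carrier B \<Longrightarrow>
      TI +>\<^bsub>PR\<^esub> frag_of (\<phi> s \<otimes>\<^bsub>A\<^esub> a, b) = TI +>\<^bsub>PR\<^esub> frag_of (a, \<psi> s \<otimes>\<^bsub>B\<^esub> b)"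
proof -
  have frag: "frag_of (a, b) \<in> carrier PR" if "a \<in> carrier A" "b \<in> carrier B" for a b
    using that by simp
  show "TI +>\<^bsub>PR\<^esub> frag_of (a \<oplus>\<^bsub>A\<^esub> a', b) = TI +>\<^bsub>PR\<^esub> (frag_of (a, b) + frag_of (a', b))"
    if "a \<in> carrier A" "a' \<in> carrier A" "b \<in> carrier B"
  proof (subst tensor_coset_eq_iff)
    have "frag_of (a \<oplus>\<^bsub>A\<^esub> a', b) - frag_of (a, b) - frag_of (a', b) \<in> TI"
      by (rule subsetD[OF tensor_relations_in_ideal]) (use that in \<open>auto simp: tensor_relations_def\<close>)
    then show "frag_of (a \<oplus>\<^bsub>A\<^esub> a', b) - (frag_of (a, b) + frag_of (a', b)) \<in> TI"
      by (simp add: diff_diff_eq)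
    show "frag_of (a, b) + frag_of (a', b) \<in> carrier PR"
      using P.a_closed[OF frag[of a b] frag[of a' b]] that by simp
  qed (use that in \<open>simp add: frag\<close>)
  show "TI +>\<^bsub>PR\<^esub> frag_of (a, b \<oplus>\<^bsub>B\<^esub> b') = TI +>\<^bsub>PR\<^esub> (frag_of (a, b) + frag_of (a, b'))"
    if "a \<in> carrier A" "b \<in> carrier B" "b' \<in> carrier B"
  proof (subst tensor_coset_eq_iff)
    have "frag_of (a, b \<oplus>\<^bsub>B\<^esub> b') - frag_of (a, b) - frag_of (a, b') \<in> TI"
      by (rule subsetD[OF tensor_relations_in_ideal]) (use that in \<open>auto simp: tensor_relations_def\<close>)
    then show "frag_of (a, b \<oplus>\<^bsub>B\<^esub> b') - (frag_of (a, b) + frag_of (a, b')) \<in> TI"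
      by (simp add: diff_diff_eq)
    show "frag_of (a, b) + frag_of (a, b') \<in> carrier PR"
      using P.a_closed[OF frag[of a b] frag[of a b']] that by simp
  qed (use that in \<open>simp add: frag\<close>)
  show "TI +>\<^bsub>PR\<^esub> frag_of (\<phi> s \<otimes>\<^bsub>A\<^esub> a, b) = TI +>\<^bsub>PR\<^esub> frag_of (a, \<psi> s \<otimes>\<^bsub>B\<^esub> b)"
    if "s \<in> S" "a \<in> carrier A" "b \<in> carrier B"
  proof (subst tensor_coset_eq_iff)
    show "frag_of (\<phi> s \<otimes>\<^bsub>A\<^esub> a, b) - frag_of (a, \<psi> s \<otimes>\<^bsub>B\<^esub> b) \<in> TI"
      by (rule subsetD[OF tensor_relations_in_ideal]) (use that in \<open>auto simp: tensor_relations_def\<close>)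
  qed (use that \<phi> \<psi> in simp_all)
qed

text \<open>The composite with a map \<open>h\<close> out of the tensor ring is treated directly
  because \<open>h\<close> will be the projection to a residue field L. Together with
  \<open>tensor_hom_right\<close> this gives C[V] -> L and K -> L.\<close>

lemma tensor_hom_left:
  assumes "ring L" and h: "h \<in> ring_hom TR L"
  shows "(\<lambda>a. h (TI +>\<^bsub>PR\<^esub> frag_of (a, \<one>\<^bsub>B\<^esub>))) \<in> ring_hom A L"
proof (rule ring_hom_memI)
  have g: "(\<lambda>c. h (TI +>\<^bsub>PR\<^esub> c)) \<in> ring_hom PR L"
    using ring_hom_trans[OF tensor_coset_hom h] by (simp add: comp_def)
  fix a a' assume a: "a \<in> carrier A" "a' \<in> carrier A"
  then have frag: "frag_of (a, \<one>\<^bsub>B\<^esub>) \<in> carrier PR" "frag_of (a', \<one>\<^bsub>B\<^esub>) \<in> carrier PR" by auto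
  show "h (TI +>\<^bsub>PR\<^esub> frag_of (a, \<one>\<^bsub>B\<^esub>)) \<in> carrier L"
    by (rule ring_hom_closed[OF g frag(1)])
  show "h (TI +>\<^bsub>PR\<^esub> frag_of (a \<otimes>\<^bsub>A\<^esub> a', \<one>\<^bsub>B\<^esub>)) =
      h (TI +>\<^bsub>PR\<^esub> frag_of (a, \<one>\<^bsub>B\<^esub>)) \<otimes>\<^bsub>L\<^esub> h (TI +>\<^bsub>PR\<^esub> frag_of (a', \<one>\<^bsub>B\<^esub>))"
    using ring_hom_mult[OF g frag] by simp
  show "h (TI +>\<^bsub>PR\<^esub> frag_of (a \<oplus>\<^bsub>A\<^esub> a', \<one>\<^bsub>B\<^esub>)) =
      h (TI +>\<^bsub>PR\<^esub> frag_of (a, \<one>\<^bsub>B\<^esub>)) \<oplus>\<^bsub>L\<^esub> h (TI +>\<^bsub>PR\<^esub> frag_of (a', \<one>\<^bsub>B\<^esub>))"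
    using ring_hom_add[OF g frag] a by (simp add: tensor_add_left)
next
  show "h (TI +>\<^bsub>PR\<^esub> frag_of (\<one>\<^bsub>A\<^esub>, \<one>\<^bsub>B\<^esub>)) = \<one>\<^bsub>L\<^esub>"
    using ring_hom_one[OF ring_hom_trans[OF tensor_coset_hom h]] by simp
qed

lemma tensor_hom_right:
  assumes "ring L" and h: "h \<in> ring_hom TR L"
  shows "(\<lambda>b. h (TI +>\<^bsub>PR\<^esub> frag_of (\<one>\<^bsub>A\<^esub>, b))) \<in> ring_hom B L"
proof (rule ring_hom_memI)
  have g: "(\<lambda>c. h (TI +>\<^bsub>PR\<^esub> c)) \<in> ring_hom PR L"
    using ring_hom_trans[OF tensor_coset_hom h] by (simp add: comp_def)
  fix b b' assume b: "b \<in> carrier B" "b' \<in> carrier B"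
  then have frag: "frag_of (\<one>\<^bsub>A\<^esub>, b) \<in> carrier PR" "frag_of (\<one>\<^bsub>A\<^esub>, b') \<in> carrier PR" by auto
  show "h (TI +>\<^bsub>PR\<^esub> frag_of (\<one>\<^bsub>A\<^esub>, b)) \<in> carrier L"
    by (rule ring_hom_closed[OF g frag(1)])
  show "h (TI +>\<^bsub>PR\<^esub> frag_of (\<one>\<^bsub>A\<^esub>, b \<otimes>\<^bsub>B\<^esub> b')) =
      h (TI +>\<^bsub>PR\<^esub> frag_of (\<one>\<^bsub>A\<^esub>, b)) \<otimes>\<^bsub>L\<^esub> h (TI +>\<^bsub>PR\<^esub> frag_of (\<one>\<^bsub>A\<^esub>, b'))"
    using ring_hom_mult[OF g frag] by simp
  show "h (TI +>\<^bsub>PR\<^esub> frag_of (\<one>\<^bsub>A\<^esub>, b \<oplus>\<^bsub>B\<^esub> b')) =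
      h (TI +>\<^bsub>PR\<^esub> frag_of (\<one>\<^bsub>A\<^esub>, b)) \<oplus>\<^bsub>L\<^esub> h (TI +>\<^bsub>PR\<^esub> frag_of (\<one>\<^bsub>A\<^esub>, b'))"
    using ring_hom_add[OF g frag] b by (simp add: tensor_add_right)
next
  show "h (TI +>\<^bsub>PR\<^esub> frag_of (\<one>\<^bsub>A\<^esub>, \<one>\<^bsub>B\<^esub>)) = \<one>\<^bsub>L\<^esub>"
    using ring_hom_one[OF ring_hom_trans[OF tensor_coset_hom h]] by simp
qed

lemma tensor_hom_balanced:
  assumes "s \<in> S"
  shows "TI +>\<^bsub>PR\<^esub> frag_of (\<phi> s, \<one>\<^bsub>B\<^esub>) = TI +>\<^bsub>PR\<^esub> frag_of (\<one>\<^bsub>A\<^esub>, \<psi> s)"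
  using tensor_balanced[OF assms A.one_closed B.one_closed] \<phi>[OF assms] \<psi>[OF assms] by simp

text \<open>A pair (a, b) is the product of (a, 1) and (1, b), so the two factors generate the
  tensor ring.\<close>

lemma tensor_hom_image_subset:
  assumes "ring L" and h: "h \<in> ring_hom TR L" and T: "subring T L"
    and "\<And>a. a \<in> carrier A \<Longrightarrow> h (TI +>\<^bsub>PR\<^esub> frag_of (a, \<one>\<^bsub>B\<^esub>)) \<in> T"
    and "\<And>b. b \<in> carrier B \<Longrightarrow> h (TI +>\<^bsub>PR\<^esub> frag_of (\<one>\<^bsub>A\<^esub>, b)) \<in> T"
  shows "h ` carrier TR \<subseteq> T"
proof -
  interpret L: ring L by fact
  have g: "(\<lambda>c. h (TI +>\<^bsub>PR\<^esub> c)) \<in> ring_hom PR L"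
    using ring_hom_trans[OF tensor_coset_hom h] by (simp add: comp_def)
  interpret g: ring_hom_ring PR L "\<lambda>c. h (TI +>\<^bsub>PR\<^esub> c)"
    by (rule ring_hom_ringI2[OF P.ring_axioms L.ring_axioms g])
  have "h (TI +>\<^bsub>PR\<^esub> c) \<in> T" if "c \<in> carrier PR" for c
    using that
  proof (induction c rule: pair_ring_induct)
    case zero
    show ?case using g.hom_zero subringE(2)[OF T] by simp
  next
    case (frag_of a b)
    then show ?case
      using g.hom_mult[of "frag_of (a, \<one>\<^bsub>B\<^esub>)" "frag_of (\<one>\<^bsub>A\<^esub>, b)"] assms(4)[of a] assms(5)[of b]
        subringE(6)[OF T] by simp
  next
    case (diff c d)
    have "h (TI +>\<^bsub>PR\<^esub> (c \<ominus>\<^bsub>PR\<^esub> d)) = h (TI +>\<^bsub>PR\<^esub> c) \<ominus>\<^bsub>L\<^esub> h (TI +>\<^bsub>PR\<^esub> d)"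
      using diff(1,2) unfolding a_minus_def by (simp del: pair_ring_simps)
    then show ?case
      using diff pair_ring_minus[OF A B diff(1,2)] subringE(5,7)[OF T] by (simp add: a_minus_def)
  qed
  then show ?thesis unfolding carrier_tensor_ring by blast
qed

end

text \<open>More scalars impose more balancing relations. For the constants among the invariants,
  the inclusion yields the surjection from the tensor product over the complex numbers.\<close>

lemma tensor_ideal_subset:
  assumes "cring A" "cring B" "\<And>s. s \<in> S' \<Longrightarrow> \<phi>' s \<in> carrier A" "\<And>s. s \<in> S' \<Longrightarrow> \<psi>' s \<in> carrier B"
    and sub: "\<And>s. s \<in> S \<Longrightarrow> \<exists>s'\<in>S'. \<phi> s = \<phi>' s' \<and> \<psi> s = \<psi>' s'"
  shows "tensor_ideal S \<phi> \<psi> A B \<subseteq> tensor_ideal S' \<phi>' \<psi>' A B"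
proof -
  interpret T': tensor_product S' \<phi>' \<psi>' A B by (rule tensor_product.intro) fact+
  interpret T: tensor_product S \<phi> \<psi> A B
  proof (rule tensor_product.intro[OF assms(1,2)])
    fix s assume "s \<in> S"
    then obtain s' where s': "s' \<in> S'" "\<phi> s = \<phi>' s'" "\<psi> s = \<psi>' s'" using sub by blast
    show "\<phi> s \<in> carrier A" "\<psi> s \<in> carrier B"
      unfolding s'(2,3) by (rule assms(3)[OF s'(1)], rule assms(4)[OF s'(1)])
  qed
  have "tensor_relations S \<phi> \<psi> A B \<subseteq> tensor_relations S' \<phi>' \<psi>' A B"
    unfolding tensor_relations_def
  proof (intro Un_mono order_refl subsetI)
    fix c assume "c \<in> {frag_of (\<phi> s \<otimes>\<^bsub>A\<^esub> a, b) - frag_of (a, \<psi> s \<otimes>\<^bsub>B\<^esub> b) | s a b.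
        s \<in> S \<and> a \<in> carrier A \<and> b \<in> carrier B}"
    then obtain s a b where c: "c = frag_of (\<phi> s \<otimes>\<^bsub>A\<^esub> a, b) - frag_of (a, \<psi> s \<otimes>\<^bsub>B\<^esub> b)"
      "s \<in> S" "a \<in> carrier A" "b \<in> carrier B" by blast
    obtain s' where "s' \<in> S'" "\<phi> s = \<phi>' s'" "\<psi> s = \<psi>' s'" using sub[OF c(2)] by blast
    with c show "c \<in> {frag_of (\<phi>' s \<otimes>\<^bsub>A\<^esub> a, b) - frag_of (a, \<psi>' s \<otimes>\<^bsub>B\<^esub> b) | s a b.
        s \<in> S' \<and> a \<in> carrier A \<and> b \<in> carrier B}" by auto
  qed
  from this T'.tensor_relations_in_ideal
  have "tensor_relations S \<phi> \<psi> A B \<subseteq> tensor_ideal S' \<phi>' \<psi>' A B" by (rule subset_trans)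
  then show ?thesis by (rule T.tensor_ideal_minimal[OF T'.tensor_ideal_ideal])
qed

lemma kernel_of_surjection_maximal:
  assumes "cring R" "field S" and g: "g \<in> ring_hom R S" and surj: "g ` carrier R = carrier S"
  shows "maximalideal (a_kernel R S g) R"
proof -
  interpret R: cring R by fact
  interpret S: field S by fact
  interpret g: ring_hom_ring R S g by (rule ring_hom_ringI2[OF R.ring_axioms S.ring_axioms g])
  show ?thesis
  proof (rule maximalidealI[OF g.kernel_is_ideal])
    show "carrier R \<noteq> a_kernel R S g"
    proof
      assume "carrier R = a_kernel R S g"
      then have "\<one>\<^bsub>R\<^esub> \<in> a_kernel R S g" using R.one_closed by simp
      then have "g \<one>\<^bsub>R\<^esub> = \<zero>\<^bsub>S\<^esub>" unfolding a_kernel_def' by blast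
      then show False by simp
    qed
    fix J assume J: "ideal J R" "a_kernel R S g \<subseteq> J" "J \<subseteq> carrier R"
    interpret J: ideal J R by fact
    show "J = a_kernel R S g \<or> J = carrier R"
    proof (rule disjCI)
      assume "J \<noteq> carrier R"
      have "x \<in> a_kernel R S g" if x: "x \<in> J" for x
      proof (rule ccontr)
        have xR: "x \<in> carrier R" using x J(3) by blast
        assume "x \<notin> a_kernel R S g"
        then have "g x \<in> carrier S - {\<zero>\<^bsub>S\<^esub>}"
          using xR ring_hom_closed[OF g] unfolding a_kernel_def' by blast
        then have gx: "g x \<in> Units S"
          by (simp only: S.field_Units)
        have "inv\<^bsub>S\<^esub> g x \<in> g ` carrier R"
          using surj S.Units_inv_closed[OF gx] by simp
        then obtain y where y: "y \<in> carrier R" "g y = inv\<^bsub>S\<^esub> g x" by (metis imageE)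
        \<comment> \<open>With \<open>y\<close> a preimage of the inverse of \<open>g x\<close>, the
          element 1 - x y lies in the kernel and hence in \<open>J\<close>, as does x y.\<close>
        have "g (\<one>\<^bsub>R\<^esub> \<ominus>\<^bsub>R\<^esub> x \<otimes>\<^bsub>R\<^esub> y) = \<zero>\<^bsub>S\<^esub>"
          using xR y gx by (simp add: a_minus_def S.Units_r_inv S.r_neg)
        then have "\<one>\<^bsub>R\<^esub> \<ominus>\<^bsub>R\<^esub> x \<otimes>\<^bsub>R\<^esub> y \<in> a_kernel R S g"
          using xR y(1) unfolding a_kernel_def' by simp
        then have "\<one>\<^bsub>R\<^esub> \<ominus>\<^bsub>R\<^esub> x \<otimes>\<^bsub>R\<^esub> y \<in> J"
          using J(2) by blast
        moreover have "x \<otimes>\<^bsub>R\<^esub> y \<in> J" using J.I_r_closed[OF x y(1)] .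
        ultimately have "(\<one>\<^bsub>R\<^esub> \<ominus>\<^bsub>R\<^esub> x \<otimes>\<^bsub>R\<^esub> y) \<oplus>\<^bsub>R\<^esub> x \<otimes>\<^bsub>R\<^esub> y \<in> J"
          by (rule J.a_closed)
        then have "\<one>\<^bsub>R\<^esub> \<in> J"
          using xR y by (simp add: a_minus_def R.a_assoc R.l_neg)
        then show False using J.one_imp_carrier \<open>J \<noteq> carrier R\<close> by blast
      qed
      then show "J = a_kernel R S g" using J(2) by blast
    qed
  qed
qed

text \<open>The kernel of a ring homomorphism is an ideal, so only the generating relations need
  checking; \<open>compat\<close> settles the balancing one. Consequently \<open>pair_eval\<close>
  descends to the tensor product.\<close>

lemma pair_eval_tensor_ideal:
  assumes "cring A" "cring B" and f: "f \<in> ring_hom A B"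
    and \<phi>: "\<And>s. s \<in> S \<Longrightarrow> \<phi> s \<in> carrier A" and \<psi>: "\<And>s. s \<in> S \<Longrightarrow> \<psi> s \<in> carrier B"
    and compat: "\<And>s. s \<in> S \<Longrightarrow> f (\<phi> s) = \<psi> s"
    and c: "c \<in> tensor_ideal S \<phi> \<psi> A B"
  shows "pair_eval B f c = \<zero>\<^bsub>B\<^esub>"
proof -
  let ?h = "pair_eval B f" and ?P = "pair_ring A B"
  interpret A: cring A by fact
  interpret B: cring B by fact
  interpret P: cring ?P by (rule cring_pair_ring) fact+
  interpret f: ring_hom_ring A B f by (rule ring_hom_ringI2[OF A.ring_axioms B.ring_axioms f])
  interpret h: ring_hom_ring ?P B ?h
    by (rule ring_hom_ringI2[OF P.ring_axioms B.ring_axioms pair_eval_hom[OF assms(1-3)]])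
  interpret T: tensor_product S \<phi> \<psi> A B by (rule tensor_product.intro) fact+
  have frag: "frag_of (a, b) \<in> carrier ?P" if "a \<in> carrier A" "b \<in> carrier B" for a b
    using that by simp
  note diff = pair_eval_diff[OF assms(1-3)] and ev = pair_eval_frag_of[OF assms(1-3)]
    and closed = T.diff_in_pair_ring
  have cancel: "x \<oplus>\<^bsub>B\<^esub> y \<ominus>\<^bsub>B\<^esub> x = y"
    if "x \<in> carrier B" "y \<in> carrier B" for x y
    using that by algebra
  have "?h r = \<zero>\<^bsub>B\<^esub>" if r: "r \<in> tensor_relations S \<phi> \<psi> A B" for r
    using r unfolding tensor_relations_def
  proof (elim UnE CollectE exE conjE)
    fix a a' b assume "r = frag_of (a \<oplus>\<^bsub>A\<^esub> a', b) - frag_of (a, b) - frag_of (a', b)"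
      "a \<in> carrier A" "a' \<in> carrier A" "b \<in> carrier B"
    then show "?h r = \<zero>\<^bsub>B\<^esub>"
      by (simp add: diff closed frag ev del: pair_ring_simps) (simp add: B.l_distr cancel)
  next
    fix a b b' assume "r = frag_of (a, b \<oplus>\<^bsub>B\<^esub> b') - frag_of (a, b) - frag_of (a, b')"
      "a \<in> carrier A" "b \<in> carrier B" "b' \<in> carrier B"
    then show "?h r = \<zero>\<^bsub>B\<^esub>"
      by (simp add: diff closed frag ev del: pair_ring_simps) (simp add: B.r_distr cancel)
  next
    fix s a b assume "r = frag_of (\<phi> s \<otimes>\<^bsub>A\<^esub> a, b) - frag_of (a, \<psi> s \<otimes>\<^bsub>B\<^esub> b)"
      "s \<in> S" "a \<in> carrier A" "b \<in> carrier B"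
    moreover from this have "f a \<otimes>\<^bsub>B\<^esub> (\<psi> s \<otimes>\<^bsub>B\<^esub> b) = (\<psi> s \<otimes>\<^bsub>B\<^esub> f a) \<otimes>\<^bsub>B\<^esub> b"
      using \<psi> by (simp add: B.m_ac)
    ultimately show "?h r = \<zero>\<^bsub>B\<^esub>"
      using \<phi> \<psi> compat
      by (simp add: diff closed frag ev del: pair_ring_simps)
  qed
  then have "tensor_relations S \<phi> \<psi> A B \<subseteq> a_kernel ?P B ?h"
    using T.tensor_relations_subset unfolding a_kernel_def' by blast
  from T.tensor_ideal_minimal[OF h.kernel_is_ideal this] c
  show ?thesis unfolding a_kernel_def' by blast
qed

section \<open>Closed points as homomorphisms to \<open>K\<close>\<close>

context
  fixes sc :: "complex \<Rightarrow> 'v::ab_group_add \<Rightarrow> 'v" and B :: "'v set"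
    and G :: "(complex^'m^'m) set" and \<rho> :: "complex^'m^'m \<Rightarrow> 'v \<Rightarrow> 'v"
    and K :: "'k ring" and \<iota> :: "(('v \<Rightarrow> complex) \<times> ('v \<Rightarrow> complex)) set \<Rightarrow> 'k"
  assumes V: "finite_dimensional_vector_space sc B"
    and K: "field K" "has_roots K"
    and hom: "invariant_to_K sc \<iota> \<in> ring_hom (coord_ring sc\<lparr>carrier := invariants sc G \<rho>\<rparr>) K"
begin

abbreviation (input) "AA \<equiv> coord_ring sc"
abbreviation (input) "\<kappa> \<equiv> invariant_to_K sc \<iota>"
abbreviation (input) "II \<equiv> tensor_ideal (invariants sc G \<rho>) id \<kappa> AA K"
abbreviation (input) "TT \<equiv> tensor_over_invariants sc G \<rho> K \<iota>"
abbreviation (input) "PP \<equiv> pair_ring AA K"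

interpretation A: cring AA by (rule cring_coord_ring)
interpretation K: field K by (rule K(1))

lemma invariants_closed: "s \<in> invariants sc G \<rho> \<Longrightarrow> id s \<in> carrier AA"
  by (simp add: invariants_def)

lemma invariant_to_K_closed: "s \<in> invariants sc G \<rho> \<Longrightarrow> \<kappa> s \<in> carrier K"
  using ring_hom_closed[OF hom] by simp

interpretation R: tensor_product "invariants sc G \<rho>" id \<kappa> AA K
  by (rule tensor_product.intro[OF A.is_cring K.is_cring invariants_closed invariant_to_K_closed])

interpretation C: tensor_product UNIV "\<lambda>c _. c" "\<lambda>c. \<kappa> (\<lambda>_. c)" AA K
  by (rule tensor_product.intro[OF A.is_cring K.is_cring])
    (auto simp: polynomial_functions.const invariant_to_K_closed const_in_invariants)

interpretation T: cring TT
  unfolding tensor_over_invariants_def by (rule R.cring_tensor_ring)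

text \<open>Members of one coset of the smaller ideal differ by elements of the larger one, so the
  set in \<open>change_of_base\<close> is a singleton and \<open>the_elem\<close> is
  meaningful.\<close>

lemma change_of_base_coset:
  assumes "c \<in> carrier PP"
  shows "change_of_base sc G \<rho> K \<iota> (tensor_ideal UNIV (\<lambda>c _. c) (\<lambda>c. \<kappa> (\<lambda>_. c)) AA K +>\<^bsub>PP\<^esub> c)
    = II +>\<^bsub>PP\<^esub> c"
proof -
  let ?I = "tensor_ideal UNIV (\<lambda>c _. c) (\<lambda>c. \<kappa> (\<lambda>_. c)) AA K"
  interpret I: ideal ?I PP by (rule C.tensor_ideal_ideal)
  have sub: "?I \<subseteq> II"
  proof (rule tensor_ideal_subset[OF A.is_cring K.is_cring])
    show "\<exists>s'\<in>invariants sc G \<rho>. (\<lambda>_. c) = id s' \<and> \<kappa> (\<lambda>_. c) = \<kappa> s'" for c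
      using const_in_invariants[of c sc G \<rho>] by (intro bexI[of _ "\<lambda>_. c"]) auto
  qed (auto simp: invariants_def invariant_to_K_closed)
  have "(\<lambda>d. II +>\<^bsub>PP\<^esub> d) ` (?I +>\<^bsub>PP\<^esub> c) = {II +>\<^bsub>PP\<^esub> c}"
  proof -
    have "II +>\<^bsub>PP\<^esub> d = II +>\<^bsub>PP\<^esub> c" if d: "d \<in> ?I +>\<^bsub>PP\<^esub> c" for d
    proof -
      obtain x where x: "x \<in> ?I" "d = x + c" using d by (auto simp: a_r_coset_def')
      have "x \<in> carrier PP" using I.Icarr[OF x(1)] .
      then have "d \<in> carrier PP" using x R.P.a_closed[OF _ assms, of x] by simp
      then show ?thesis
        using R.tensor_coset_eq_iff[of d c] assms x sub by auto
    qed
    moreover have "c \<in> ?I +>\<^bsub>PP\<^esub> c" using I.a_rcos_self[OF assms] .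
    ultimately show ?thesis by blast
  qed
  then show ?thesis by (simp add: change_of_base_def)
qed

text \<open>The surjection takes f \<otimes> 1 to f \<otimes> 1, so the passage through the tensor
  product over the complex numbers cancels and the contraction is read off from \<open>p\<close>
  directly.\<close>

lemma contraction_point_ideal:
  "contraction sc K \<iota> (point_ideal sc G \<rho> K \<iota> p) =
    {f \<in> polynomial_functions sc. II +>\<^bsub>PP\<^esub> frag_of (f, \<one>\<^bsub>K\<^esub>) \<in> p}"
proof -
  let ?I = "tensor_ideal UNIV (\<lambda>c _. c) (\<lambda>c. \<kappa> (\<lambda>_. c)) AA K"
  have "pure_tensor UNIV (\<lambda>c _. c) (\<lambda>c. \<kappa> (\<lambda>_. c)) AA K f \<one>\<^bsub>K\<^esub> \<in> point_ideal sc G \<rho> K \<iota> p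
      \<longleftrightarrow> II +>\<^bsub>PP\<^esub> frag_of (f, \<one>\<^bsub>K\<^esub>) \<in> p" if f: "f \<in> polynomial_functions sc" for f
  proof -
    have c: "frag_of (f, \<one>\<^bsub>K\<^esub>) \<in> carrier PP" using f by simp
    have "?I +>\<^bsub>PP\<^esub> frag_of (f, \<one>\<^bsub>K\<^esub>) \<in> carrier (tensor_over_complex sc K \<iota>)"
      unfolding tensor_over_complex_def
      unfolding C.carrier_tensor_ring using c by (rule imageI)
    then show ?thesis
      using change_of_base_coset[OF c] by (simp add: pure_tensor_def point_ideal_def)
  qed
  then show ?thesis by (auto simp: contraction_def)
qed

text \<open>The residue field is generated over \<open>K\<close> by the images of the coordinates,
  so the identity of \<open>K\<close> extends to it. A map of fields is injective; hence f \<otimes>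
  1 lies in \<open>p\<close> exactly when its image in \<open>K\<close> is zero.\<close>

lemma hom_of_closed_point:
  assumes "p \<in> closed_points sc G \<rho> K \<iota>"
  obtains \<eta> where "\<eta> \<in> ring_hom AA K" "\<forall>s\<in>invariants sc G \<rho>. \<eta> s = \<kappa> s"
    "contraction sc K \<iota> (point_ideal sc G \<rho> K \<iota> p) = {f \<in> polynomial_functions sc. \<eta> f = \<zero>\<^bsub>K\<^esub>}"
proof -
  have p: "maximalideal p TT" using assms by (simp add: closed_points_def)
  interpret p: maximalideal p TT by (rule p)
  let ?L = "TT Quot p"
  have L: "field ?L" by (rule p.quotient_is_field[OF T.is_cring])
  interpret L: field ?L by (rule L)
  define q where "q = (\<lambda>x. p +>\<^bsub>TT\<^esub> x)"
  have q: "q \<in> ring_hom TT ?L" unfolding q_def by (rule p.rcos_ring_hom)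
  have q': "q \<in> ring_hom (tensor_ring (invariants sc G \<rho>) id \<kappa> AA K) ?L"
    using q by (simp add: tensor_over_invariants_def)
  have carL: "carrier ?L = q ` carrier TT"
    by (auto simp: FactRing_def A_RCOSETS_def' q_def)
  have q0: "q x = \<zero>\<^bsub>?L\<^esub> \<longleftrightarrow> x \<in> p" if "x \<in> carrier TT" for x
    using p.rcos_const_imp_mem[OF that] T.a_rcos_zero[OF p.is_ideal] by (auto simp: q_def FactRing_def)
  define \<pi> where "\<pi> = (\<lambda>f. q (II +>\<^bsub>PP\<^esub> frag_of (f, \<one>\<^bsub>K\<^esub>)))"
  define k where "k = (\<lambda>y. q (II +>\<^bsub>PP\<^esub> frag_of (\<one>\<^bsub>AA\<^esub>, y)))"
  have \<pi>: "\<pi> \<in> ring_hom AA ?L"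
    unfolding \<pi>_def by (rule R.tensor_hom_left[OF L.ring_axioms q'])
  have k: "k \<in> ring_hom K ?L"
    unfolding k_def by (rule R.tensor_hom_right[OF L.ring_axioms q'])
  have balanced: "\<pi> s = k (\<kappa> s)" if "s \<in> invariants sc G \<rho>" for s
    using R.tensor_hom_balanced[OF that] by (simp add: \<pi>_def k_def)
  have inj: "inj_on k (carrier K)"
    using non_trivial_field_hom_is_inj[OF k K(1) L] by simp
  have X: "\<pi> ` coordinates sc B \<subseteq> carrier ?L"
    using coordinates_subset[OF V] ring_hom_closed[OF \<pi>] by auto
  obtain T where T: "subring T ?L" "k ` carrier K \<subseteq> T" "\<pi> ` coordinates sc B \<subseteq> T"
    and T_ext: "\<And>b. b \<in> T \<Longrightarrow> b \<noteq> \<zero>\<^bsub>?L\<^esub> \<Longrightarrow>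
      \<exists>a\<in>carrier K. a \<noteq> \<zero>\<^bsub>K\<^esub> \<and> (\<forall>\<phi>\<in>ring_hom K K. \<phi> a \<noteq> \<zero>\<^bsub>K\<^esub> \<longrightarrow>
        (\<exists>\<psi>\<in>ring_hom (?L\<lparr>carrier := T\<rparr>) K. (\<forall>d\<in>carrier K. \<psi> (k d) = \<phi> d) \<and> \<psi> b \<noteq> \<zero>\<^bsub>K\<^esub>))"
    using finite_hom_extension[OF K.domain_axioms L.domain_axioms k inj
        finite_imageI[OF finite_coordinates[OF V]] X K] by blast
  have \<pi>T: "\<pi> ` polynomial_functions sc \<subseteq> T"
  proof (rule image_polynomial_functions_subset[OF V \<pi> T(1) _ T(3)])
    \<comment> \<open>Balancing moves a constant, being invariant, into the factor
      \<open>K\<close>.\<close>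
    show "\<pi> (\<lambda>_. c) \<in> T" for c
      using T(2) invariant_to_K_closed[OF const_in_invariants] by (auto simp: balanced const_in_invariants)
  qed
  have "q ` carrier (tensor_ring (invariants sc G \<rho>) id \<kappa> AA K) \<subseteq> T"
  proof (rule R.tensor_hom_image_subset[OF L.ring_axioms q' T(1)])
    show "q (II +>\<^bsub>PP\<^esub> frag_of (a, \<one>\<^bsub>K\<^esub>)) \<in> T" if "a \<in> carrier AA" for a
      using \<pi>T that by (auto simp: \<pi>_def)
    show "q (II +>\<^bsub>PP\<^esub> frag_of (\<one>\<^bsub>AA\<^esub>, y)) \<in> T" if "y \<in> carrier K" for y
      using T(2) that by (auto simp: k_def)
  qed
  then have "T = carrier ?L"
    using subringE(1)[OF T(1)] carL by (auto simp: tensor_over_invariants_def)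
  \<comment> \<open>Only 1 has to survive, and the identity of \<open>K\<close> meets the condition
    on \<open>a\<close>.\<close>
  with T_ext[of "\<one>\<^bsub>?L\<^esub>"] obtain a where a: "a \<noteq> \<zero>\<^bsub>K\<^esub>"
    "\<forall>\<phi>\<in>ring_hom K K. \<phi> a \<noteq> \<zero>\<^bsub>K\<^esub> \<longrightarrow>
        (\<exists>\<psi>\<in>ring_hom ?L K. (\<forall>d\<in>carrier K. \<psi> (k d) = \<phi> d) \<and> \<psi> \<one>\<^bsub>?L\<^esub> \<noteq> \<zero>\<^bsub>K\<^esub>)"
    by auto
  have "id \<in> ring_hom K K" by (auto simp: ring_hom_def)
  with a obtain \<psi> where \<psi>: "\<psi> \<in> ring_hom ?L K" "\<forall>d\<in>carrier K. \<psi> (k d) = d"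
    by fastforce
  have \<psi>_inj: "inj_on \<psi> (carrier ?L)"
    using non_trivial_field_hom_is_inj[OF \<psi>(1) L K(1)] by simp
  have \<psi>0: "\<psi> \<zero>\<^bsub>?L\<^esub> = \<zero>\<^bsub>K\<^esub>" by (rule ring_hom_zero[OF \<psi>(1) L.ring_axioms K.ring_axioms])
  show thesis
  proof
    show "\<psi> \<circ> \<pi> \<in> ring_hom AA K" by (rule ring_hom_trans[OF \<pi> \<psi>(1)])
    show "\<forall>s\<in>invariants sc G \<rho>. (\<psi> \<circ> \<pi>) s = \<kappa> s"
      using balanced \<psi>(2) invariant_to_K_closed by simp
    have "II +>\<^bsub>PP\<^esub> frag_of (f, \<one>\<^bsub>K\<^esub>) \<in> p \<longleftrightarrow> (\<psi> \<circ> \<pi>) f = \<zero>\<^bsub>K\<^esub>"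
      if f: "f \<in> polynomial_functions sc" for f
    proof -
      have "frag_of (f, \<one>\<^bsub>K\<^esub>) \<in> carrier PP" using f by simp
      then have "II +>\<^bsub>PP\<^esub> frag_of (f, \<one>\<^bsub>K\<^esub>) \<in> carrier TT"
        unfolding tensor_over_invariants_def R.carrier_tensor_ring by (rule imageI)
      from q0[OF this] have "II +>\<^bsub>PP\<^esub> frag_of (f, \<one>\<^bsub>K\<^esub>) \<in> p \<longleftrightarrow> \<pi> f = \<zero>\<^bsub>?L\<^esub>"
        by (simp add: \<pi>_def)
      also have "\<dots> \<longleftrightarrow> \<psi> (\<pi> f) = \<psi> \<zero>\<^bsub>?L\<^esub>"
        using inj_on_eq_iff[OF \<psi>_inj, of "\<pi> f" "\<zero>\<^bsub>?L\<^esub>"] ring_hom_closed[OF \<pi>, of f] f by simp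
      finally show ?thesis by (simp add: \<psi>0)
    qed
    then show "contraction sc K \<iota> (point_ideal sc G \<rho> K \<iota> p) =
        {f \<in> polynomial_functions sc. (\<psi> \<circ> \<pi>) f = \<zero>\<^bsub>K\<^esub>}"
      unfolding contraction_point_ideal by blast
  qed
qed

text \<open>The map sending a \<otimes> y to \<eta>(a) y is onto \<open>K\<close>, already on the
  elements 1 \<otimes> y, so its kernel is maximal; and it takes f \<otimes> 1 to \<eta> f.\<close>

lemma closed_point_of_hom:
  assumes \<eta>: "\<eta> \<in> ring_hom AA K" "\<And>s. s \<in> invariants sc G \<rho> \<Longrightarrow> \<eta> s = \<kappa> s"
  obtains p where "p \<in> closed_points sc G \<rho> K \<iota>"
    "contraction sc K \<iota> (point_ideal sc G \<rho> K \<iota> p) = {f \<in> polynomial_functions sc. \<eta> f = \<zero>\<^bsub>K\<^esub>}"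
proof -
  let ?h = "pair_eval K \<eta>"
  note eta = A.is_cring K.is_cring \<eta>(1)
  have h: "?h \<in> ring_hom PP K" by (rule pair_eval_hom[OF eta])
  have coset: "(\<lambda>c. II +>\<^bsub>PP\<^esub> c) \<in> ring_hom PP TT"
    unfolding tensor_over_invariants_def by (rule R.tensor_coset_hom)
  have car: "carrier TT = (\<lambda>c. II +>\<^bsub>PP\<^esub> c) ` carrier PP"
    unfolding tensor_over_invariants_def by (rule R.carrier_tensor_ring)
  have ker: "?h c = \<zero>\<^bsub>K\<^esub>" if c: "c \<in> carrier PP" "II +>\<^bsub>PP\<^esub> c = \<zero>\<^bsub>TT\<^esub>" for c
  proof -
    have cI: "c \<in> II"
      using ideal.rcos_const_imp_mem[OF R.tensor_ideal_ideal c(1)] c(2)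
      by (simp add: tensor_over_invariants_def tensor_ring_def FactRing_def)
    show ?thesis
      by (rule pair_eval_tensor_ideal[OF eta R.\<phi> R.\<psi> _ cI]) (simp_all add: \<eta>(2))
  qed
  \<comment> \<open>The carrier of \<open>TT\<close> is the image of the coset map, so factoring
    through that image defines \<open>g\<close> on all of \<open>TT\<close>.\<close>
  obtain g where g': "g \<in> ring_hom (TT\<lparr>carrier := (\<lambda>c. II +>\<^bsub>PP\<^esub> c) ` carrier PP\<rparr>) K"
    and gh: "\<And>c. c \<in> carrier PP \<Longrightarrow> g (II +>\<^bsub>PP\<^esub> c) = ?h c"
    using ring_hom_factor[OF R.P.ring_axioms T.ring_axioms K.ring_axioms coset h ker] by blast
  have g: "g \<in> ring_hom TT K" using g' unfolding car[symmetric] by simp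
  have h_of: "?h (frag_of (f, y)) = \<eta> f \<otimes>\<^bsub>K\<^esub> y" if "f \<in> carrier AA" "y \<in> carrier K" for f y
    using pair_eval_frag_of[OF eta that] .
  have surj: "g ` carrier TT = carrier K"
  proof
    show "g ` carrier TT \<subseteq> carrier K" using ring_hom_closed[OF g] by blast
    show "carrier K \<subseteq> g ` carrier TT"
    proof
      fix y assume y: "y \<in> carrier K"
      have frag: "frag_of (\<one>\<^bsub>AA\<^esub>, y) \<in> carrier PP" using y A.one_closed by simp
      have "g (II +>\<^bsub>PP\<^esub> frag_of (\<one>\<^bsub>AA\<^esub>, y)) = y"
        using gh[OF frag] h_of[OF A.one_closed y] ring_hom_one[OF \<eta>(1)] y by simp
      then show "y \<in> g ` carrier TT"
        unfolding car using frag by (metis imageI)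
    qed
  qed
  have max: "maximalideal (a_kernel TT K g) TT"
    by (rule kernel_of_surjection_maximal[OF T.is_cring K(1) g surj])
  have mem: "II +>\<^bsub>PP\<^esub> frag_of (f, \<one>\<^bsub>K\<^esub>) \<in> a_kernel TT K g \<longleftrightarrow> \<eta> f = \<zero>\<^bsub>K\<^esub>"
    if f: "f \<in> polynomial_functions sc" for f
  proof -
    have frag: "frag_of (f, \<one>\<^bsub>K\<^esub>) \<in> carrier PP" using f by simp
    have "g (II +>\<^bsub>PP\<^esub> frag_of (f, \<one>\<^bsub>K\<^esub>)) = \<eta> f"
      using gh[OF frag] h_of[of f "\<one>\<^bsub>K\<^esub>"] ring_hom_closed[OF \<eta>(1), of f] f by simp
    moreover have "II +>\<^bsub>PP\<^esub> frag_of (f, \<one>\<^bsub>K\<^esub>) \<in> carrier TT" unfolding car using frag by (rule imageI)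
    ultimately show ?thesis unfolding a_kernel_def' by simp
  qed
  show thesis
  proof (rule that)
    show "a_kernel TT K g \<in> closed_points sc G \<rho> K \<iota>"
      using max by (simp add: closed_points_def)
    show "contraction sc K \<iota> (point_ideal sc G \<rho> K \<iota> (a_kernel TT K g)) =
        {f \<in> polynomial_functions sc. \<eta> f = \<zero>\<^bsub>K\<^esub>}"
      unfolding contraction_point_ideal using mem by blast
  qed
qed

end

theorem proposition3:
  fixes sc :: "complex \<Rightarrow> 'v::ab_group_add \<Rightarrow> 'v" and B :: "'v set"
    and G :: "(complex^'m^'m) set" and \<rho> :: "complex^'m^'m \<Rightarrow> 'v \<Rightarrow> 'v"
    and K :: "'k ring" and \<iota> :: "(('v \<Rightarrow> complex) \<times> ('v \<Rightarrow> complex)) set \<Rightarrow> 'k"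
  assumes "finite_dimensional_vector_space sc B"
    and "reductive_group G"
    and "rational_representation sc G \<rho>"
    and "rational_invariants sc G \<rho> = fractions_of_invariants sc G \<rho>"
    and "\<iota> \<in> ring_hom (rational_invariant_field sc G \<rho>) K"
    and "algebraic_closure K (\<iota> ` rational_invariants sc G \<rho>)"
  shows "(\<forall>p \<in> closed_points sc G \<rho> K \<iota>.
            (\<exists>!Y. is_extension_subvariety sc G \<rho> K \<iota> p Y) \<and>
            (\<forall>Y. is_extension_subvariety sc G \<rho> K \<iota> p Y \<longrightarrow>
              closed_subvariety sc Y \<and> restriction_injective sc G \<rho> Y \<and>
              algebraic_over_invariants sc G \<rho> Y)) \<and>
         (\<forall>Y. closed_subvariety sc Y \<and> restriction_injective sc G \<rho> Y \<and>
              algebraic_over_invariants sc G \<rho> Y \<longrightarrow>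
            (\<exists>p \<in> closed_points sc G \<rho> K \<iota>. is_extension_subvariety sc G \<rho> K \<iota> p Y))"
proof -
  interpret K: algebraic_closure K "\<iota> ` rational_invariants sc G \<rho>" by (rule assms(6))
  note V = assms(1)
  note vs = finite_dimensional_vector_space.axioms(1)[OF V]
  note inv = vs K.field_axioms assms(4,5)
  note hom = invariant_to_K_hom[OF inv]
  note subvar = V assms(6) hom invariant_to_K_inj[OF inv] rational_invariants_fractions[OF inv]
  note point = V K.field_axioms K.has_roots hom
  show ?thesis
  proof (intro conjI ballI allI impI)
    fix p assume p: "p \<in> closed_points sc G \<rho> K \<iota>"
    obtain \<eta> where \<eta>: "\<eta> \<in> ring_hom (coord_ring sc) K"
      "\<forall>s\<in>invariants sc G \<rho>. \<eta> s = invariant_to_K sc \<iota> s"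
      "contraction sc K \<iota> (point_ideal sc G \<rho> K \<iota> p) = {f \<in> polynomial_functions sc. \<eta> f = \<zero>\<^bsub>K\<^esub>}"
      by (rule hom_of_closed_point[OF point p])
    \<comment> \<open>\<open>p\<close> enters \<open>is_extension_subvariety\<close> only through
      the contraction, which is now the kernel of \<eta>.\<close>
    show "\<exists>!Y. is_extension_subvariety sc G \<rho> K \<iota> p Y"
      unfolding is_extension_subvariety_def \<eta>(3)
      by (rule ex1_subvariety_of_hom[OF V K.field_axioms \<eta>(1)])
    fix Y assume "is_extension_subvariety sc G \<rho> K \<iota> p Y"
    then have Y: "closed_subvariety sc Y" "vanishing_ideal sc Y = {f \<in> polynomial_functions sc. \<eta> f = \<zero>\<^bsub>K\<^esub>}"
      unfolding is_extension_subvariety_def \<eta>(3) by auto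
    show "closed_subvariety sc Y" by (rule Y(1))
    show "restriction_injective sc G \<rho> Y"
      by (rule restriction_injective_of_hom[OF subvar \<eta>(1) bspec[OF \<eta>(2)] Y(2)])
    show "algebraic_over_invariants sc G \<rho> Y"
      by (rule algebraic_over_invariants_of_hom[OF subvar \<eta>(1) bspec[OF \<eta>(2)] Y(2)])
  next
    fix Y assume Y: "closed_subvariety sc Y \<and> restriction_injective sc G \<rho> Y \<and>
      algebraic_over_invariants sc G \<rho> Y"
    \<comment> \<open>This choice is where uniqueness of the point may be lost: composing \<eta>
      with an automorphism of \<open>K\<close> that fixes the image of C(V)^G may change \<eta> but
      not its kernel.\<close>
    obtain \<eta> where \<eta>: "\<eta> \<in> ring_hom (coord_ring sc) K"
      "\<forall>s\<in>invariants sc G \<rho>. \<eta> s = invariant_to_K sc \<iota> s"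
      "vanishing_ideal sc Y = {f \<in> polynomial_functions sc. \<eta> f = \<zero>\<^bsub>K\<^esub>}"
      by (rule hom_of_subvariety[OF subvar, of Y]) (use Y in auto)
    obtain p where "p \<in> closed_points sc G \<rho> K \<iota>"
      "contraction sc K \<iota> (point_ideal sc G \<rho> K \<iota> p) = {f \<in> polynomial_functions sc. \<eta> f = \<zero>\<^bsub>K\<^esub>}"
      by (rule closed_point_of_hom[OF point \<eta>(1) bspec[OF \<eta>(2)]])
    then show "\<exists>p \<in> closed_points sc G \<rho> K \<iota>. is_extension_subvariety sc G \<rho> K \<iota> p Y"
      using Y \<eta>(3) by (auto simp: is_extension_subvariety_def)
  qed
qed

end
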